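(* Let $a:\Omega_{t,x}\times V\times V\to\mathbb{R}$ satisfy: (i) $(t,x)\mapsto a((t,x);\phi,\psi)$ is measurable on $\Omega_{t,x}$ for all $\phi,\psi\in V$; (ii) $a((t,x);\cdot,\cdot)$ is bilinear for a.e. $(t,x)\in\Omega_{t,x}$; (iii) $a((t,x);\phi,\psi)\le c_a\|\phi\|_V\|\psi\|_V$ for all $\phi,\psi\in V$ and a.e. $(t,x)$, with $c_a<\infty$; (iv) $a((t,x);\phi,\phi)+\lambda_a\|\phi\|_{L^2(\Omega_v)}^2\ge\alpha_a\|\phi\|_V^2$ for all $\phi\in V$ and a.e. $(t,x)$, with $\alpha_a>0$ and $\lambda_a\le0$ (so that $a$ is coercive) ($c_a,\lambda_a,\alpha_a$ independent of $(t,x)$). Define $b:\mathcal{X}\times\mathcal{Y}\to\mathbb{R}$ by $$b(w,p):=\int_{\Omega_{t,x}}\langle w(t,x),-k\cdot\nabla_{t,x}p(t,x)\rangle_{V,V'}+a((t,x);w(t,x),p(t,x))\,\mathrm{d}(t,x),$$ and $f\in\mathcal{Y}'$ by $f(p):=\int_{\Gamma_-}g\,p\,|k\cdot n|\,\mathrm{d}s$ with $g\in L^2(\Gamma_-,|k\cdot n|)$. Let $V_h\subset V$ be a finite-dimensional subspace and let $\mathcal{Y}_\delta\subset\mathcal{Y}$ be a finite-dimensional subspace such that $p^\delta(t,x)\in V_h$ for all $p^\delta\in\mathcal{Y}_\delta$ and a.e. $(t,x)\in\Omega_{t,x}$. For $p^\delta\in\mathcal{Y}_\delta$ let $r_p^\delta:=-k\cdot\nabla_{t,x}p^\delta\in\mathcal{X}'$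 and let $z_p^\delta\in\mathcal{X}$, with $z_p^\delta(t,x)\in V_h$ for a.e. $(t,x)$, be the solution of $$a((t,x);z_p^\delta(t,x),\phi^h)=\langle r_p^\delta(t,x),\phi^h\rangle_{V',V}\qquad\forall\,\phi^h\in V_h,\ \text{a.e. }(t,x)\in\Omega_{t,x}.$$ Define the discrete trial space $\mathcal{X}_\delta:=\{p^\delta+z_p^\delta:\ p^\delta\in\mathcal{Y}_\delta\}\subset\mathcal{X}$. Then there exists a unique $u^\delta\in\mathcal{X}_\delta$ such that $$b(u^\delta,v^\delta)=f(v^\delta)\qquad\forall\,v^\delta\in\mathcal{Y}_\delta.$$ Moreover, the discrete inf-sup estimate $$\inf_{0\ne p^\delta\in\mathcal{Y}_\delta}\ \sup_{0\ne w^\delta\in\mathcal{X}_\delta}\frac{b(w^\delta,p^\delta)}{\|w^\delta\|_{\mathcal{X}}\|p^\delta\|_{\mathcal{Y}_\delta}}\ \ge\ \beta_\delta\ \ge\ \frac{\alpha_a}{\sqrt2\,\max\{1,c_a\}}$$ holds, where $$\|w\|_{\mathcal{Y}_\delta}^2:=\|w\|_{L^2(\Omega_{t,x};V)}^2+\int_{\Omega_{t,x}}\|(k\cdot\nabla_{t,x}w)(t,x)\|_{V_h'}^2\,\mathrm{d}(t,x),\qquad \|\psi\|_{V_h'}:=\sup_{0\ne\phi^h\in V_h}\frac{\langle\psi,\phi^h\rangle_{V',V}}{\|\phi^h\|_V}.$$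
   Context: Domains: $d\in\{2,3\}$; $\Omega_x\subset\mathbb{R}^d$ is a domain with piecewise $C^1$ boundary that is globally Lipschitz; $T>0$, $I_t=(0,T)$; $\Omega_v=S^{d-1}$ is the unit sphere in $\mathbb{R}^d$; $\Omega_{t,x}=I_t\times\Omega_x$; $\Omega=\Omega_{t,x}\times\Omega_v$. The kinetic advection field is $k((t,x),v)=(1,v)\in\mathbb{R}^{d+1}$, so $k\cdot\nabla_{t,x}p=\partial_tp+v\cdot\nabla_xp$. With $n=n(t,x)$ the unit outer normal to $\partial\Omega_{t,x}$ (at boundary points where the boundary is $C^1$), the outflow and inflow boundaries are $\Gamma_\pm=\{((t,x),v)\in\partial\Omega_{t,x}\times\Omega_v:\ k\cdot n(t,x)\gtrless0\}$. Spaces: $V=H^1(\Omega_v)$ with $\|\phi\|_V^2=\|\phi\|_{L^2(\Omega_v)}^2+\|\nabla_v\phi\|_{L^2(\Omega_v)}^2$ ($\nabla_v$ the tangential gradient), $V'$ its dual, with Gelfand triple $V\hookrightarrow L^2(\Omega_v)\hookrightarrow V'$. $H^1_{\mathrm{FP}}(\Omega)=\{p\in L^2(\Omega_{t,x};V):\ k\cdot\nabla_{t,x}p\in L^2(\Omega_{t,x};V')\}$, where $k\cdot\nabla_{t,x}p$ is the weak derivative, i.e. $\int_{\Omega_{t,x}}\langle k\cdot\nabla_{t,x}p,\phi\rangle_{V',V}\,\psi\,\mathrm{d}(t,x)=-\int_{\Omega}p\,\phi\,(k\cdot\nabla_{t,x}\psi)$ for all $\psi\in C_0^\infty(\Omega_{t,x})$,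 $\phi\in V$; its norm is $\|p\|_{H^1_{\mathrm{FP}}(\Omega)}^2=\|p\|_{L^2(\Omega_{t,x};V)}^2+\|k\cdot\nabla_{t,x}p\|_{L^2(\Omega_{t,x};V')}^2$. $C^\infty(\bar\Omega)$ denotes the restrictions to $\bar\Omega$ of compactly supported smooth functions on $\mathbb{R}^{d+1}\times S^{d-1}$. $H^1_{\mathrm{FP},\Gamma_\pm}(\Omega)$ is the closure of $\{f\in C^\infty(\bar\Omega):f\equiv0\text{ on }\Gamma_\pm\}$ in $\|\cdot\|_{H^1_{\mathrm{FP}}(\Omega)}$. $\mathcal{X}=L^2(\Omega_{t,x};V)$ with $\|w\|_{\mathcal{X}}^2=\int_{\Omega_{t,x}}\|w(t,x)\|_V^2\,\mathrm{d}(t,x)$, and $\mathcal{Y}=H^1_{\mathrm{FP},\Gamma_+}(\Omega)$ with $\|p\|_{\mathcal{Y}}^2=\|p\|_{\mathcal{X}}^2+\|k\cdot\nabla_{t,x}p\|_{\mathcal{X}'}^2$, $\mathcal{X}'=L^2(\Omega_{t,x};V')$. For $\Gamma\subset\partial\Omega_{t,x}\times\Omega_v$, $\|w\|_{L^2(\Gamma,|k\cdot n|)}^2=\int_\Gamma w^2|k\cdot n|\,\mathrm{d}s$. The restriction $w\mapsto w|_{\Gamma_-}$ on smooth functions vanishing on $\Gamma_+$ extends to a continuous trace operator $\gamma_-:\mathcal{Y}\to L^2(\Gamma_-,|k\cdot n|)$; in $f(p)$ the value of $p$ on $\Gamma_-$ means $\gamma_-(p)$. *)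

theory Defs
  imports "HOL-Analysis.Analysis"
begin

section \<open>Smooth functions\<close>

primrec Ck :: "nat \<Rightarrow> ('a::euclidean_space \<Rightarrow> real) \<Rightarrow> bool" where
  "Ck 0 f \<longleftrightarrow> continuous_on UNIV f"
| "Ck (Suc k) f \<longleftrightarrow> (\<forall>x. f differentiable (at x)) \<and>
     (\<forall>b\<in>Basis. Ck k (\<lambda>x. frechet_derivative f (at x) b))"

definition smooth :: "('a::euclidean_space \<Rightarrow> real) \<Rightarrow> bool" where
  "smooth f \<longleftrightarrow> (\<forall>k. Ck k f)"

definition supp :: "('a::topological_space \<Rightarrow> real) \<Rightarrow> 'a set" where
  "supp f = closure {x. f x \<noteq> 0}"

definition test_function :: "'a::euclidean_space set \<Rightarrow> ('a \<Rightarrow> real) \<Rightarrow> bool" where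
  "test_function U \<psi> \<longleftrightarrow> smooth \<psi> \<and> compact (supp \<psi>) \<and> supp \<psi> \<subseteq> U"

lemma Ck_const: "Ck k (\<lambda>x. c)"
  by (induction k arbitrary: c) (auto simp: frechet_derivative_const)

lemma Ck_imp_continuous: "Ck k f \<Longrightarrow> continuous_on UNIV f"
  by (cases k) (auto intro: differentiable_imp_continuous_on simp: differentiable_on_def
      differentiable_at_withinI)

lemma Ck_SucD: "Ck (Suc k) f \<Longrightarrow> Ck k f"
proof (induction k arbitrary: f)
  case 0
  then show ?case using Ck_imp_continuous[of "Suc 0" f] by simp
next
  case (Suc k)
  then have "Ck k (\<lambda>x. frechet_derivative f (at x) b)" if "b \<in> Basis" for b
    using Suc.IH[of "\<lambda>x. frechet_derivative f (at x) b"] that by simp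
  with Suc.prems show ?case by auto
qed

lemma frechet_eq: "(f has_derivative f') (at x) \<Longrightarrow> frechet_derivative f (at x) = f'"
  using frechet_derivative_at by metis

lemma Ck_add: "Ck k f \<Longrightarrow> Ck k g \<Longrightarrow> Ck k (\<lambda>x. f x + g x)"
proof (induction k arbitrary: f g)
  case 0
  then show ?case by (auto intro: continuous_intros)
next
  case (Suc k)
  have "frechet_derivative (\<lambda>x. f x + g x) (at x) =
      (\<lambda>h. frechet_derivative f (at x) h + frechet_derivative g (at x) h)" for x
    using Suc.prems by (intro frechet_eq has_derivative_add) (auto simp: frechet_derivative_works)
  with Suc show ?case by auto
qed

lemma Ck_mult: "Ck k f \<Longrightarrow> Ck k g \<Longrightarrow> Ck k (\<lambda>x. f x * g x)"
proof (induction k arbitrary: f g)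
  case 0
  then show ?case by (auto intro: continuous_intros)
next
  case (Suc k)
  have eq: "frechet_derivative (\<lambda>x. f x * g x) (at x) =
      (\<lambda>h. f x * frechet_derivative g (at x) h + frechet_derivative f (at x) h * g x)" for x
    using Suc.prems by (intro frechet_eq has_derivative_mult) (auto simp: frechet_derivative_works)
  have "Ck k f" "Ck k g" using Suc.prems Ck_SucD by blast+
  with Suc show ?case by (auto simp: eq intro!: Ck_add)
qed

lemma smooth_polynomial: "real_polynomial_function f \<Longrightarrow> smooth f"
  unfolding smooth_def
proof (induction rule: real_polynomial_function.induct)
  case (linear f)
  show ?case
  proof
    fix k
    have d: "(f has_derivative f) (at x)" for x
      using linear bounded_linear_imp_has_derivative by blast
    show "Ck k f"
    proof (cases k)
      case 0
      then show ?thesis using linear by (simp add: linear_continuous_on)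
    next
      case (Suc n)
      then show ?thesis using d frechet_eq[OF d] by (auto simp: Ck_const differentiable_def)
    qed
  qed
qed (auto intro: Ck_const Ck_add Ck_mult)

lemma smooth_continuous: "smooth f \<Longrightarrow> continuous_on UNIV f"
  unfolding smooth_def using Ck.simps(1) by blast

section \<open>Lebesgue spaces\<close>

definition L2_functions :: "'a measure \<Rightarrow> ('a \<Rightarrow> 'b::{second_countable_topology, real_normed_vector}) set" where
  "L2_functions M = {f \<in> borel_measurable M. integrable M (\<lambda>x. (norm (f x))\<^sup>2)}"

lemma L2_measurable: "f \<in> L2_functions M \<Longrightarrow> f \<in> borel_measurable M"
  by (simp add: L2_functions_def)

lemma L2_add:
  assumes f: "f \<in> L2_functions M" and g: "g \<in> L2_functions M"
  shows "(\<lambda>x. f x + g x) \<in> L2_functions M"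
proof -
  have [measurable]: "f \<in> borel_measurable M" "g \<in> borel_measurable M"
    using f g by (auto simp: L2_functions_def)
  have "integrable M (\<lambda>x. (norm (f x + g x))\<^sup>2)"
  proof (rule Bochner_Integration.integrable_bound)
    show "integrable M (\<lambda>x. 2 * (norm (f x))\<^sup>2 + 2 * (norm (g x))\<^sup>2)"
      using f g by (auto simp: L2_functions_def)
    show "AE x in M. norm ((norm (f x + g x))\<^sup>2) \<le> norm (2 * (norm (f x))\<^sup>2 + 2 * (norm (g x))\<^sup>2)"
    proof (rule AE_I2)
      fix x
      have "(norm (f x + g x))\<^sup>2 \<le> (norm (f x) + norm (g x))\<^sup>2"
        by (simp add: norm_triangle_ineq power_mono)
      also have "\<dots> \<le> 2 * (norm (f x))\<^sup>2 + 2 * (norm (g x))\<^sup>2"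
        using sum_squares_ge_zero[of "norm (f x) - norm (g x)" 0]
        by (simp add: power2_eq_square algebra_simps)
      finally show "norm ((norm (f x + g x))\<^sup>2) \<le> norm (2 * (norm (f x))\<^sup>2 + 2 * (norm (g x))\<^sup>2)"
        by simp
    qed
  qed measurable
  then show ?thesis by (simp add: L2_functions_def)
qed

lemma L2_scale: "f \<in> L2_functions M \<Longrightarrow> (\<lambda>x. c *\<^sub>R f x) \<in> L2_functions M"
  by (auto simp: L2_functions_def power_mult_distrib)

lemma L2_zero: "(\<lambda>x. 0) \<in> L2_functions M"
  by (simp add: L2_functions_def)

lemma L2_inner_integrable:
  fixes f g :: "'a \<Rightarrow> 'b::euclidean_space"
  assumes f: "f \<in> L2_functions M" and g: "g \<in> L2_functions M"
  shows "integrable M (\<lambda>x. f x \<bullet> g x)"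
proof -
  have [measurable]: "f \<in> borel_measurable M" "g \<in> borel_measurable M"
    using f g by (auto simp: L2_functions_def)
  show ?thesis
  proof (rule Bochner_Integration.integrable_bound)
    show "integrable M (\<lambda>x. (norm (f x))\<^sup>2 + (norm (g x))\<^sup>2)"
      using f g by (auto simp: L2_functions_def)
    show "AE x in M. norm (f x \<bullet> g x) \<le> norm ((norm (f x))\<^sup>2 + (norm (g x))\<^sup>2)"
    proof (rule AE_I2)
      fix x
      have "norm (f x \<bullet> g x) \<le> norm (f x) * norm (g x)"
        using Cauchy_Schwarz_ineq2 by simp
      also have "\<dots> \<le> (norm (f x))\<^sup>2 + (norm (g x))\<^sup>2"
        using sum_squares_bound[of "norm (f x)" "norm (g x)"]
          mult_nonneg_nonneg[OF norm_ge_zero[of "f x"] norm_ge_zero[of "g x"]] by linarith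
      finally show "norm (f x \<bullet> g x) \<le> norm ((norm (f x))\<^sup>2 + (norm (g x))\<^sup>2)"
        by simp
    qed
  qed measurable
qed

section \<open>Surface measure and Sobolev space on the unit sphere\<close>

text \<open>
  Surface measure on the unit sphere in polar coordinates: a Borel set of directions is
  weighed by the dimension times the Lebesgue measure of the cone over it inside the unit
  ball.  The measure lives on the Borel sets of the ambient space and is concentrated on
  the unit sphere, so functions on the sphere are represented by functions on the whole
  space, up to null sets of this measure.
\<close>

definition sphere_measure :: "'a::euclidean_space measure" where
  "sphere_measure = scale_measure (of_nat DIM('a))
     (distr (restrict_space lborel (ball 0 1 - {0})) borel sgn)"

lemma sets_sphere_measure [simp, measurable_cong]: "sets sphere_measure = sets borel"
  by (simp add: sphere_measure_def)

lemma space_sphere_measure [simp]: "space sphere_measure = UNIV"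
  by (simp add: sphere_measure_def space_scale_measure)

lemma sgn_measurable_ball [measurable]:
  "sgn \<in> measurable (restrict_space lborel (ball 0 1 - {0})) (borel :: 'a::euclidean_space measure)"
  by (rule measurable_restrict_space1) simp

lemma finite_sphere_measure: "finite_measure (sphere_measure :: 'a::euclidean_space measure)"
proof
  have "emeasure lborel (ball (0::'a) 1 - {0}) \<le> emeasure lborel (ball (0::'a) 1)"
    by (rule emeasure_mono) auto
  also have "\<dots> < \<infinity>" using emeasure_bounded_finite[OF bounded_ball[of "0::'a" 1]] by simp
  finally show "emeasure (sphere_measure :: 'a measure) (space sphere_measure) \<noteq> \<infinity>"
    by (simp add: sphere_measure_def space_scale_measure emeasure_distr space_restrict_space
        emeasure_restrict_space ennreal_mult_eq_top_iff)
qed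

lemma AE_sphere_measure: "AE v in sphere_measure. norm (v::'a::euclidean_space) = 1"
proof (rule AE_I)
  show "{v \<in> space sphere_measure. norm (v::'a) \<noteq> 1} \<subseteq> {v. norm v \<noteq> 1}" by auto
  have "sgn -` {v. norm v \<noteq> 1} \<inter> (ball 0 1 - {0::'a}) = {}"
    by (auto simp: norm_sgn)
  then show "emeasure sphere_measure {v::'a. norm v \<noteq> 1} = 0"
    by (simp add: sphere_measure_def emeasure_distr space_restrict_space)
qed simp

lemma small_imp_zero:
  fixes I K :: real
  assumes "\<And>e. e > 0 \<Longrightarrow> \<bar>I\<bar> \<le> e * K"
  shows "I = 0"
proof -
  have "\<bar>I\<bar> \<le> e" if "e > 0" for e
  proof -
    have "\<bar>I\<bar> \<le> e / (\<bar>K\<bar> + 1) * K" using that by (intro assms divide_pos_pos) auto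
    also have "\<dots> \<le> e / (\<bar>K\<bar> + 1) * (\<bar>K\<bar> + 1)" using that by (intro mult_left_mono) auto
    also have "\<dots> = e" by simp
    finally show ?thesis .
  qed
  then have "\<bar>I\<bar> \<le> 0" by (rule field_le_epsilon[where y=0, simplified])
  then show ?thesis by simp
qed

text \<open>Fundamental lemma of the calculus of variations on the sphere.\<close>

lemma fundamental_lemma_sphere:
  fixes G :: "'a::euclidean_space \<Rightarrow> real"
  assumes G: "integrable sphere_measure G"
    and test: "\<And>\<psi>. smooth \<psi> \<Longrightarrow> (\<integral>v. G v * \<psi> v \<partial>sphere_measure) = 0"
  shows "AE v in sphere_measure. G v = 0"
proof -
  let ?S = "sphere_measure :: 'a measure"
  have [measurable]: "G \<in> borel_measurable ?S" using G by auto
  have absG: "integrable ?S (\<lambda>v. \<bar>G v\<bar>)" using G by auto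
  have bddint: "integrable ?S (\<lambda>v. G v * h v)"
    if "h \<in> borel_measurable borel" "AE v in ?S. \<bar>h v\<bar> \<le> B" for h B
  proof -
    have [measurable]: "h \<in> borel_measurable ?S" using that(1) by simp
    show ?thesis
    proof (rule Bochner_Integration.integrable_bound)
      show "integrable ?S (\<lambda>v. B * \<bar>G v\<bar>)" using absG by auto
      show "AE v in ?S. norm (G v * h v) \<le> norm (B * \<bar>G v\<bar>)"
        using that(2)
      proof eventually_elim
        case (elim v)
        then have "\<bar>G v\<bar> * \<bar>h v\<bar> \<le> \<bar>G v\<bar> * \<bar>B\<bar>"
          by (intro mult_left_mono) auto
        then show ?case by (simp add: abs_mult mult.commute)
      qed
    qed measurable
  qed
  have cont: "(\<integral>v. G v * h v \<partial>?S) = 0" if h: "continuous_on UNIV h" for h :: "'a \<Rightarrow> real"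
  proof -
    have hm: "h \<in> borel_measurable borel" using h by (rule borel_measurable_continuous_onI)
    have le: "\<bar>\<integral>v. G v * h v \<partial>?S\<bar> \<le> e * (\<integral>v. \<bar>G v\<bar> \<partial>?S)" if e: "e > 0" for e
    proof -
      obtain p where p: "real_polynomial_function p" "\<And>x. x \<in> sphere 0 1 \<Longrightarrow> \<bar>h x - p x\<bar> < e"
        using Stone_Weierstrass_real_polynomial_function[OF compact_sphere[of "0::'a" 1]
            continuous_on_subset[OF h subset_UNIV] e] by metis
      have sp: "smooth p" using p(1) smooth_polynomial by blast
      have pm: "p \<in> borel_measurable borel"
        using smooth_continuous[OF sp] by (rule borel_measurable_continuous_onI)
      have AEd: "AE v in ?S. \<bar>h v - p v\<bar> \<le> e"
        using AE_sphere_measure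
      proof eventually_elim
        case (elim v)
        then show ?case using p(2)[of v] by simp
      qed
      have i1: "integrable ?S (\<lambda>v. G v * (h v - p v))"
        using hm pm AEd by (intro bddint[where B=e]) auto
      have "compact (p ` sphere 0 1)"
        by (intro compact_continuous_image) (auto intro: continuous_on_subset[OF smooth_continuous[OF sp]])
      then obtain B where B: "\<And>v. v \<in> sphere 0 1 \<Longrightarrow> \<bar>p v\<bar> \<le> B"
        by (metis compact_imp_bounded bounded_iff imageI real_norm_def)
      have i2: "integrable ?S (\<lambda>v. G v * p v)"
      proof (rule bddint[OF pm, where B=B])
        show "AE v in ?S. \<bar>p v\<bar> \<le> B"
          using AE_sphere_measure
        proof eventually_elim
          case (elim v)
          then show ?case using B[of v] by simp
        qed
      qed
      have "(\<integral>v. G v * h v \<partial>?S) = (\<integral>v. G v * (h v - p v) + G v * p v \<partial>?S)"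
        by (simp add: algebra_simps)
      also have "\<dots> = (\<integral>v. G v * (h v - p v) \<partial>?S)"
        using i1 i2 test[OF sp] by simp
      finally have "\<bar>\<integral>v. G v * h v \<partial>?S\<bar> \<le> (\<integral>v. \<bar>G v * (h v - p v)\<bar> \<partial>?S)"
        by simp
      also have "\<dots> \<le> (\<integral>v. e * \<bar>G v\<bar> \<partial>?S)"
      proof (rule integral_mono_AE)
        show "AE v in ?S. \<bar>G v * (h v - p v)\<bar> \<le> e * \<bar>G v\<bar>"
          using AEd
        proof eventually_elim
          case (elim v)
          then have "\<bar>G v\<bar> * \<bar>h v - p v\<bar> \<le> \<bar>G v\<bar> * e" by (intro mult_left_mono) auto
          then show ?case by (simp add: abs_mult mult.commute)
        qed
      qed (use i1 absG in auto)
      finally show ?thesis by simp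
    qed
    show ?thesis using small_imp_zero[OF le] by simp
  qed
  have closed0: "(\<integral>v. G v * indicator C v \<partial>?S) = 0" if C: "closed C" for C
  proof (cases "C = {}")
    case True
    then show ?thesis by simp
  next
    case False
    define h where "h = (\<lambda>n::nat. \<lambda>v. max 0 (1 - real n * infdist v C))"
    have hc: "continuous_on UNIV (h n)" for n
      unfolding h_def by (intro continuous_intros)
    have "h n \<in> borel_measurable borel" for n
      using hc by (rule borel_measurable_continuous_onI)
    then have [measurable]: "h n \<in> borel_measurable ?S" for n by simp
    have lim: "(\<lambda>n. h n v) \<longlonglongrightarrow> indicator C v" for v
    proof (cases "v \<in> C")
      case True
      then show ?thesis by (simp add: h_def)
    next
      case F: False
      then have pos: "infdist v C > 0"
        using C False by (metis in_closed_iff_infdist_zero infdist_nonneg less_eq_real_def)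
      obtain N where N: "real N * infdist v C > 1" using reals_Archimedean3[OF pos] by blast
      have "h n v = 0" if "n \<ge> N" for n
      proof -
        have "real n * infdist v C \<ge> real N * infdist v C"
          using that pos by (intro mult_right_mono) auto
        then show ?thesis using N by (simp add: h_def)
      qed
      then have "eventually (\<lambda>n. h n v = 0) sequentially"
        by (auto simp: eventually_sequentially)
      then show ?thesis using F by (simp add: tendsto_eventually)
    qed
    have "(\<lambda>n. \<integral>v. G v * h n v \<partial>?S) \<longlonglongrightarrow> (\<integral>v. G v * indicator C v \<partial>?S)"
    proof (rule integral_dominated_convergence[where w="\<lambda>v. \<bar>G v\<bar>"])
      show "(\<lambda>v. G v * indicator C v) \<in> borel_measurable ?S"
      proof -
        have [measurable]: "C \<in> sets ?S" using C by simp
        show ?thesis by measurable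
      qed
      show "AE v in ?S. (\<lambda>n. G v * h n v) \<longlonglongrightarrow> G v * indicator C v"
        using lim by (auto intro!: AE_I2 tendsto_mult_left)
      show "AE v in ?S. norm (G v * h n v) \<le> \<bar>G v\<bar>" for n
        by (rule AE_I2) (auto simp: h_def abs_mult mult_left_le infdist_nonneg)
    qed (use absG in auto)
    moreover have "(\<lambda>n. \<integral>v. G v * h n v \<partial>?S) = (\<lambda>n. 0)" using cont hc by simp
    ultimately have "(\<lambda>n::nat. 0::real) \<longlonglongrightarrow> (\<integral>v. G v * indicator C v \<partial>?S)" by simp
    then show ?thesis using LIMSEQ_unique[OF tendsto_const] by metis
  qed
  have "(\<integral>v. G v * indicator A v \<partial>?S) = 0" if "A \<in> sets borel" for A
  proof -
    have "Int_stable (Collect closed :: 'a set set)" "Collect closed \<subseteq> Pow (UNIV :: 'a set)"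
      "A \<in> sigma_sets UNIV (Collect closed)"
      using that by (auto simp: Int_stable_def borel_eq_closed)
    then show ?thesis
    proof (induct A rule: sigma_sets_induct_disjoint)
      case (basic A)
      then show ?case using closed0 by simp
    next
      case empty
      then show ?case by simp
    next
      case (compl A)
      have A: "A \<in> sets borel" using compl(1) by (simp add: borel_eq_closed)
      have iA: "integrable ?S (\<lambda>v. G v * indicator A v)"
        by (rule bddint[where B=1]) (use A in \<open>auto simp: indicator_def\<close>)
      have "(\<integral>v. G v * indicator (UNIV - A) v \<partial>?S) = (\<integral>v. G v - G v * indicator A v \<partial>?S)"
        by (rule Bochner_Integration.integral_cong) (auto simp: indicator_def)
      also have "\<dots> = (\<integral>v. G v * 1 \<partial>?S)" using G iA compl(2) by simp
      also have "\<dots> = 0" by (rule cont) simp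
      finally show ?case .
    next
      case (union A)
      have A: "A i \<in> sets ?S" for i
        using union(2) by (auto simp: borel_eq_closed)
      have "integrable ?S (\<lambda>v. G v * indicator (\<Union>i. A i) v)"
        by (rule bddint[where B=1]) (use A in \<open>auto simp: indicator_def\<close>)
      then have "set_integrable ?S (\<Union>i. A i) G"
        by (simp add: set_integrable_def mult.commute)
      then have "(\<integral>v. indicator (\<Union>i. A i) v *\<^sub>R G v \<partial>?S)
          = (\<Sum>i. (\<integral>v. indicator (A i) v *\<^sub>R G v \<partial>?S))"
        using lebesgue_integral_countable_add[of A ?S G] A union(1)
        by (auto simp: disjoint_family_on_def set_lebesgue_integral_def)
      then show ?case using union(3) by (simp add: mult.commute)
    qed
  qed
  then show ?thesis
    by (intro density_unique_real[of ?S G "\<lambda>_. 0"])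
       (use G in \<open>auto simp: set_lebesgue_integral_def mult.commute\<close>)
qed


text \<open>
  Weak tangential gradient on the unit sphere.  With the tangential derivatives
  \<open>D\<^sub>b \<psi> = \<nabla>\<psi> \<bullet> (b - (b \<bullet> v) v)\<close>, integration by parts on the unit sphere, whose mean
  curvature is \<open>DIM('a) - 1\<close>, reads
  \<open>\<integral> (D\<^sub>b \<phi>) \<psi> = - \<integral> \<phi> D\<^sub>b \<psi> + (DIM('a) - 1) \<integral> \<phi> \<psi> (v \<bullet> b)\<close>.
\<close>

definition weak_tangential_gradient :: "('a::euclidean_space \<Rightarrow> real) \<Rightarrow> ('a \<Rightarrow> 'a) \<Rightarrow> bool" where
  "weak_tangential_gradient \<phi> G \<longleftrightarrow>
     G \<in> L2_functions sphere_measure \<and>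
     (\<forall>\<psi>. smooth \<psi> \<longrightarrow> (\<forall>b\<in>Basis.
        (\<integral>v. (G v \<bullet> b) * \<psi> v \<partial>sphere_measure) =
        - (\<integral>v. \<phi> v * (frechet_derivative \<psi> (at v) (b - (b \<bullet> v) *\<^sub>R v)
                 - (real DIM('a) - 1) * \<psi> v * (v \<bullet> b)) \<partial>sphere_measure)))"

definition H1_functions :: "('a::euclidean_space \<Rightarrow> real) set" where
  "H1_functions = {\<phi> \<in> L2_functions sphere_measure. \<exists>G. weak_tangential_gradient \<phi> G}"

definition tangential_gradient :: "('a::euclidean_space \<Rightarrow> real) \<Rightarrow> 'a \<Rightarrow> 'a" where
  "tangential_gradient \<phi> = (SOME G. weak_tangential_gradient \<phi> G)"

lemma tangential_gradient:
  "\<phi> \<in> H1_functions \<Longrightarrow> weak_tangential_gradient \<phi> (tangential_gradient \<phi>)"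
  unfolding H1_functions_def tangential_gradient_def by (metis (mono_tags, lifting) mem_Collect_eq someI_ex)

lemma L2_sphere_integrable:
  fixes G :: "'a::euclidean_space \<Rightarrow> 'b::euclidean_space"
  assumes "G \<in> L2_functions sphere_measure"
  shows "integrable sphere_measure (\<lambda>v. G v \<bullet> b)"
proof -
  interpret finite_measure "sphere_measure :: 'a measure" by (rule finite_sphere_measure)
  have "(\<lambda>_::'a. b) \<in> L2_functions sphere_measure" by (simp add: L2_functions_def)
  from L2_inner_integrable[OF assms this] show ?thesis .
qed

lemma L2_sphere_test_integrable:
  fixes \<phi> h :: "'a::euclidean_space \<Rightarrow> real"
  assumes \<phi>: "integrable sphere_measure \<phi>" and h: "continuous_on UNIV h"
  shows "integrable sphere_measure (\<lambda>v. \<phi> v * h v)"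
proof -
  have "h \<in> borel_measurable borel" using h by (rule borel_measurable_continuous_onI)
  then have [measurable]: "h \<in> borel_measurable (sphere_measure :: 'a measure)" by simp
  have [measurable]: "\<phi> \<in> borel_measurable sphere_measure" using \<phi> by auto
  have "compact (h ` sphere 0 1)"
    by (intro compact_continuous_image) (auto intro: continuous_on_subset[OF h])
  then obtain B where B: "\<And>v. v \<in> sphere 0 1 \<Longrightarrow> \<bar>h v\<bar> \<le> B"
    by (metis compact_imp_bounded bounded_iff imageI real_norm_def)
  show ?thesis
  proof (rule Bochner_Integration.integrable_bound)
    show "integrable sphere_measure (\<lambda>v. B * \<bar>\<phi> v\<bar>)" using \<phi> by auto
    show "AE v in sphere_measure. norm (\<phi> v * h v) \<le> norm (B * \<bar>\<phi> v\<bar>)"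
      using AE_sphere_measure
    proof eventually_elim
      case (elim v)
      then have "\<bar>h v\<bar> \<le> \<bar>B\<bar>" using B[of v] by simp
      then have "\<bar>\<phi> v\<bar> * \<bar>h v\<bar> \<le> \<bar>\<phi> v\<bar> * \<bar>B\<bar>" by (intro mult_left_mono) auto
      then show ?case by (simp add: abs_mult mult.commute)
    qed
  qed measurable
qed

lemma smooth_partial_continuous:
  fixes \<psi> :: "'a::euclidean_space \<Rightarrow> real"
  assumes "smooth \<psi>" and that: "continuous_on UNIV w"
  shows "continuous_on UNIV (\<lambda>v. frechet_derivative \<psi> (at v) (w v))"
proof -
  have d: "\<psi> differentiable (at x)" and c: "b \<in> Basis \<Longrightarrow> continuous_on UNIV (\<lambda>x. frechet_derivative \<psi> (at x) b)"
    for x b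
  proof -
    have "Ck (Suc 0) \<psi>" using assms(1) by (simp only: smooth_def)
    then show "\<psi> differentiable (at x)"
      "b \<in> Basis \<Longrightarrow> continuous_on UNIV (\<lambda>x. frechet_derivative \<psi> (at x) b)"
      by simp_all
  qed
  have "frechet_derivative \<psi> (at v) (w v) = (\<Sum>b\<in>Basis. (w v \<bullet> b) * frechet_derivative \<psi> (at v) b)" for v
  proof -
    interpret bounded_linear "frechet_derivative \<psi> (at v)"
      using d by (meson frechet_derivative_works has_derivative_bounded_linear)
    have "frechet_derivative \<psi> (at v) (\<Sum>b\<in>Basis. (w v \<bullet> b) *\<^sub>R b) =
        (\<Sum>b\<in>Basis. (w v \<bullet> b) * frechet_derivative \<psi> (at v) b)"
      by (simp add: sum scaleR)
    then show ?thesis by (simp add: euclidean_representation)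
  qed
  then show ?thesis using c that by (auto intro!: continuous_intros)
qed

lemma weak_gradient_integrands:
  fixes \<phi> \<psi> :: "'a::euclidean_space \<Rightarrow> real" and G :: "'a \<Rightarrow> 'a"
  assumes "\<phi> \<in> L2_functions sphere_measure" "G \<in> L2_functions sphere_measure" "smooth \<psi>"
  shows "integrable sphere_measure (\<lambda>v. (G v \<bullet> b) * \<psi> v)"
    and "integrable sphere_measure (\<lambda>v. \<phi> v * (frechet_derivative \<psi> (at v) (b - (b \<bullet> v) *\<^sub>R v)
                 - (real DIM('a) - 1) * \<psi> v * (v \<bullet> b)))"
proof -
  show "integrable sphere_measure (\<lambda>v. (G v \<bullet> b) * \<psi> v)"
    using assms by (intro L2_sphere_test_integrable L2_sphere_integrable smooth_continuous)
  have "integrable sphere_measure \<phi>"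
    using L2_sphere_integrable[OF assms(1), of 1] by simp
  then show "integrable sphere_measure (\<lambda>v. \<phi> v * (frechet_derivative \<psi> (at v) (b - (b \<bullet> v) *\<^sub>R v)
                 - (real DIM('a) - 1) * \<psi> v * (v \<bullet> b)))"
    by (rule L2_sphere_test_integrable)
       (intro continuous_intros smooth_partial_continuous smooth_continuous assms)
qed

lemma weak_gradient_unique:
  fixes \<phi> \<phi>' :: "'a::euclidean_space \<Rightarrow> real"
  assumes G: "weak_tangential_gradient \<phi> G" and H: "weak_tangential_gradient \<phi>' H"
    and \<phi>: "\<phi> \<in> L2_functions sphere_measure" "\<phi>' \<in> L2_functions sphere_measure"
    and ae: "AE v in sphere_measure. \<phi> v = \<phi>' v"
  shows "AE v in sphere_measure. G v = H v"
proof -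
  have L: "G \<in> L2_functions sphere_measure" "H \<in> L2_functions sphere_measure"
    using G H by (auto simp: weak_tangential_gradient_def)
  have "AE v in sphere_measure. (G v - H v) \<bullet> b = 0" if b: "b \<in> Basis" for b
  proof (rule fundamental_lemma_sphere)
    show "integrable sphere_measure (\<lambda>v. (G v - H v) \<bullet> b)"
      using L2_sphere_integrable[OF L(1), of b] L2_sphere_integrable[OF L(2), of b]
      by (simp add: inner_diff_left)
    fix \<psi> :: "'a \<Rightarrow> real" assume \<psi>: "smooth \<psi>"
    have "(\<integral>v. (G v \<bullet> b) * \<psi> v \<partial>sphere_measure) = (\<integral>v. (H v \<bullet> b) * \<psi> v \<partial>sphere_measure)"
    proof -
      have "(\<integral>v. \<phi> v * (frechet_derivative \<psi> (at v) (b - (b \<bullet> v) *\<^sub>R v)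
                 - (real DIM('a) - 1) * \<psi> v * (v \<bullet> b)) \<partial>sphere_measure)
          = (\<integral>v. \<phi>' v * (frechet_derivative \<psi> (at v) (b - (b \<bullet> v) *\<^sub>R v)
                 - (real DIM('a) - 1) * \<psi> v * (v \<bullet> b)) \<partial>sphere_measure)"
        by (rule integral_cong_AE)
           (use weak_gradient_integrands(2)[OF \<phi>(1) L(1) \<psi>, of b]
             weak_gradient_integrands(2)[OF \<phi>(2) L(2) \<psi>, of b] ae in auto)
      then show ?thesis using G H b \<psi> by (simp add: weak_tangential_gradient_def)
    qed
    then show "(\<integral>v. ((G v - H v) \<bullet> b) * \<psi> v \<partial>sphere_measure) = 0"
      using weak_gradient_integrands(1)[OF \<phi>(1) L(1) \<psi>, of b]
        weak_gradient_integrands(1)[OF \<phi>(1) L(2) \<psi>, of b]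
      by (simp add: inner_diff_left left_diff_distrib)
  qed
  then have "AE v in sphere_measure. \<forall>b\<in>Basis. (G v - H v) \<bullet> b = 0"
    by (intro AE_finite_allI) auto
  then show ?thesis
    by (rule eventually_mono) (metis euclidean_all_zero_iff right_minus_eq)
qed

lemma weak_gradient_add:
  fixes \<phi> \<phi>' :: "'a::euclidean_space \<Rightarrow> real"
  assumes G: "weak_tangential_gradient \<phi> G" and H: "weak_tangential_gradient \<phi>' H"
    and \<phi>: "\<phi> \<in> L2_functions sphere_measure" "\<phi>' \<in> L2_functions sphere_measure"
  shows "weak_tangential_gradient (\<lambda>v. \<phi> v + \<phi>' v) (\<lambda>v. G v + H v)"
proof -
  have L: "G \<in> L2_functions sphere_measure" "H \<in> L2_functions sphere_measure"
    using G H by (auto simp: weak_tangential_gradient_def)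
  have "(\<integral>v. ((G v + H v) \<bullet> b) * \<psi> v \<partial>sphere_measure) =
        - (\<integral>v. (\<phi> v + \<phi>' v) * (frechet_derivative \<psi> (at v) (b - (b \<bullet> v) *\<^sub>R v)
                 - (real DIM('a) - 1) * \<psi> v * (v \<bullet> b)) \<partial>sphere_measure)"
    if \<psi>: "smooth \<psi>" and b: "b \<in> Basis" for \<psi> b
    unfolding inner_add_left distrib_right
    using weak_gradient_integrands[OF \<phi>(1) L(1) \<psi>, of b]
      weak_gradient_integrands[OF \<phi>(2) L(2) \<psi>, of b] G H \<psi> b
    by (subst (1 2) Bochner_Integration.integral_add)
       (auto simp: weak_tangential_gradient_def)
  then show ?thesis using L L2_add by (auto simp: weak_tangential_gradient_def)
qed

lemma weak_gradient_scale:
  fixes \<phi> :: "'a::euclidean_space \<Rightarrow> real"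
  assumes G: "weak_tangential_gradient \<phi> G"
  shows "weak_tangential_gradient (\<lambda>v. c *\<^sub>R \<phi> v) (\<lambda>v. c *\<^sub>R G v)"
  using G by (auto simp: weak_tangential_gradient_def mult.assoc intro: L2_scale)

lemma H1_add: "\<phi> \<in> H1_functions \<Longrightarrow> \<psi> \<in> H1_functions \<Longrightarrow> (\<lambda>v. \<phi> v + \<psi> v) \<in> H1_functions"
  using weak_gradient_add L2_add unfolding H1_functions_def by blast

lemma H1_scale: "\<phi> \<in> H1_functions \<Longrightarrow> (\<lambda>v. c *\<^sub>R \<phi> v) \<in> H1_functions"
  using weak_gradient_scale L2_scale unfolding H1_functions_def by blast

lemma H1_zero: "(\<lambda>v. 0) \<in> H1_functions"
  unfolding H1_functions_def weak_tangential_gradient_def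
  by (auto simp: L2_zero intro!: exI[of _ "\<lambda>v. 0"])

lemma H1_L2:
  assumes "\<phi> \<in> H1_functions"
  shows "\<phi> \<in> L2_functions sphere_measure" "tangential_gradient \<phi> \<in> L2_functions sphere_measure"
  using assms tangential_gradient[OF assms]
  by (auto simp: H1_functions_def weak_tangential_gradient_def)

lemma tangential_gradient_unique:
  assumes "\<phi> \<in> H1_functions" "\<psi> \<in> H1_functions" "AE v in sphere_measure. \<phi> v = \<psi> v"
  shows "AE v in sphere_measure. tangential_gradient \<phi> v = tangential_gradient \<psi> v"
  using assms by (intro weak_gradient_unique[of \<phi> _ \<psi>] tangential_gradient H1_L2)

lemma tangential_gradient_add:
  assumes "\<phi> \<in> H1_functions" "\<psi> \<in> H1_functions"
  shows "AE v in sphere_measure. tangential_gradient (\<lambda>v. \<phi> v + \<psi> v) v =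
           tangential_gradient \<phi> v + tangential_gradient \<psi> v"
  using assms
  by (intro weak_gradient_unique[of "\<lambda>v. \<phi> v + \<psi> v" _ "\<lambda>v. \<phi> v + \<psi> v"]
      tangential_gradient weak_gradient_add H1_L2 H1_add) auto

lemma tangential_gradient_scale:
  assumes "\<phi> \<in> H1_functions"
  shows "AE v in sphere_measure. tangential_gradient (\<lambda>v. c *\<^sub>R \<phi> v) v =
           c *\<^sub>R tangential_gradient \<phi> v"
  using assms
  by (intro weak_gradient_unique[of "\<lambda>v. c *\<^sub>R \<phi> v" _ "\<lambda>v. c *\<^sub>R \<phi> v"]
      tangential_gradient weak_gradient_scale H1_L2 H1_scale) auto

text \<open>The Sobolev space on the unit sphere, as a space of classes of a.e. equal functions.\<close>

definition H1_eq :: "('a::euclidean_space \<Rightarrow> real) \<Rightarrow> ('a \<Rightarrow> real) \<Rightarrow> bool" where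
  "H1_eq \<phi> \<psi> \<longleftrightarrow> \<phi> \<in> H1_functions \<and> \<psi> \<in> H1_functions \<and> (AE v in sphere_measure. \<phi> v = \<psi> v)"

quotient_type (overloaded) 'a H1_sphere = "'a::euclidean_space \<Rightarrow> real" / partial: H1_eq
proof (rule part_equivpI)
  show "\<exists>\<phi>. H1_eq \<phi> (\<phi> :: 'a \<Rightarrow> real)" using H1_zero by (auto simp: H1_eq_def)
  show "symp (H1_eq :: ('a \<Rightarrow> real) \<Rightarrow> _)"
    by (auto simp: symp_def H1_eq_def eq_commute)
  show "transp (H1_eq :: ('a \<Rightarrow> real) \<Rightarrow> _)"
    by (auto simp: transp_def H1_eq_def elim: eventually_elim2)
qed

definition H1_inner :: "('a::euclidean_space \<Rightarrow> real) \<Rightarrow> ('a \<Rightarrow> real) \<Rightarrow> real" where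
  "H1_inner \<phi> \<psi> = (\<integral>v. \<phi> v * \<psi> v \<partial>sphere_measure)
     + (\<integral>v. tangential_gradient \<phi> v \<bullet> tangential_gradient \<psi> v \<partial>sphere_measure)"

lemma L2_mult_integrable:
  fixes f g :: "'a \<Rightarrow> real"
  shows "f \<in> L2_functions M \<Longrightarrow> g \<in> L2_functions M \<Longrightarrow> integrable M (\<lambda>x. f x * g x)"
  using L2_inner_integrable[of f M g] by simp

lemma H1_inner_cong:
  assumes "H1_eq \<phi> \<phi>'" "H1_eq \<psi> \<psi>'"
  shows "H1_inner \<phi> \<psi> = H1_inner \<phi>' \<psi>'"
proof -
  have H: "\<phi> \<in> H1_functions" "\<phi>' \<in> H1_functions" "\<psi> \<in> H1_functions" "\<psi>' \<in> H1_functions"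
    and ae: "AE v in sphere_measure. \<phi> v = \<phi>' v" "AE v in sphere_measure. \<psi> v = \<psi>' v"
    using assms by (auto simp: H1_eq_def)
  note L = H[THEN H1_L2(1)] and M = H[THEN H1_L2(2)]
  have "(\<integral>v. \<phi> v * \<psi> v \<partial>sphere_measure) = (\<integral>v. \<phi>' v * \<psi>' v \<partial>sphere_measure)"
    by (rule integral_cong_AE)
       (use ae L2_mult_integrable[OF L(1) L(3)] L2_mult_integrable[OF L(2) L(4)] in auto)
  moreover have "(\<integral>v. tangential_gradient \<phi> v \<bullet> tangential_gradient \<psi> v \<partial>sphere_measure)
      = (\<integral>v. tangential_gradient \<phi>' v \<bullet> tangential_gradient \<psi>' v \<partial>sphere_measure)"
    by (rule integral_cong_AE)
       (use tangential_gradient_unique[OF H(1,2) ae(1)] tangential_gradient_unique[OF H(3,4) ae(2)]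
         L2_inner_integrable[OF M(1) M(3)] L2_inner_integrable[OF M(2) M(4)] in auto)
  ultimately show ?thesis by (simp add: H1_inner_def)
qed

lemma H1_inner_commute: "H1_inner \<phi> \<psi> = H1_inner \<psi> \<phi>"
  by (simp add: H1_inner_def mult.commute inner_commute)

lemma H1_inner_add:
  assumes "\<phi> \<in> H1_functions" "\<phi>' \<in> H1_functions" "\<psi> \<in> H1_functions"
  shows "H1_inner (\<lambda>v. \<phi> v + \<phi>' v) \<psi> = H1_inner \<phi> \<psi> + H1_inner \<phi>' \<psi>"
proof -
  note L = assms[THEN H1_L2(1)] and M = assms[THEN H1_L2(2)]
  note S = H1_add[OF assms(1,2), THEN H1_L2(2)]
  have "(\<integral>v. tangential_gradient (\<lambda>v. \<phi> v + \<phi>' v) v \<bullet> tangential_gradient \<psi> v \<partial>sphere_measure)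
      = (\<integral>v. tangential_gradient \<phi> v \<bullet> tangential_gradient \<psi> v
            + tangential_gradient \<phi>' v \<bullet> tangential_gradient \<psi> v \<partial>sphere_measure)"
    by (rule integral_cong_AE)
       (use tangential_gradient_add[OF assms(1,2)] L2_inner_integrable[OF S M(3)]
         L2_inner_integrable[OF M(1) M(3)] L2_inner_integrable[OF M(2) M(3)]
         in \<open>auto simp: inner_add_left\<close>)
  then show ?thesis
    using L2_inner_integrable[OF M(1) M(3)] L2_inner_integrable[OF M(2) M(3)]
      L2_mult_integrable[OF L(1) L(3)] L2_mult_integrable[OF L(2) L(3)]
    by (simp add: H1_inner_def distrib_right)
qed

lemma H1_inner_scale:
  assumes "\<phi> \<in> H1_functions" "\<psi> \<in> H1_functions"
  shows "H1_inner (\<lambda>v. c *\<^sub>R \<phi> v) \<psi> = c * H1_inner \<phi> \<psi>"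
proof -
  note M = assms[THEN H1_L2(2)] and S = H1_scale[OF assms(1), THEN H1_L2(2)]
  have "(\<integral>v. tangential_gradient (\<lambda>v. c *\<^sub>R \<phi> v) v \<bullet> tangential_gradient \<psi> v \<partial>sphere_measure)
      = (\<integral>v. c * (tangential_gradient \<phi> v \<bullet> tangential_gradient \<psi> v) \<partial>sphere_measure)"
    by (rule integral_cong_AE)
       (use tangential_gradient_scale[OF assms(1), of c] L2_inner_integrable[OF S M(2)]
         L2_inner_integrable[OF M(1) M(2)] in auto)
  then show ?thesis by (simp add: H1_inner_def mult.assoc distrib_left)
qed

lemma H1_inner_nonneg: "0 \<le> H1_inner \<phi> \<phi>"
  by (simp add: H1_inner_def)

lemma H1_inner_zero_iff:
  fixes \<phi> :: "'a::euclidean_space \<Rightarrow> real"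
  assumes "\<phi> \<in> H1_functions"
  shows "H1_inner \<phi> \<phi> = 0 \<longleftrightarrow> H1_eq \<phi> (\<lambda>v. 0)"
proof
  assume eq: "H1_eq \<phi> (\<lambda>v. 0)"
  have "H1_inner \<phi> \<phi> = H1_inner (\<lambda>v. 0) (\<lambda>v::'a. 0)" by (rule H1_inner_cong[OF eq eq])
  also have "\<dots> = 0" using H1_inner_scale[OF H1_zero H1_zero, where c=0] by simp
  finally show "H1_inner \<phi> \<phi> = 0" .
next
  assume eq: "H1_inner \<phi> \<phi> = 0"
  have "0 \<le> (\<integral>v. \<phi> v * \<phi> v \<partial>sphere_measure)"
    "0 \<le> (\<integral>v. tangential_gradient \<phi> v \<bullet> tangential_gradient \<phi> v \<partial>sphere_measure)"
    by simp_all
  with eq have "(\<integral>v. \<phi> v * \<phi> v \<partial>sphere_measure) = 0"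
    by (simp only: H1_inner_def add_nonneg_eq_0_iff)
  then have "AE v in sphere_measure. \<phi> v * \<phi> v = 0"
    using L2_mult_integrable[OF H1_L2(1)[OF assms] H1_L2(1)[OF assms]]
    by (subst (asm) integral_nonneg_eq_0_iff_AE) auto
  then show "H1_eq \<phi> (\<lambda>v. 0)" using assms H1_zero by (auto simp: H1_eq_def)
qed

instantiation H1_sphere :: (euclidean_space) real_vector
begin

lift_definition zero_H1_sphere :: "'a H1_sphere" is "\<lambda>v. 0"
  by (auto simp: H1_eq_def H1_zero)

lift_definition plus_H1_sphere :: "'a H1_sphere \<Rightarrow> 'a H1_sphere \<Rightarrow> 'a H1_sphere"
  is "\<lambda>\<phi> \<psi> v. \<phi> v + \<psi> v"
  by (auto simp: H1_eq_def H1_add elim: eventually_elim2)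

lift_definition scaleR_H1_sphere :: "real \<Rightarrow> 'a H1_sphere \<Rightarrow> 'a H1_sphere"
  is "\<lambda>c \<phi> v. c *\<^sub>R \<phi> v"
  by (auto simp: H1_eq_def intro: H1_scale simp del: real_scaleR_def elim: eventually_mono)

lift_definition uminus_H1_sphere :: "'a H1_sphere \<Rightarrow> 'a H1_sphere"
  is "\<lambda>\<phi> v. (-1) *\<^sub>R \<phi> v"
  using H1_scale[where c="-1"] by (auto simp: H1_eq_def elim: eventually_mono)

definition minus_H1_sphere :: "'a H1_sphere \<Rightarrow> 'a H1_sphere \<Rightarrow> 'a H1_sphere" where
  "minus_H1_sphere u w = u + - w"

instance
proof
  fix u w x :: "'a H1_sphere" and c d :: real
  show "u + w + x = u + (w + x)"
    by transfer (auto simp: H1_eq_def H1_add add.assoc)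
  show "u + w = w + u"
    by transfer (auto simp: H1_eq_def H1_add add.commute)
  show "0 + u = u"
    by transfer (auto simp: H1_eq_def)
  show "- u + u = 0"
    by transfer (auto simp: H1_eq_def H1_zero)
  show "u - w = u + - w"
    by (simp add: minus_H1_sphere_def)
  show "c *\<^sub>R (u + w) = c *\<^sub>R u + c *\<^sub>R w"
    by transfer (use H1_add H1_scale in \<open>auto simp: H1_eq_def distrib_left\<close>)
  show "(c + d) *\<^sub>R u = c *\<^sub>R u + d *\<^sub>R u"
    by transfer (use H1_add H1_scale in \<open>auto simp: H1_eq_def distrib_right\<close>)
  show "c *\<^sub>R d *\<^sub>R u = (c * d) *\<^sub>R u"
    by transfer (use H1_scale in \<open>auto simp: H1_eq_def mult.assoc\<close>)
  show "1 *\<^sub>R u = u"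
    by transfer (auto simp: H1_eq_def)
qed

end

instantiation H1_sphere :: (euclidean_space) real_inner
begin

lift_definition inner_H1_sphere :: "'a H1_sphere \<Rightarrow> 'a H1_sphere \<Rightarrow> real" is H1_inner
  by (rule H1_inner_cong)

definition "norm_H1_sphere (u :: 'a H1_sphere) = sqrt (u \<bullet> u)"
definition "dist_H1_sphere (u :: 'a H1_sphere) w = norm (u - w)"
definition "sgn_H1_sphere (u :: 'a H1_sphere) = u /\<^sub>R norm u"
definition "uniformity_H1_sphere = (INF e\<in>{0<..}. principal {(u :: 'a H1_sphere, w). dist u w < e})"
definition "open_H1_sphere (U :: 'a H1_sphere set) \<longleftrightarrow>
  (\<forall>u\<in>U. eventually (\<lambda>(u', w). u' = u \<longrightarrow> w \<in> U) uniformity)"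

instance
proof
  fix u w x :: "'a H1_sphere" and c :: real
  show "u \<bullet> w = w \<bullet> u"
    by transfer (rule H1_inner_commute)
  show "(u + w) \<bullet> x = u \<bullet> x + w \<bullet> x"
    by transfer (auto simp: H1_eq_def H1_inner_add)
  show "(c *\<^sub>R u) \<bullet> w = c * (u \<bullet> w)"
    by transfer (auto simp: H1_eq_def H1_inner_scale simp del: real_scaleR_def)
  show "0 \<le> u \<bullet> u"
    by transfer (rule H1_inner_nonneg)
  show "(u \<bullet> u = 0) = (u = 0)"
    by transfer (auto simp: H1_inner_zero_iff H1_eq_def)
qed (simp_all add: norm_H1_sphere_def dist_H1_sphere_def sgn_H1_sphere_def
      uniformity_H1_sphere_def open_H1_sphere_def)

end

lift_definition L2_norm_sphere :: "'a::euclidean_space H1_sphere \<Rightarrow> real"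
  is "\<lambda>\<phi>. sqrt (\<integral>v. (\<phi> v)\<^sup>2 \<partial>sphere_measure)"
proof -
  fix \<phi> \<psi> :: "'a \<Rightarrow> real" assume "H1_eq \<phi> \<psi>"
  then have "AE v in sphere_measure. \<phi> v = \<psi> v"
    and [measurable]: "\<phi> \<in> borel_measurable sphere_measure" "\<psi> \<in> borel_measurable sphere_measure"
    using H1_L2(1) L2_measurable by (auto simp: H1_eq_def)
  then show "sqrt (\<integral>v. (\<phi> v)\<^sup>2 \<partial>sphere_measure) = sqrt (\<integral>v. (\<psi> v)\<^sup>2 \<partial>sphere_measure)"
    by (intro arg_cong[where f=sqrt] integral_cong_AE) (auto elim: eventually_mono)
qed

section \<open>Bochner spaces\<close>

text \<open>
  Strong (Bochner) measurability; elements of the Bochner spaces are represented by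
  functions, with equality in the space being equality almost everywhere.
\<close>

definition strongly_measurable :: "'a measure \<Rightarrow> ('a \<Rightarrow> 'b::topological_space) \<Rightarrow> bool" where
  "strongly_measurable M f \<longleftrightarrow>
     (\<exists>s. (\<forall>n::nat. simple_function M (s n)) \<and> (AE x in M. (\<lambda>n. s n x) \<longlonglongrightarrow> f x))"

definition bochner_L2 :: "'a measure \<Rightarrow> ('a \<Rightarrow> 'b::real_normed_vector) set" where
  "bochner_L2 M = {f. strongly_measurable M f \<and> integrable M (\<lambda>x. (norm (f x))\<^sup>2)}"

definition bochner_norm :: "'a measure \<Rightarrow> ('a \<Rightarrow> 'b::real_normed_vector) \<Rightarrow> real" where
  "bochner_norm M f = sqrt (\<integral>x. (norm (f x))\<^sup>2 \<partial>M)"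

text \<open>A finite-dimensional linear space of functions modulo almost everywhere equality.\<close>

definition finite_dim_function_space :: "'a measure \<Rightarrow> ('a \<Rightarrow> 'b::real_vector) set \<Rightarrow> bool" where
  "finite_dim_function_space M W \<longleftrightarrow>
     (\<lambda>x. 0) \<in> W \<and>
     (\<forall>p\<in>W. \<forall>q\<in>W. (\<lambda>x. p x + q x) \<in> W) \<and>
     (\<forall>c. \<forall>p\<in>W. (\<lambda>x. c *\<^sub>R p x) \<in> W) \<and>
     (\<exists>B\<subseteq>W. finite B \<and> (\<forall>p\<in>W. \<exists>c. AE x in M. p x = (\<Sum>b\<in>B. c b *\<^sub>R b x)))"

section \<open>Boundaries\<close>

text \<open>
  The \<open>m\<close>-dimensional Hausdorff measure, normalised to agree with Lebesgue measure
  on \<open>m\<close>-dimensional subspaces.  All Borel sets are Caratheodory measurable for this metric outer measure.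
\<close>

definition hausdorff_outer :: "nat \<Rightarrow> 'a::metric_space set \<Rightarrow> ennreal" where
  "hausdorff_outer m A =
     (SUP \<delta>\<in>{0<..}. INF U\<in>{U :: nat \<Rightarrow> 'a set. A \<subseteq> (\<Union>i. U i) \<and> (\<forall>i. bounded (U i) \<and> diameter (U i) \<le> \<delta>)}.
        (\<Sum>i. ennreal (unit_ball_vol (real m) * (diameter (U i) / 2) ^ m)))"

definition hausdorff_measure :: "nat \<Rightarrow> 'a::metric_space measure" where
  "hausdorff_measure m = measure_of UNIV (sets borel) (hausdorff_outer m)"

definition surface_measure :: "'a::euclidean_space set \<Rightarrow> 'a measure" where
  "surface_measure U = restrict_space (hausdorff_measure (DIM('a) - 1)) (frontier U)"

text \<open>
  Near a boundary point where the boundary is of class \<open>C\<^sup>1\<close>, the set is a strict sublevel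
  set \<open>{\<rho> < 0}\<close> of a \<open>C\<^sup>1\<close> function whose gradient \<open>D\<close> does not vanish.
\<close>

definition outer_unit_normal :: "'a::euclidean_space set \<Rightarrow> 'a \<Rightarrow> 'a \<Rightarrow> bool" where
  "outer_unit_normal U x n \<longleftrightarrow> x \<in> frontier U \<and>
     (\<exists>N \<rho> D. open N \<and> x \<in> N \<and>
        (\<forall>y\<in>N. (\<rho> has_derivative (\<lambda>h. D y \<bullet> h)) (at y) \<and> D y \<noteq> 0) \<and> continuous_on N D \<and>
        U \<inter> N = {y \<in> N. \<rho> y < 0} \<and> n = D x /\<^sub>R norm (D x))"

definition C1_boundary_points :: "'a::euclidean_space set \<Rightarrow> 'a set" where
  "C1_boundary_points U = {x. \<exists>n. outer_unit_normal U x n}"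

definition unit_normal :: "'a::euclidean_space set \<Rightarrow> 'a \<Rightarrow> 'a" where
  "unit_normal U x = (THE n. outer_unit_normal U x n)"

text \<open>
  The boundary is a locally finite union of (closed) faces whose relative interiors are
  connected, pairwise disjoint and of class \<open>C\<^sup>1\<close>; edges and corners form a null set.
\<close>

definition piecewise_C1_boundary :: "'a::euclidean_space set \<Rightarrow> bool" where
  "piecewise_C1_boundary U \<longleftrightarrow>
     (\<exists>F. (\<forall>S\<in>F. openin (top_of_set (frontier U)) S \<and> connected S \<and> S \<subseteq> C1_boundary_points U) \<and>
          disjoint F \<and> locally_finite_in euclidean F \<and>
          frontier U = (\<Union>S\<in>F. closure S) \<and>
          hausdorff_outer (DIM('a) - 1) (frontier U - \<Union>F) = 0)"

text \<open>
  Near every boundary point the set is, in rotated coordinates, the subgraph of a Lipschitz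
  function; the Lipschitz constant is the same for the whole boundary.
\<close>

definition lipschitz_boundary :: "'a::euclidean_space set \<Rightarrow> bool" where
  "lipschitz_boundary U \<longleftrightarrow>
     (\<exists>L. \<forall>x\<in>frontier U. \<exists>e g r h. norm e = 1 \<and> 0 < r \<and> 0 < h \<and>
        L-lipschitz_on {z. z \<bullet> e = 0} g \<and>
        (\<forall>z s. z \<bullet> e = 0 \<and> norm z < r \<and> \<bar>s\<bar> < h \<longrightarrow>
               (x + z + s *\<^sub>R e \<in> U \<longleftrightarrow> s < g z)))"

section \<open>The kinetic Sobolev space\<close>

text \<open>
  Below, \<open>Q\<close> stands for the space-time cylinder, the type \<open>'a H1_sphere\<close> for the space \<open>V\<close>
  and \<open>'a H1_sphere \<Rightarrow>\<^sub>L real\<close> for its dual.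
\<close>

definition advection :: "'a \<Rightarrow> real \<times> 'a" where
  "advection v = (1, v)"

definition outflow :: "(real \<times> 'a::euclidean_space) set \<Rightarrow> ((real \<times> 'a) \<times> 'a) set" where
  "outflow Q = {(y, v). y \<in> C1_boundary_points Q \<and> norm v = 1 \<and> advection v \<bullet> unit_normal Q y > 0}"

definition inflow :: "(real \<times> 'a::euclidean_space) set \<Rightarrow> ((real \<times> 'a) \<times> 'a) set" where
  "inflow Q = {(y, v). y \<in> C1_boundary_points Q \<and> norm v = 1 \<and> advection v \<bullet> unit_normal Q y < 0}"

text \<open>
  The integral over \<open>Q \<times> sphere\<close> is written as an iterated integral, which does not depend on
  the representatives \<open>rep_H1_sphere (p y)\<close> chosen for the individual \<open>y\<close>.
\<close>

definition weak_kinetic_derivative ::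
  "(real \<times> 'a::euclidean_space) set \<Rightarrow> (real \<times> 'a \<Rightarrow> 'a H1_sphere) \<Rightarrow>
   (real \<times> 'a \<Rightarrow> 'a H1_sphere \<Rightarrow>\<^sub>L real) \<Rightarrow> bool" where
  "weak_kinetic_derivative Q p r \<longleftrightarrow>
     r \<in> bochner_L2 (lebesgue_on Q) \<and>
     (\<forall>\<psi> \<phi>. test_function Q \<psi> \<longrightarrow>
        (\<integral>y. blinfun_apply (r y) \<phi> * \<psi> y \<partial>lebesgue_on Q) =
        - (\<integral>y. (\<integral>v. rep_H1_sphere (p y) v * rep_H1_sphere \<phi> v *
                    frechet_derivative \<psi> (at y) (advection v) \<partial>sphere_measure) \<partial>lebesgue_on Q))"

definition kinetic_derivative ::
  "(real \<times> 'a::euclidean_space) set \<Rightarrow> (real \<times> 'a \<Rightarrow> 'a H1_sphere) \<Rightarrow>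
   real \<times> 'a \<Rightarrow> 'a H1_sphere \<Rightarrow>\<^sub>L real" where
  "kinetic_derivative Q p = (SOME r. weak_kinetic_derivative Q p r)"

definition H1_FP :: "(real \<times> 'a::euclidean_space) set \<Rightarrow> (real \<times> 'a \<Rightarrow> 'a H1_sphere) set" where
  "H1_FP Q = {p \<in> bochner_L2 (lebesgue_on Q). \<exists>r. weak_kinetic_derivative Q p r}"

definition H1_FP_norm :: "(real \<times> 'a::euclidean_space) set \<Rightarrow> (real \<times> 'a \<Rightarrow> 'a H1_sphere) \<Rightarrow> real" where
  "H1_FP_norm Q p = sqrt ((bochner_norm (lebesgue_on Q) p)\<^sup>2 +
                          (bochner_norm (lebesgue_on Q) (kinetic_derivative Q p))\<^sup>2)"

text \<open>
  Smooth compactly supported functions on \<open>\<real>\<^sup>d\<^sup>+\<^sup>1 \<times> sphere\<close> are the restrictions of smooth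
  compactly supported functions on the ambient space.
\<close>

definition smooth_vanishing_on_outflow ::
  "(real \<times> 'a::euclidean_space) set \<Rightarrow> ((real \<times> 'a) \<times> 'a \<Rightarrow> real) \<Rightarrow> bool" where
  "smooth_vanishing_on_outflow Q f \<longleftrightarrow> test_function UNIV f \<and> (\<forall>z\<in>outflow Q. f z = 0)"

definition represents ::
  "(real \<times> 'a::euclidean_space) set \<Rightarrow> (real \<times> 'a \<Rightarrow> 'a H1_sphere) \<Rightarrow> ((real \<times> 'a) \<times> 'a \<Rightarrow> real) \<Rightarrow> bool" where
  "represents Q p f \<longleftrightarrow>
     (AE y in lebesgue_on Q. AE v in sphere_measure. rep_H1_sphere (p y) v = f (y, v))"

definition H1_FP_outflow :: "(real \<times> 'a::euclidean_space) set \<Rightarrow> (real \<times> 'a \<Rightarrow> 'a H1_sphere) set" where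
  "H1_FP_outflow Q = {p \<in> H1_FP Q. \<forall>\<epsilon>>0. \<exists>f q. smooth_vanishing_on_outflow Q f \<and>
     q \<in> H1_FP Q \<and> represents Q q f \<and> H1_FP_norm Q (\<lambda>y. p y - q y) < \<epsilon>}"

definition inflow_measure :: "(real \<times> 'a::euclidean_space) set \<Rightarrow> ((real \<times> 'a) \<times> 'a) measure" where
  "inflow_measure Q = density (surface_measure Q \<Otimes>\<^sub>M sphere_measure)
     (\<lambda>(y, v). if (y, v) \<in> inflow Q then ennreal \<bar>advection v \<bullet> unit_normal Q y\<bar> else 0)"

text \<open>
  The continuous linear extension of the restriction to the inflow boundary; by density it is
  unique up to null sets.
\<close>

definition is_inflow_trace ::
  "(real \<times> 'a::euclidean_space) set \<Rightarrow>
   ((real \<times> 'a \<Rightarrow> 'a H1_sphere) \<Rightarrow> (real \<times> 'a) \<times> 'a \<Rightarrow> real) \<Rightarrow> bool" where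
  "is_inflow_trace Q \<gamma> \<longleftrightarrow>
     (\<forall>p\<in>H1_FP_outflow Q. \<gamma> p \<in> L2_functions (inflow_measure Q)) \<and>
     (\<forall>p\<in>H1_FP_outflow Q. \<forall>q\<in>H1_FP_outflow Q.
        AE z in inflow_measure Q. \<gamma> (\<lambda>y. p y + q y) z = \<gamma> p z + \<gamma> q z) \<and>
     (\<forall>c. \<forall>p\<in>H1_FP_outflow Q. AE z in inflow_measure Q. \<gamma> (\<lambda>y. c *\<^sub>R p y) z = c * \<gamma> p z) \<and>
     (\<exists>C. \<forall>p\<in>H1_FP_outflow Q. sqrt (\<integral>z. (\<gamma> p z)\<^sup>2 \<partial>inflow_measure Q) \<le> C * H1_FP_norm Q p) \<and>
     (\<forall>f. \<forall>q\<in>H1_FP_outflow Q. smooth_vanishing_on_outflow Q f \<and> represents Q q f \<longrightarrow>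
        (AE z in inflow_measure Q. \<gamma> q z = f z))"

section \<open>The Petrov-Galerkin discretisation\<close>

definition form_b ::
  "(real \<times> 'a::euclidean_space) set \<Rightarrow> (real \<times> 'a \<Rightarrow> 'a H1_sphere \<Rightarrow> 'a H1_sphere \<Rightarrow> real) \<Rightarrow>
   (real \<times> 'a \<Rightarrow> 'a H1_sphere) \<Rightarrow> (real \<times> 'a \<Rightarrow> 'a H1_sphere) \<Rightarrow> real" where
  "form_b Q a w p =
     (\<integral>y. blinfun_apply (- kinetic_derivative Q p y) (w y) + a y (w y) (p y) \<partial>lebesgue_on Q)"

definition load ::
  "(real \<times> 'a::euclidean_space) set \<Rightarrow> ((real \<times> 'a \<Rightarrow> 'a H1_sphere) \<Rightarrow> (real \<times> 'a) \<times> 'a \<Rightarrow> real) \<Rightarrow>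
   ((real \<times> 'a) \<times> 'a \<Rightarrow> real) \<Rightarrow> (real \<times> 'a \<Rightarrow> 'a H1_sphere) \<Rightarrow> real" where
  "load Q \<gamma> g p = (\<integral>z. g z * \<gamma> p z \<partial>inflow_measure Q)"

definition is_local_solution ::
  "(real \<times> 'a::euclidean_space) set \<Rightarrow> (real \<times> 'a \<Rightarrow> 'a H1_sphere \<Rightarrow> 'a H1_sphere \<Rightarrow> real) \<Rightarrow>
   'a H1_sphere set \<Rightarrow> (real \<times> 'a \<Rightarrow> 'a H1_sphere) \<Rightarrow> (real \<times> 'a \<Rightarrow> 'a H1_sphere) \<Rightarrow> bool" where
  "is_local_solution Q a Vh p z \<longleftrightarrow>
     z \<in> bochner_L2 (lebesgue_on Q) \<and>
     (AE y in lebesgue_on Q. z y \<in> Vh) \<and>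
     (AE y in lebesgue_on Q. \<forall>\<phi>\<in>Vh. a y (z y) \<phi> = blinfun_apply (- kinetic_derivative Q p y) \<phi>)"

definition trial_space ::
  "(real \<times> 'a::euclidean_space) set \<Rightarrow> (real \<times> 'a \<Rightarrow> 'a H1_sphere \<Rightarrow> 'a H1_sphere \<Rightarrow> real) \<Rightarrow>
   'a H1_sphere set \<Rightarrow> (real \<times> 'a \<Rightarrow> 'a H1_sphere) set \<Rightarrow> (real \<times> 'a \<Rightarrow> 'a H1_sphere) set" where
  "trial_space Q a Vh Yd = {\<lambda>y. p y + z y | p z. p \<in> Yd \<and> is_local_solution Q a Vh p z}"

text \<open>The value \<open>0\<close> is added to the supremum only to cover the trivial space \<open>Vh = {0}\<close>.\<close>

definition discrete_dual_norm :: "'b::real_normed_vector set \<Rightarrow> ('b \<Rightarrow>\<^sub>L real) \<Rightarrow> real" where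
  "discrete_dual_norm Vh \<psi> = Sup (insert 0 {blinfun_apply \<psi> \<phi> / norm \<phi> | \<phi>. \<phi> \<in> Vh \<and> \<phi> \<noteq> 0})"

definition discrete_Y_norm ::
  "(real \<times> 'a::euclidean_space) set \<Rightarrow> 'a H1_sphere set \<Rightarrow> (real \<times> 'a \<Rightarrow> 'a H1_sphere) \<Rightarrow> real" where
  "discrete_Y_norm Q Vh p = sqrt ((bochner_norm (lebesgue_on Q) p)\<^sup>2 +
     (\<integral>y. (discrete_dual_norm Vh (kinetic_derivative Q p y))\<^sup>2 \<partial>lebesgue_on Q))"

end

theory Submission
  imports Defs
begin

text \<open>
  Write \<open>r = - k \<bullet> \<nabla>p\<close> and \<open>w = p + z\<close> with \<open>a(z, \<cdot>) = r\<close> on \<open>V\<^sub>h\<close>.  Testing with \<open>z\<close> and \<open>p\<close> gives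
  \<open>b(w, p) = 2 \<integral> \<langle>r, p\<rangle> + \<integral> a(z, z) + a(p, p)\<close>.  The first integral is nonnegative because \<open>p\<close>
  vanishes on the outflow boundary, so \<open>b(w, p) \<ge> \<alpha> (\<parallel>p\<parallel>\<^sup>2 + \<parallel>z\<parallel>\<^sup>2)\<close>, while \<open>\<parallel>w\<parallel>\<^sup>2 \<le> 2 (\<parallel>p\<parallel>\<^sup>2 + \<parallel>z\<parallel>\<^sup>2)\<close>
  and \<open>\<parallel>r\<parallel> \<le> c \<parallel>z\<parallel>\<close> in the discrete dual norm.  This is the inf-sup bound, and it makes
  \<open>(p, q) \<mapsto> b(p + z\<^sub>p, q)\<close> positive definite, which gives existence and uniqueness.

  By density, nonnegativity of \<open>\<integral> \<langle>r, p\<rangle>\<close> reduces to \<open>\<integral> k \<bullet> \<nabla>(f\<^sup>2) \<le> 0\<close> for smooth \<open>f\<close> vanishing on the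
  outflow boundary.  Instead of the divergence theorem, integrate along the lines
  \<open>t \<mapsto> (t, x + t v)\<close>: each piece of such a line inside the cylinder contributes the value of \<open>f\<^sup>2\<close>
  at its exit point minus that at its entry point, and for almost every \<open>x\<close> all exit points are
  outflow points.  Tangential exits form a null set by Sard's lemma, exits through edges and
  corners because these have vanishing surface measure.
\<close>

section \<open>The fundamental lemma of the calculus of variations on open sets\<close>

text \<open>The constant: for S = |p|^2 + |z|^2 in L2(Q; V) one has |w| <= sqrt (2 S), and the
  discrete norm of p is at most max{1, c_a} sqrt S, so \<alpha> S divided by both leaves \<alpha> /
  (sqrt 2 max{1, c_a}). Three obstacles shape the rest. The kinetic derivative is an arbitrary
  choice among weak derivatives, and it is known only through its values on single vectors \<phi>,
  each with its own exceptional null set; these are merged by passing to countably many vectors,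
  obtained from the simple functions that approximate a strongly measurable function. The local
  solution z must be measurable in (t, x), so it comes from elimination formulas and not from a
  separate existence argument at each point. Finally, functions stand for classes: the basis of the
  test space must be independent modulo null sets, and the load must be shown to vanish on null
  functions. Existence then is one square system, because b |-> b + z_b turns the test basis into
  trial functions and coercivity makes the matrix positive definite.\<close>

definition bump_kernel :: "nat \<Rightarrow> real \<Rightarrow> real" where
  "bump_kernel m s = (if s > 0 then exp (- 1 / s) / s ^ m else 0)"

lemma bump_kernel_tendsto_0: "(bump_kernel m \<longlongrightarrow> 0) (at 0)"
proof -
  have "((\<lambda>s::real. (inverse s) ^ m / exp (inverse s)) \<longlongrightarrow> 0) (at_right 0)"
    by (rule filterlim_compose[OF tendsto_power_div_exp_0 filterlim_inverse_at_top_right])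
  then have "(bump_kernel m \<longlongrightarrow> 0) (at_right 0)"
    by (rule filterlim_mono_eventually)
       (auto simp: bump_kernel_def eventually_at_right_less exp_minus field_simps
             intro!: eventually_mono[OF eventually_at_right_less])
  moreover have "(bump_kernel m \<longlongrightarrow> 0) (at_left 0)"
    by (rule tendsto_eventually)
       (auto simp: bump_kernel_def eventually_at_filter)
  ultimately show ?thesis by (simp add: filterlim_split_at)
qed

text \<open>The power \<open>m\<close> is carried along because it makes the family closed under
  differentiation; smoothness of exp (-1/s) then follows for all members at once by induction. At 0
  the difference quotient is the next kernel.\<close>

lemma bump_kernel_derivative:
  "(bump_kernel m has_real_derivative (bump_kernel (m + 2) s - real m * bump_kernel (m + 1) s)) (at s)"
proof -
  consider "s > 0" | "s < 0" | "s = 0" by linarith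
  then show ?thesis
  proof cases
    case 1
    have "((\<lambda>s. exp (- 1 / s) / s ^ m) has_real_derivative
        (bump_kernel (m + 2) s - real m * bump_kernel (m + 1) s)) (at s)"
    proof -
      have "real m * s ^ (m - 1) * s = real m * s ^ m" by (cases m) auto
      with 1 show ?thesis
        by (auto intro!: derivative_eq_intros simp: bump_kernel_def field_simps power2_eq_square)
    qed
    then show ?thesis
      by (rule has_field_derivative_transform_within_open[where S="{0<..}"])
         (use 1 in \<open>auto simp: bump_kernel_def\<close>)
  next
    case 2
    have "((\<lambda>s. 0) has_real_derivative 0) (at s)" by simp
    then have "(bump_kernel m has_real_derivative 0) (at s)"
      by (rule has_field_derivative_transform_within_open[where S="{..<0}"])
         (use 2 in \<open>auto simp: bump_kernel_def\<close>)
    then show ?thesis using 2 by (simp add: bump_kernel_def)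
  next
    case 3
    have "bump_kernel m h / h = bump_kernel (m + 1) h" if "h \<noteq> 0" for h
      using that by (auto simp: bump_kernel_def field_simps)
    then have "((\<lambda>h. bump_kernel m h / h) \<longlongrightarrow> 0) (at 0)"
      using bump_kernel_tendsto_0[of "m + 1"]
      by (subst tendsto_cong[where g="bump_kernel (m + 1)"]) (auto simp: eventually_at_filter)
    then show ?thesis
      using 3 by (simp add: DERIV_def bump_kernel_def)
  qed
qed

lemma frechet_derivative_real:
  "(f has_real_derivative D) (at x) \<Longrightarrow> frechet_derivative f (at x) = (*) D"
  by (rule frechet_eq) (simp add: has_field_derivative_def)

lemma Ck_bump_kernel: "Ck k (bump_kernel m)"
proof (induction k arbitrary: m)
  case 0
  then show ?case
    using DERIV_isCont[OF bump_kernel_derivative] by (auto simp: continuous_at_imp_continuous_on)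
next
  case (Suc k)
  have "frechet_derivative (bump_kernel m) (at x) =
      (*) (bump_kernel (m + 2) x - real m * bump_kernel (m + 1) x)" for x
    by (rule frechet_derivative_real[OF bump_kernel_derivative])
  moreover have "bump_kernel m differentiable (at x)" for x
    using bump_kernel_derivative real_differentiable_def by blast
  moreover have "Ck k (\<lambda>x. bump_kernel (m + 2) x + (- real m) * bump_kernel (m + 1) x)"
    by (intro Ck_add Ck_mult Ck_const Suc.IH)
  ultimately show ?case by simp
qed

text \<open>The derivative in direction b is the constant b . w times h' composed with the same
  affine map, so the induction hypothesis applies to h'.\<close>

lemma Ck_compose_affine:
  fixes h :: "real \<Rightarrow> real" and w :: "'a::euclidean_space"
  shows "Ck k h \<Longrightarrow> Ck k (\<lambda>y. h (y \<bullet> w + c))"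
proof (induction k arbitrary: h)
  case 0
  then have "continuous_on UNIV h" by simp
  then have "continuous_on UNIV (\<lambda>y. h (y \<bullet> w + c))"
    by (rule continuous_on_compose2) (auto intro!: continuous_intros)
  then show ?case by simp
next
  case (Suc k)
  have hd: "(h has_derivative frechet_derivative h (at s)) (at s)" for s
    using Suc.prems by (simp add: frechet_derivative_works)
  have lin: "frechet_derivative h (at s) t = t * frechet_derivative h (at s) 1" for s t
    using linear_scale[OF bounded_linear.linear[OF has_derivative_bounded_linear[OF hd[of s]]], of t 1] by simp
  have d: "((\<lambda>y. h (y \<bullet> w + c)) has_derivative
        (\<lambda>H. frechet_derivative h (at (y \<bullet> w + c)) (H \<bullet> w))) (at y)" for y
    by (rule has_derivative_compose[of "\<lambda>y. y \<bullet> w + c", OF _ hd])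
       (auto intro!: derivative_eq_intros)
  have "Ck k (\<lambda>y. (\<lambda>s. frechet_derivative h (at s) 1) (y \<bullet> w + c))"
    by (rule Suc.IH) (use Suc.prems in simp)
  then have "Ck k (\<lambda>y. (b \<bullet> w) * frechet_derivative h (at (y \<bullet> w + c)) 1)" for b :: 'a
    by (intro Ck_mult Ck_const)
  then have "Ck k (\<lambda>y. frechet_derivative (\<lambda>y. h (y \<bullet> w + c)) (at y) b)" for b :: 'a
    by (subst frechet_eq[OF d], subst lin)
  then show ?case using d by (auto simp: differentiable_def)
qed

lemma Ck_prod:
  "finite I \<Longrightarrow> (\<And>i. i \<in> I \<Longrightarrow> Ck k (f i)) \<Longrightarrow> Ck k (\<lambda>y. \<Prod>i\<in>I. f i y)"
  by (induction I rule: finite_induct) (auto simp: Ck_const intro: Ck_mult)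

text \<open>The factors are exp (-1 / (n (y_i - a_i))) and exp (-1 / (n (b_i - y_i))) inside the
  box; growing n flattens them to 1. The arguments are written as y . w + c to match
  \<open>Ck_compose_affine\<close>.\<close>

definition box_bump :: "'a::euclidean_space \<Rightarrow> 'a \<Rightarrow> nat \<Rightarrow> 'a \<Rightarrow> real" where
  "box_bump a b n y = (\<Prod>i\<in>Basis. bump_kernel 0 (y \<bullet> (real n *\<^sub>R i) + - real n * (a \<bullet> i)) *
                                bump_kernel 0 (y \<bullet> (- real n *\<^sub>R i) + real n * (b \<bullet> i)))"

lemma smooth_box_bump: "smooth (box_bump a b n)"
  unfolding smooth_def box_bump_def
  by (intro allI Ck_prod Ck_mult Ck_compose_affine Ck_bump_kernel finite_Basis)

lemma box_bump_outside:
  assumes "y \<notin> box a b"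
  shows "box_bump a b n y = 0"
proof -
  from assms obtain i where i: "i \<in> Basis" "\<not> (a \<bullet> i < y \<bullet> i \<and> y \<bullet> i < b \<bullet> i)"
    by (auto simp: mem_box)
  have "bump_kernel 0 (y \<bullet> (real n *\<^sub>R i) + - real n * (a \<bullet> i)) *
     bump_kernel 0 (y \<bullet> (- real n *\<^sub>R i) + real n * (b \<bullet> i)) = 0"
  proof (cases "a \<bullet> i < y \<bullet> i")
    case True
    then have "y \<bullet> (- real n *\<^sub>R i) + real n * (b \<bullet> i) \<le> 0"
      using i mult_left_mono[of "b \<bullet> i" "y \<bullet> i" "real n"] by simp
    then show ?thesis by (simp add: bump_kernel_def)
  next
    case False
    then have "y \<bullet> (real n *\<^sub>R i) + - real n * (a \<bullet> i) \<le> 0"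
      using i mult_left_mono[of "y \<bullet> i" "a \<bullet> i" "real n"] by simp
    then show ?thesis by (simp add: bump_kernel_def)
  qed
  then show ?thesis unfolding box_bump_def using i(1) by (intro prod_zero) auto
qed

lemma bump_kernel_bounds: "0 \<le> bump_kernel 0 s" "bump_kernel 0 s \<le> 1"
  by (auto simp: bump_kernel_def)

lemma box_bump_bounds: "0 \<le> box_bump a b n y" "box_bump a b n y \<le> 1"
  unfolding box_bump_def
  by (auto intro!: prod_nonneg prod_le_1 mult_nonneg_nonneg mult_le_one bump_kernel_bounds)

lemma bump_kernel_limit:
  assumes "c > 0"
  shows "(\<lambda>n. bump_kernel 0 (real n * c)) \<longlonglongrightarrow> 1"
proof -
  have "(\<lambda>n. 1 / (real n * c)) \<longlonglongrightarrow> 0"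
    using tendsto_mult[OF lim_1_over_n tendsto_const[of "1 / c" sequentially]] by simp
  then have "(\<lambda>n. - (1 / (real n * c))) \<longlonglongrightarrow> - 0" by (rule tendsto_minus)
  then have "(\<lambda>n. exp (- (1 / (real n * c)))) \<longlonglongrightarrow> exp (- 0)" by (rule tendsto_exp)
  then have "(\<lambda>n. exp (- 1 / (real n * c))) \<longlonglongrightarrow> 1" by simp
  moreover have "eventually (\<lambda>n. exp (- 1 / (real n * c)) = bump_kernel 0 (real n * c)) sequentially"
    using eventually_gt_at_top[of "0::nat"]
    by eventually_elim (use assms in \<open>auto simp: bump_kernel_def\<close>)
  ultimately show ?thesis by (rule Lim_transform_eventually)
qed

lemma box_bump_limit: "(\<lambda>n. box_bump a b n y) \<longlonglongrightarrow> indicator (box a b) y"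
proof (cases "y \<in> box a b")
  case True
  have "(\<lambda>n. bump_kernel 0 (y \<bullet> (real n *\<^sub>R i) + - real n * (a \<bullet> i)) *
          bump_kernel 0 (y \<bullet> (- real n *\<^sub>R i) + real n * (b \<bullet> i))) \<longlonglongrightarrow> 1 * 1" if "i \<in> Basis" for i
  proof (rule tendsto_mult)
    have "a \<bullet> i < y \<bullet> i" "y \<bullet> i < b \<bullet> i" using True that by (auto simp: mem_box)
    then have "(\<lambda>n. bump_kernel 0 (real n * (y \<bullet> i - a \<bullet> i))) \<longlonglongrightarrow> 1"
      "(\<lambda>n. bump_kernel 0 (real n * (b \<bullet> i - y \<bullet> i))) \<longlonglongrightarrow> 1"
      by (auto intro: bump_kernel_limit)
    then show "(\<lambda>n. bump_kernel 0 (y \<bullet> (real n *\<^sub>R i) + - real n * (a \<bullet> i))) \<longlonglongrightarrow> 1"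
      "(\<lambda>n. bump_kernel 0 (y \<bullet> (- real n *\<^sub>R i) + real n * (b \<bullet> i))) \<longlonglongrightarrow> 1"
      by (simp_all add: algebra_simps)
  qed
  then have "(\<lambda>n. box_bump a b n y) \<longlonglongrightarrow> (\<Prod>i\<in>(Basis::'a set). 1)"
    unfolding box_bump_def by (intro tendsto_prod) simp
  then show ?thesis using True by simp
next
  case False
  then show ?thesis by (simp add: box_bump_outside)
qed

lemma box_bump_test_function:
  assumes "cbox a b \<subseteq> Q"
  shows "test_function Q (box_bump a b n)"
proof -
  have "supp (box_bump a b n) \<subseteq> cbox a b"
    unfolding supp_def
    by (rule closure_minimal) (use box_bump_outside[of _ a b n] box_subset_cbox in \<open>auto simp: closed_cbox\<close>)
  moreover have "closed (supp (box_bump a b n))" by (simp add: supp_def)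
  ultimately show ?thesis
    using assms smooth_box_bump bounded_subset[OF bounded_cbox]
    by (auto simp: test_function_def compact_eq_bounded_closed)
qed

text \<open>Boxes form an intersection-stable generator of the Borel sets, and the sets over which u
  integrates to 0 form a Dynkin system. The whole space is not a box, so its integral is assumed
  separately to handle complements.\<close>

lemma AE_zero_if_box_integrals_zero:
  fixes u :: "'a::euclidean_space \<Rightarrow> real"
  assumes u: "integrable lborel u" and total: "(\<integral>y. u y \<partial>lborel) = 0"
    and box: "\<And>a b. (\<integral>y. u y * indicator (box a b) y \<partial>lborel) = 0"
  shows "AE y in lborel. u y = 0"
proof -
  have int: "integrable lborel (\<lambda>y. u y * indicator A y)" if "A \<in> sets borel" for A
    using integrable_mult_indicator[of A lborel u] u that by (simp add: mult.commute)
  have "(\<integral>y. u y * indicator A y \<partial>lborel) = 0" if "A \<in> sets borel" for A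
  proof -
    have "Int_stable (range (\<lambda>(a, b). box a b) :: 'a set set)"
    proof -
      have "box c d \<inter> box c' d' \<in> range (\<lambda>(a, b). box a b)" for c d c' d' :: 'a
        unfolding box_Int_box by (simp add: image_iff, intro exI, rule refl)
      then show ?thesis by (auto simp: Int_stable_def)
    qed
    moreover have "range (\<lambda>(a, b). box a b) \<subseteq> Pow (UNIV :: 'a set)" by simp
    moreover have "A \<in> sigma_sets UNIV (range (\<lambda>(a, b). box a b))"
      using that by (simp add: borel_eq_box)
    ultimately show ?thesis
    proof (induct A rule: sigma_sets_induct_disjoint)
      case (basic A)
      then show ?case using box by auto
    next
      case empty
      then show ?case by simp
    next
      case (compl A)
      have A: "A \<in> sets borel" using compl(1) by (simp add: borel_eq_box)
      have "(\<integral>y. u y * indicator (UNIV - A) y \<partial>lborel) = (\<integral>y. u y - u y * indicator A y \<partial>lborel)"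
        by (rule Bochner_Integration.integral_cong) (auto simp: indicator_def)
      also have "\<dots> = 0" using u int[OF A] compl(2) total by simp
      finally show ?case .
    next
      case (union A)
      have A: "A i \<in> sets borel" for i using union(2) by (auto simp: borel_eq_box)
      have "integrable lborel (\<lambda>y. u y * indicator (\<Union>i. A i) y)" using A by (intro int) auto
      then have "set_integrable lborel (\<Union>i. A i) u"
        by (simp add: set_integrable_def mult.commute)
      then have "(\<integral>y. indicator (\<Union>i. A i) y *\<^sub>R u y \<partial>lborel)
          = (\<Sum>i. (\<integral>y. indicator (A i) y *\<^sub>R u y \<partial>lborel))"
        using lebesgue_integral_countable_add[of A lborel u] A union(1)
        by (auto simp: disjoint_family_on_def set_lebesgue_integral_def)
      then show ?case using union(3) by (simp add: mult.commute)
    qed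
  qed
  then show ?thesis
    by (intro density_unique_real[of lborel u "\<lambda>_. 0"])
       (use u in \<open>auto simp: set_lebesgue_integral_def mult.commute\<close>)
qed

text \<open>Bumps converge boundedly to the indicator of a box, so u integrates to 0 over every box
  with closure in Q, hence vanishes almost everywhere on such boxes; by Lindelof countably many of
  them cover Q. A Borel representative w of u allows the work to be done in
  \<open>lborel\<close>.\<close>

lemma fundamental_lemma_open:
  fixes u :: "'a::euclidean_space \<Rightarrow> real"
  assumes Q: "open Q" and u: "u \<in> L2_functions (lebesgue_on Q)"
    and test: "\<And>\<psi>. test_function Q \<psi> \<Longrightarrow> (\<integral>y. u y * \<psi> y \<partial>lebesgue_on Q) = 0"
  shows "AE y in lebesgue_on Q. u y = 0"
proof -
  have Ql [simp]: "Q \<in> sets lebesgue" using Q by (simp add: borel_open sets_completionI_sets)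
  have um: "(\<lambda>y. indicator Q y * u y) \<in> borel_measurable (completion lborel)"
    using u borel_measurable_restrict_space_iff[of Q lebesgue u] by (auto simp: L2_functions_def)
  obtain w where w [measurable]: "w \<in> borel_measurable lborel"
    and ae: "AE y in lborel. indicator Q y * u y = w y"
    using completion_ex_borel_measurable_real[OF um] by auto
  have ael: "AE y in lebesgue. indicator Q y * u y = w y" using ae by (rule AE_completion)
  have i2: "integrable lebesgue (\<lambda>y. indicator Q y * (u y)\<^sup>2)"
    using u integrable_restrict_space[of Q lebesgue "\<lambda>y. (u y)\<^sup>2"] by (auto simp: L2_functions_def)
  have "AE y in lebesgue. indicator Q y * (u y)\<^sup>2 = (w y)\<^sup>2"
    using ael by eventually_elim (auto simp: indicator_def split: if_splits)
  then have "integrable lebesgue (\<lambda>y. (w y)\<^sup>2)"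
    by (intro integrable_cong_AE_imp[OF i2]) (auto intro: measurable_completion)
  then have w2: "integrable lborel (\<lambda>y. (w y)\<^sup>2)"
    by (subst (asm) integrable_completion) auto
  have conv: "(\<integral>y. u y * h y \<partial>lebesgue_on Q) = (\<integral>y. w y * h y \<partial>lborel)"
    if [measurable]: "h \<in> borel_measurable borel" for h
  proof -
    have "(\<integral>y. u y * h y \<partial>lebesgue_on Q) = (\<integral>y. (indicator Q y * u y) * h y \<partial>lebesgue)"
      by (subst integral_restrict_space) (auto simp: mult.assoc)
    also have "\<dots> = (\<integral>y. w y * h y \<partial>lebesgue)"
    proof (rule integral_cong_AE)
      have "h \<in> borel_measurable lebesgue" by (rule measurable_completion) simp
      then show "(\<lambda>y. (indicator Q y * u y) * h y) \<in> borel_measurable lebesgue"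
        by (rule borel_measurable_times[OF um])
      show "(\<lambda>y. w y * h y) \<in> borel_measurable lebesgue"
        by (rule measurable_completion) simp
    qed (use ael in auto)
    also have "\<dots> = (\<integral>y. w y * h y \<partial>lborel)"
      by (rule integral_completion) simp
    finally show ?thesis .
  qed
  have AEbox: "AE y in lborel. y \<in> box a b \<longrightarrow> w y = 0" if ab: "cbox a b \<subseteq> Q" for a b
  proof -
    \<comment> \<open>Square integrability gives integrability only on sets of finite measure, hence
      the truncation to one box.\<close>
    define w' where "w' = (\<lambda>y. w y * indicator (box a b) y)"
    have fin: "integrable lborel (\<lambda>y. indicator (box a b) y :: real)"
      using emeasure_bounded_finite[of "box a b"] by (auto simp: bounded_box)
    have bound: "\<bar>w y * indicator (box a b) y\<bar> \<le> (w y)\<^sup>2 + indicator (box a b) y" for y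
      using sum_squares_bound[of "\<bar>w y\<bar>" 1] by (auto simp: indicator_def power2_eq_square)
    have w': "integrable lborel w'"
      unfolding w'_def
    proof (rule Bochner_Integration.integrable_bound)
      show "integrable lborel (\<lambda>y. (w y)\<^sup>2 + indicator (box a b) y)" using w2 fin by simp
      show "AE y in lborel. norm (w y * indicator (box a b) y) \<le> norm ((w y)\<^sup>2 + indicator (box a b) y)"
        using bound by (auto intro!: AE_I2 simp: order_trans[OF _ abs_ge_self])
    qed simp
    have sub0: "(\<integral>y. w y * indicator (box c d) y \<partial>lborel) = 0" if cd: "box c d \<subseteq> box a b" for c d
    \<comment> \<open>The closure of \<open>box c d\<close> is \<open>cbox c d\<close> only for a
      nonempty box.\<close>
    proof (cases "box c d = {}")
      case True
      then show ?thesis by simp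
    next
      case False
      have "cbox c d \<subseteq> Q"
        using closure_mono[OF cd] closure_box[OF False] ab
          closure_minimal[OF box_subset_cbox[of a b] closed_cbox] by blast
      then have t: "(\<integral>y. w y * box_bump c d n y \<partial>lborel) = 0" for n
        using test[OF box_bump_test_function[of c d Q n]]
          conv[OF borel_measurable_continuous_onI[OF smooth_continuous[OF smooth_box_bump[of c d n]]]]
        by simp
      have "(\<lambda>n. \<integral>y. w y * box_bump c d n y \<partial>lborel) \<longlonglongrightarrow> (\<integral>y. w y * indicator (box c d) y \<partial>lborel)"
      proof (rule integral_dominated_convergence[where w="\<lambda>y. \<bar>w' y\<bar>"])
        show "(\<lambda>y. w y * box_bump c d n y) \<in> borel_measurable lborel" for n
          using borel_measurable_continuous_onI[OF smooth_continuous[OF smooth_box_bump[of c d n]]]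
          by auto
        show "AE y in lborel. (\<lambda>n. w y * box_bump c d n y) \<longlonglongrightarrow> w y * indicator (box c d) y"
          by (auto intro!: AE_I2 tendsto_mult_left box_bump_limit)
        show "AE y in lborel. norm (w y * box_bump c d n y) \<le> \<bar>w' y\<bar>" for n
        proof (rule AE_I2)
          fix y
          show "norm (w y * box_bump c d n y) \<le> \<bar>w' y\<bar>"
            using box_bump_bounds[of c d n y] box_bump_outside[of y c d n] cd
            by (cases "y \<in> box c d") (auto simp: w'_def abs_mult mult_left_le)
        qed
      qed (use w' in auto)
      then have "(\<lambda>n::nat. 0::real) \<longlonglongrightarrow> (\<integral>y. w y * indicator (box c d) y \<partial>lborel)"
        by (simp only: t)
      then show ?thesis using LIMSEQ_unique[OF tendsto_const] by metis
    qed
    have "AE y in lborel. w' y = 0"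
    proof (rule AE_zero_if_box_integrals_zero[OF w'])
      show "(\<integral>y. w' y \<partial>lborel) = 0" using sub0[of a b] by (simp add: w'_def)
      show "(\<integral>y. w' y * indicator (box c d) y \<partial>lborel) = 0" for c d
      proof -
        have "\<exists>c' d'. box a b \<inter> box c d = box c' d'" by (intro exI, rule box_Int_box)
        then obtain c' d' where cd': "box a b \<inter> box c d = box c' d'" by metis
        have "(\<integral>y. w' y * indicator (box c d) y \<partial>lborel) = (\<integral>y. w y * indicator (box c' d') y \<partial>lborel)"
          by (rule Bochner_Integration.integral_cong) (auto simp: w'_def cd'[symmetric] indicator_def)
        also have "\<dots> = 0" by (rule sub0) (use cd' in auto)
        finally show ?thesis .
      qed
    qed
    then show ?thesis by eventually_elim (auto simp: w'_def)
  qed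
  define F where "F = {box a b |a b. cbox a b \<subseteq> Q}"
  have "open B" if "B \<in> F" for B
    using that unfolding F_def by (elim CollectE exE conjE) (simp only: open_box)
  then obtain F' where F': "F' \<subseteq> F" "countable F'" "\<Union>F' = \<Union>F"
    by (rule Lindelof)
  have "Q \<subseteq> \<Union>F"
  proof
    fix y assume "y \<in> Q"
    then obtain a b where ab: "cbox a b \<subseteq> Q" "y \<in> box a b"
      using open_contains_cbox[OF Q] by metis
    then have "box a b \<in> F" unfolding F_def by blast
    then show "y \<in> \<Union>F" using ab(2) by (rule UnionI)
  qed
  moreover have "AE y in lborel. \<forall>B\<in>F'. y \<in> B \<longrightarrow> w y = 0"
    unfolding AE_ball_countable[OF F'(2)]
  proof
    fix B assume "B \<in> F'"
    then obtain a b where "B = box a b" "cbox a b \<subseteq> Q" using F'(1) unfolding F_def by blast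
    then show "AE y in lborel. y \<in> B \<longrightarrow> w y = 0" using AEbox by simp
  qed
  ultimately have "AE y in lborel. y \<in> Q \<longrightarrow> w y = 0"
    unfolding F'(3)[symmetric] by (auto elim!: eventually_mono)
  with ae have "AE y in lborel. y \<in> Q \<longrightarrow> u y = 0" by eventually_elim auto
  then show ?thesis by (subst AE_restrict_space_iff) (auto intro: AE_completion)
qed

section \<open>Bochner measurable functions\<close>

text \<open>The pointwise \<open>lim\<close> is measurable and differs from g only on a null set,
  which completeness absorbs.\<close>

lemma (in complete_measure) borel_measurable_AE_LIMSEQ:
  fixes f :: "nat \<Rightarrow> 'a \<Rightarrow> real"
  assumes [measurable]: "\<And>i. f i \<in> borel_measurable M"
    and lim: "AE x in M. (\<lambda>i. f i x) \<longlonglongrightarrow> g x"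
  shows "g \<in> borel_measurable M"
proof -
  define h where "h = (\<lambda>x. lim (\<lambda>i. f i x))"
  have hm: "h \<in> borel_measurable M"
    unfolding h_def by (rule borel_measurable_lim_metric) simp
  have ae: "AE x in M. h x = g x"
    using lim by eventually_elim (simp add: h_def limI)
  show ?thesis
  proof (rule measurableI)
    fix A :: "real set" assume A: "A \<in> sets borel"
    show "g -` A \<inter> space M \<in> sets M"
    proof (rule in_sets_AE)
      show "AE x in M. (x \<in> h -` A \<inter> space M) = (x \<in> g -` A \<inter> space M)"
        using ae by eventually_elim auto
    qed (use hm A in \<open>auto intro: measurable_sets\<close>)
  qed simp
qed

lemma (in complete_measure) borel_measurable_AE_eq:
  fixes f g :: "'a \<Rightarrow> real"
  assumes "f \<in> borel_measurable M" "AE x in M. f x = g x"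
  shows "g \<in> borel_measurable M"
proof (rule borel_measurable_AE_LIMSEQ[of "\<lambda>_. f"])
  show "AE x in M. (\<lambda>i. f x) \<longlonglongrightarrow> g x" using assms(2) by eventually_elim simp
qed (rule assms(1)[rule_format])

lemma complete_lebesgue_on:
  assumes "S \<in> sets lebesgue"
  shows "complete_measure (lebesgue_on S)"
proof
  fix A B :: "'a set" assume AB: "B \<subseteq> A" "A \<in> null_sets (lebesgue_on S)"
  then have "A \<in> null_sets lebesgue" "A \<subseteq> S"
    using assms by (auto simp: null_sets_restrict_space)
  then have "B \<in> sets lebesgue" "B \<subseteq> S"
    using AB(1) complete_measure.complete[of lebesgue B A] by (auto simp: complete_measure_def completion.complete)
  then show "B \<in> sets (lebesgue_on S)"
    using assms by (auto simp: sets_restrict_space_iff)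
qed

section \<open>Strong measurability and square integrable Bochner functions\<close>

lemma strongly_measurableE:
  assumes "strongly_measurable M f"
  obtains s where "\<forall>n::nat. simple_function M (s n)" "AE x in M. (\<lambda>n. s n x) \<longlonglongrightarrow> f x"
  using assms unfolding strongly_measurable_def by (elim exE conjE) (rule that)

lemma strongly_measurable_const: "strongly_measurable M (\<lambda>x. c)"
  unfolding strongly_measurable_def by (rule exI[of _ "\<lambda>n x. c"]) simp

text \<open>Combining the simple approximations pointwise uses no more than joint sequential
  continuity of h, which covers sums, scalar multiples and the duality pairing.\<close>

lemma strongly_measurable_compose2:
  assumes f: "strongly_measurable M f" and g: "strongly_measurable M g"
    and lim: "\<And>u v a b. u \<longlonglongrightarrow> a \<Longrightarrow> v \<longlonglongrightarrow> b \<Longrightarrow> (\<lambda>n::nat. h (u n) (v n)) \<longlonglongrightarrow> h a b"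
  shows "strongly_measurable M (\<lambda>x. h (f x) (g x))"
proof -
  obtain s where s: "\<forall>n::nat. simple_function M (s n)" "AE x in M. (\<lambda>n. s n x) \<longlonglongrightarrow> f x"
    by (rule strongly_measurableE[OF f]) (rule that)
  obtain t where t: "\<forall>n::nat. simple_function M (t n)" "AE x in M. (\<lambda>n. t n x) \<longlonglongrightarrow> g x"
    by (rule strongly_measurableE[OF g]) (rule that)
  show ?thesis
    unfolding strongly_measurable_def
  proof (intro exI conjI allI)
    show "simple_function M (\<lambda>x. h (s n x) (t n x))" for n
      using s(1) t(1) by (simp add: simple_function_compose2)
    show "AE x in M. (\<lambda>n. h (s n x) (t n x)) \<longlonglongrightarrow> h (f x) (g x)"
      using s(2) t(2) by eventually_elim (rule lim)
  qed
qed

lemma strongly_measurable_compose: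
  assumes f: "strongly_measurable M f"
    and lim: "\<And>u a. u \<longlonglongrightarrow> a \<Longrightarrow> (\<lambda>n::nat. h (u n)) \<longlonglongrightarrow> h a"
  shows "strongly_measurable M (\<lambda>x. h (f x))"
  using strongly_measurable_compose2[OF f f, of "\<lambda>a b. h a"] lim by blast

lemma strongly_measurable_add:
  fixes f g :: "'a \<Rightarrow> 'b::real_normed_vector"
  shows "strongly_measurable M f \<Longrightarrow> strongly_measurable M g \<Longrightarrow> strongly_measurable M (\<lambda>x. f x + g x)"
  by (erule strongly_measurable_compose2) (auto intro: tendsto_add)

lemma strongly_measurable_scaleR:
  fixes f :: "'a \<Rightarrow> 'b::real_normed_vector"
  shows "strongly_measurable M c \<Longrightarrow> strongly_measurable M f \<Longrightarrow> strongly_measurable M (\<lambda>x. c x *\<^sub>R f x)"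
  by (erule strongly_measurable_compose2) (auto intro: tendsto_scaleR)

lemma strongly_measurable_sum:
  fixes f :: "'i \<Rightarrow> 'a \<Rightarrow> 'b::real_normed_vector"
  shows "(\<And>i. i \<in> I \<Longrightarrow> strongly_measurable M (f i)) \<Longrightarrow> strongly_measurable M (\<lambda>x. \<Sum>i\<in>I. f i x)"
  by (induction I rule: infinite_finite_induct)
     (auto intro: strongly_measurable_add strongly_measurable_const)

lemma strongly_measurable_real:
  fixes f :: "'a \<Rightarrow> real"
  assumes "f \<in> borel_measurable M"
  shows "strongly_measurable M f"
proof -
  from borel_measurable_implies_sequence_metric[OF assms, of 0]
  obtain s where "\<forall>n. simple_function M (s n)" "\<forall>x\<in>space M. (\<lambda>n. s n x) \<longlonglongrightarrow> f x" by blast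
  then show ?thesis unfolding strongly_measurable_def by (intro exI[of _ s]) (auto intro!: AE_I2)
qed

lemma (in complete_measure) strongly_measurable_imp_borel:
  fixes f :: "'a \<Rightarrow> real"
  assumes "strongly_measurable M f"
  shows "f \<in> borel_measurable M"
proof -
  obtain s where s: "\<forall>n::nat. simple_function M (s n)" "AE x in M. (\<lambda>n. s n x) \<longlonglongrightarrow> f x"
    by (rule strongly_measurableE[OF assms]) (rule that)
  show ?thesis
    by (rule borel_measurable_AE_LIMSEQ[OF borel_measurable_simple_function s(2)]) (rule s(1)[rule_format])
qed

lemma strongly_measurable_norm:
  fixes f :: "'a \<Rightarrow> 'b::real_normed_vector"
  shows "strongly_measurable M f \<Longrightarrow> strongly_measurable M (\<lambda>x. norm (f x))"
  by (erule strongly_measurable_compose) (rule tendsto_norm)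

lemma strongly_measurable_blinfun_apply:
  fixes r :: "'a \<Rightarrow> 'b::real_normed_vector \<Rightarrow>\<^sub>L 'c::real_normed_vector"
  shows "strongly_measurable M r \<Longrightarrow> strongly_measurable M w \<Longrightarrow>
    strongly_measurable M (\<lambda>x. blinfun_apply (r x) (w x))"
  by (erule strongly_measurable_compose2)
     (auto intro: bounded_bilinear.tendsto[OF bounded_bilinear_blinfun_apply])

lemma bochner_L2_norm:
  assumes M: "complete_measure M" and f: "f \<in> bochner_L2 M"
  shows "(\<lambda>x. norm (f x)) \<in> L2_functions M"
proof -
  interpret complete_measure M by fact
  show ?thesis
    using f by (auto simp: bochner_L2_def L2_functions_def
        intro: strongly_measurable_imp_borel strongly_measurable_norm)
qed

lemma bochner_L2I:
  assumes M: "complete_measure M" and f: "strongly_measurable M f"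
    and g: "g \<in> L2_functions M" and le: "AE x in M. norm (f x) \<le> g x"
  shows "f \<in> bochner_L2 M"
proof -
  interpret complete_measure M by fact
  have "(\<lambda>x. norm (f x)) \<in> borel_measurable M"
    by (intro strongly_measurable_imp_borel strongly_measurable_norm f)
  then have m: "(\<lambda>x. (norm (f x))\<^sup>2) \<in> borel_measurable M" by simp
  have i: "integrable M (\<lambda>x. (g x)\<^sup>2)" using g by (simp add: L2_functions_def)
  have "AE x in M. norm ((norm (f x))\<^sup>2) \<le> norm ((g x)\<^sup>2)"
    using le by eventually_elim (simp add: power_mono)
  then have "integrable M (\<lambda>x. (norm (f x))\<^sup>2)"
    by (rule Bochner_Integration.integrable_bound[OF i m])
  with f show ?thesis by (simp add: bochner_L2_def)
qed

lemma bochner_L2_add: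
  fixes f g :: "'a \<Rightarrow> 'b::real_normed_vector"
  assumes M: "complete_measure M" and f: "f \<in> bochner_L2 M" and g: "g \<in> bochner_L2 M"
  shows "(\<lambda>x. f x + g x) \<in> bochner_L2 M"
proof (rule bochner_L2I[OF M])
  show "strongly_measurable M (\<lambda>x. f x + g x)"
    using f g by (auto simp: bochner_L2_def intro: strongly_measurable_add)
  show "(\<lambda>x. norm (f x) + norm (g x)) \<in> L2_functions M"
    by (intro L2_add bochner_L2_norm M f g)
qed (simp add: norm_triangle_ineq)

lemma bochner_L2_scaleR:
  fixes f :: "'a \<Rightarrow> 'b::real_normed_vector"
  assumes f: "f \<in> bochner_L2 M"
  shows "(\<lambda>x. c *\<^sub>R f x) \<in> bochner_L2 M"
  using f by (auto simp: bochner_L2_def power_mult_distrib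
      intro: strongly_measurable_scaleR strongly_measurable_const)

lemma bochner_L2_diff:
  fixes f g :: "'a \<Rightarrow> 'b::real_normed_vector"
  assumes "complete_measure M" "f \<in> bochner_L2 M" "g \<in> bochner_L2 M"
  shows "(\<lambda>x. f x - g x) \<in> bochner_L2 M"
  using bochner_L2_add[OF assms(1,2) bochner_L2_scaleR[OF assms(3), of "-1"]] by simp

lemma bochner_norm_nonneg: "0 \<le> bochner_norm M f"
  by (simp add: bochner_norm_def)

lemma bochner_norm_power2: "(bochner_norm M f)\<^sup>2 = (\<integral>x. (norm (f x))\<^sup>2 \<partial>M)"
  by (simp add: bochner_norm_def)

text \<open>The integral of (f - t g)^2 is a quadratic polynomial in t that is never negative; its
  minimum is at t = C / B.\<close>

lemma L2_Cauchy_Schwarz: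
  fixes f g :: "'a \<Rightarrow> real"
  assumes f: "f \<in> L2_functions M" and g: "g \<in> L2_functions M"
  shows "\<bar>\<integral>x. f x * g x \<partial>M\<bar> \<le> sqrt (\<integral>x. (f x)\<^sup>2 \<partial>M) * sqrt (\<integral>x. (g x)\<^sup>2 \<partial>M)"
proof -
  define A B C where "A = (\<integral>x. (f x)\<^sup>2 \<partial>M)" and "B = (\<integral>x. (g x)\<^sup>2 \<partial>M)" and "C = (\<integral>x. f x * g x \<partial>M)"
  have i: "integrable M (\<lambda>x. (f x)\<^sup>2)" "integrable M (\<lambda>x. (g x)\<^sup>2)" "integrable M (\<lambda>x. f x * g x)"
    using f g L2_mult_integrable[OF f g] by (auto simp: L2_functions_def)
  have pos: "0 \<le> A - 2 * t * C + t\<^sup>2 * B" for t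
  proof -
    have "0 \<le> (\<integral>x. (f x - t * g x)\<^sup>2 \<partial>M)" by simp
    also have "\<dots> = (\<integral>x. (f x)\<^sup>2 - (2 * t) * (f x * g x) + t\<^sup>2 * (g x)\<^sup>2 \<partial>M)"
      by (rule Bochner_Integration.integral_cong) (auto simp: power2_eq_square algebra_simps)
    also have "\<dots> = A - 2 * t * C + t\<^sup>2 * B"
      using i by (simp add: A_def B_def C_def)
    finally show ?thesis .
  qed
  have AB: "A \<ge> 0" "B \<ge> 0" by (auto simp: A_def B_def)
  have "C\<^sup>2 \<le> A * B"
  proof (cases "B = 0")
    case True
    have "C = 0"
    proof (rule ccontr)
      assume "C \<noteq> 0"
      \<comment> \<open>For B = 0 this t gives the polynomial the value -1.\<close>
      then show False using pos[of "(A + 1) / (2 * C)"] True by simp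
    qed
    then show ?thesis using True by simp
  next
    case False
    then have "B > 0" using AB by simp
    then show ?thesis using pos[of "C / B"] by (simp add: field_simps power2_eq_square)
  qed
  then have "sqrt (C\<^sup>2) \<le> sqrt (A * B)" by (rule real_sqrt_le_mono)
  then show ?thesis by (simp add: A_def B_def C_def real_sqrt_mult)
qed

section \<open>The pairing of L2(Q; V') with L2(Q; V)\<close>

lemma blinfun_pairing_measurable:
  fixes r :: "'a \<Rightarrow> 'b::real_normed_vector \<Rightarrow>\<^sub>L real"
  assumes M: "complete_measure M" and "r \<in> bochner_L2 M" "w \<in> bochner_L2 M"
  shows "(\<lambda>x. blinfun_apply (r x) (w x)) \<in> borel_measurable M"
  using assms by (auto simp: bochner_L2_def
      intro: complete_measure.strongly_measurable_imp_borel strongly_measurable_blinfun_apply)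

lemma blinfun_pairing_integrable:
  fixes r :: "'a \<Rightarrow> 'b::real_normed_vector \<Rightarrow>\<^sub>L real"
  assumes M: "complete_measure M" and r: "r \<in> bochner_L2 M" and w: "w \<in> bochner_L2 M"
  shows "integrable M (\<lambda>x. blinfun_apply (r x) (w x))"
proof (rule Bochner_Integration.integrable_bound)
  show "integrable M (\<lambda>x. norm (r x) * norm (w x))"
    by (intro L2_mult_integrable bochner_L2_norm M r w)
  show "AE x in M. norm (blinfun_apply (r x) (w x)) \<le> norm (norm (r x) * norm (w x))"
    using norm_blinfun[of "r x" "w x" for x] by (auto intro!: AE_I2)
qed (rule blinfun_pairing_measurable[OF assms])

lemma blinfun_pairing_bound:
  fixes r :: "'a \<Rightarrow> 'b::real_normed_vector \<Rightarrow>\<^sub>L real"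
  assumes M: "complete_measure M" and r: "r \<in> bochner_L2 M" and w: "w \<in> bochner_L2 M"
  shows "\<bar>\<integral>x. blinfun_apply (r x) (w x) \<partial>M\<bar> \<le> bochner_norm M r * bochner_norm M w"
proof -
  have "\<bar>\<integral>x. blinfun_apply (r x) (w x) \<partial>M\<bar> \<le> (\<integral>x. \<bar>blinfun_apply (r x) (w x)\<bar> \<partial>M)"
    by simp
  also have "\<dots> \<le> (\<integral>x. norm (r x) * norm (w x) \<partial>M)"
    using norm_blinfun[of "r x" "w x" for x]
    by (intro integral_mono L2_mult_integrable bochner_L2_norm integrable_abs
        blinfun_pairing_integrable assms) auto
  also have "\<dots> \<le> bochner_norm M r * bochner_norm M w"
    using L2_Cauchy_Schwarz[OF bochner_L2_norm[OF M r] bochner_L2_norm[OF M w]]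
    by (simp add: bochner_norm_def)
  finally show ?thesis .
qed

text \<open>
  The finitely many values of each approximating simple function are nearly normed by
  countably many unit vectors; these norm the limit as well.
\<close>

lemma strongly_measurable_blinfun_AE_zero:
  fixes r :: "'a \<Rightarrow> 'b::real_normed_vector \<Rightarrow>\<^sub>L real"
  assumes r: "strongly_measurable M r"
    and zero: "\<And>\<phi>. AE x in M. blinfun_apply (r x) \<phi> = 0"
  shows "AE x in M. r x = 0"
proof -
  obtain s where s: "\<forall>n::nat. simple_function M (s n)" "AE x in M. (\<lambda>n. s n x) \<longlonglongrightarrow> r x"
    by (rule strongly_measurableE[OF r]) (rule that)
  define D where "D = (\<Union>n. s n ` space M)"
  have D: "countable D"
    unfolding D_def using simple_functionD(1)[OF s(1)[rule_format]] by (simp add: countable_finite)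
  \<comment> \<open>If no vector of the unit ball came this close, the number \<open>K\<close>
    below, smaller than the norm of \<delta>, would bound the functional.\<close>
  have "\<exists>\<phi>. norm \<phi> \<le> 1 \<and> norm \<delta> \<le> blinfun_apply \<delta> \<phi> + 1 / real (Suc k)" for \<delta> :: "'b \<Rightarrow>\<^sub>L real" and k
  proof (rule ccontr)
    assume *: "\<nexists>\<phi>. norm \<phi> \<le> 1 \<and> norm \<delta> \<le> blinfun_apply \<delta> \<phi> + 1 / real (Suc k)"
    then have lt: "blinfun_apply \<delta> \<phi> < norm \<delta> - 1 / real (Suc k)" if "norm \<phi> \<le> 1" for \<phi>
      using spec[OF *[unfolded not_ex], of \<phi>] that by linarith
    define K where "K = norm \<delta> - 1 / real (Suc k)"
    have K: "K \<ge> 0" using lt[of 0] by (simp add: K_def)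
    have "norm (blinfun_apply \<delta> x) \<le> K * norm x" for x
    proof (cases "x = 0")
      case False
      have "blinfun_apply \<delta> (x /\<^sub>R norm x) < K" "blinfun_apply \<delta> ((-x) /\<^sub>R norm x) < K"
        unfolding K_def by (rule lt, use False in simp)+
      then have "blinfun_apply \<delta> x / norm x < K" "- blinfun_apply \<delta> x / norm x < K"
        by (simp_all add: blinfun.scaleR_right blinfun.minus_right divide_inverse mult.commute)
      then show ?thesis using False by (auto simp: field_simps abs_le_iff)
    qed (simp add: blinfun.zero_right)
    then have "norm \<delta> \<le> K" by (rule norm_blinfun_bound[OF K])
    then show False by (simp add: K_def)
  qed
  then obtain \<Phi> where \<Phi>: "\<And>\<delta> k. norm (\<Phi> \<delta> k) \<le> 1"
    "\<And>(\<delta>::'b \<Rightarrow>\<^sub>L real) k. norm \<delta> \<le> blinfun_apply \<delta> (\<Phi> \<delta> k) + 1 / real (Suc k)"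
    by metis
  have "AE x in M. \<forall>\<delta>\<in>D. \<forall>k. blinfun_apply (r x) (\<Phi> \<delta> k) = 0"
    using D zero by (simp add: AE_ball_countable AE_all_countable)
  with s(2) AE_space[of M] show ?thesis
  proof eventually_elim
    case (elim x)
    \<comment> \<open>On the vectors that nearly norm s n x the functional r x vanishes, so there s
      n x and s n x - r x take the same values.\<close>
    have "norm (s n x) \<le> norm (s n x - r x)" for n
    proof (rule field_le_epsilon)
      fix e :: real assume "e > 0"
      then obtain k where k: "1 / real (Suc k) < e" using nat_approx_posE by metis
      let ?\<phi> = "\<Phi> (s n x) k"
      have "s n x \<in> D" using elim by (auto simp: D_def)
      then have "blinfun_apply (s n x) ?\<phi> = blinfun_apply (s n x - r x) ?\<phi>"
        using elim by (simp add: blinfun.diff_left)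
      also have "\<dots> \<le> norm (s n x - r x) * norm ?\<phi>"
        using norm_blinfun[of "s n x - r x" ?\<phi>] by simp
      also have "\<dots> \<le> norm (s n x - r x)" using \<Phi>(1) by (simp add: mult_left_le)
      finally show "norm (s n x) \<le> norm (s n x - r x) + e" using \<Phi>(2)[of "s n x" k] k by simp
    qed
    moreover have "(\<lambda>n. norm (s n x)) \<longlonglongrightarrow> norm (r x)" "(\<lambda>n. norm (s n x - r x)) \<longlonglongrightarrow> norm (r x - r x)"
      by (intro tendsto_norm tendsto_diff tendsto_const elim(1))+
    ultimately have "norm (r x) \<le> norm (r x - r x)" by (intro LIMSEQ_le) auto
    then show "r x = 0" by simp
  qed
qed

section \<open>Outer normals\<close>

lemma Sard_transfer:
  fixes f :: "'a::euclidean_space \<Rightarrow> 'a"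
  assumes dim: "DIM('a) = CARD('w::{finite,wellorder})"
    and der: "\<And>x. x \<in> S \<Longrightarrow> (f has_derivative f' x) (at x within S)"
    and deg: "\<And>x. x \<in> S \<Longrightarrow> \<exists>D. D \<noteq> 0 \<and> (\<forall>h. D \<bullet> f' x h = 0)"
  shows "negligible (f ` S)"
proof -
  obtain L :: "'a \<Rightarrow> (real, 'w) vec" and K where L: "linear L" "linear K" "\<And>x. K (L x) = x" "\<And>y. L (K y) = y"
    using isomorphisms_UNIV_UNIV[where 'M='a and 'N="(real, 'w) vec"] dim by (metis DIM_cart DIM_real mult.right_neutral)
  have KL: "K ` L ` S = S" using L(3) by (force simp: image_image)
  have bl: "bounded_linear L" "bounded_linear K" using L linear_conv_bounded_linear by auto
  have "negligible ((\<lambda>y. L (f (K y))) ` (L ` S))"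
  proof (rule baby_Sard)
    fix y assume y: "y \<in> L ` S"
    then have Ky: "K y \<in> S" using L(3) by auto
    have d: "((\<lambda>y. f (K y)) has_derivative (\<lambda>h. f' (K y) (K h))) (at y within L ` S)"
      by (rule has_derivative_in_compose[of K K y "L ` S" f])
         (use der[OF Ky] bl(2) in \<open>auto simp: KL intro: bounded_linear_imp_has_derivative\<close>)
    show "((\<lambda>y. L (f (K y))) has_derivative (\<lambda>h. L (f' (K y) (K h)))) (at y within L ` S)"
      by (rule bounded_linear.has_derivative[OF bl(1) d])
    have lin: "linear (\<lambda>h. L (f' (K y) (K h)))"
      using has_derivative_linear[OF bounded_linear.has_derivative[OF bl(1) d]] .
    show "rank (matrix (\<lambda>h. L (f' (K y) (K h)))) < CARD('w)"
    proof (subst less_rank_noninjective, rule notI)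
      assume "inj ((*v) (matrix (\<lambda>h. L (f' (K y) (K h)))))"
      then have "inj (\<lambda>h. L (f' (K y) (K h)))" using lin by (simp add: matrix_works)
      then have "surj (\<lambda>h. L (f' (K y) (K h)))" using linear_injective_imp_surjective[OF lin] by simp
      moreover obtain D where D: "D \<noteq> 0" "\<And>h. D \<bullet> f' (K y) h = 0" using deg[OF Ky] by blast
      ultimately obtain h where "L D = L (f' (K y) (K h))" by (meson surjD)
      then have "D = f' (K y) (K h)" using L(3) by metis
      then show False using D(2)[of "K h"] D(1) by simp
    qed
  qed simp
  then have "negligible (K ` ((\<lambda>y. L (f (K y))) ` (L ` S)))"
    by (rule negligible_differentiable_image_negligible[rotated])
       (use dim L in \<open>auto simp: linear_imp_differentiable_on\<close>)
  moreover have "K ` ((\<lambda>y. L (f (K y))) ` (L ` S)) = f ` S"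
    using L(3) by (simp add: image_image)
  ultimately show ?thesis by simp
qed

text \<open>The numeral types 2 and 3 serve as wellordered index types of the right
  cardinality.\<close>

lemma Sard_dim_2_3:
  fixes f :: "'a::euclidean_space \<Rightarrow> 'a"
  assumes dim: "DIM('a) = 2 \<or> DIM('a) = 3"
    and der: "\<And>x. x \<in> S \<Longrightarrow> (f has_derivative f' x) (at x within S)"
    and deg: "\<And>x. x \<in> S \<Longrightarrow> \<exists>D. D \<noteq> 0 \<and> (\<forall>h. D \<bullet> f' x h = 0)"
  shows "negligible (f ` S)"
  using dim
proof
  assume "DIM('a) = 2"
  then show ?thesis using Sard_transfer[where 'w=2, OF _ der deg] by simp
next
  assume "DIM('a) = 3"
  then show ?thesis using Sard_transfer[where 'w=3, OF _ der deg] by simp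
qed

text \<open>Names the data hidden in the existential of \<open>outer_unit_normal\<close>, but
  without a base point: one chart serves all boundary points in N.\<close>

definition C1_chart :: "'a::euclidean_space set \<Rightarrow> 'a set \<Rightarrow> ('a \<Rightarrow> real) \<Rightarrow> ('a \<Rightarrow> 'a) \<Rightarrow> bool" where
  "C1_chart U N \<rho> D \<longleftrightarrow> open N \<and>
     (\<forall>y\<in>N. (\<rho> has_derivative (\<lambda>h. D y \<bullet> h)) (at y) \<and> D y \<noteq> 0) \<and> continuous_on N D \<and>
     U \<inter> N = {y \<in> N. \<rho> y < 0}"

lemma outer_unit_normal_chart:
  "outer_unit_normal U x n \<longleftrightarrow>
     x \<in> frontier U \<and> (\<exists>N \<rho> D. C1_chart U N \<rho> D \<and> x \<in> N \<and> n = D x /\<^sub>R norm (D x))"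
  unfolding outer_unit_normal_def C1_chart_def by blast

lemma outer_unit_normalI:
  "x \<in> frontier U \<Longrightarrow> C1_chart U N \<rho> D \<Longrightarrow> x \<in> N \<Longrightarrow> n = D x /\<^sub>R norm (D x) \<Longrightarrow> outer_unit_normal U x n"
  unfolding outer_unit_normal_chart by blast

lemma C1_chartD:
  assumes "C1_chart U N \<rho> D"
  shows "open N" "continuous_on N \<rho>" "continuous_on N D"
    "y \<in> N \<Longrightarrow> (\<rho> has_derivative (\<lambda>h. D y \<bullet> h)) (at y)" "y \<in> N \<Longrightarrow> D y \<noteq> 0"
    "y \<in> N \<Longrightarrow> y \<in> U \<longleftrightarrow> \<rho> y < 0"
proof -
  show "open N" "continuous_on N D"
    "y \<in> N \<Longrightarrow> (\<rho> has_derivative (\<lambda>h. D y \<bullet> h)) (at y)" "y \<in> N \<Longrightarrow> D y \<noteq> 0"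
    "y \<in> N \<Longrightarrow> y \<in> U \<longleftrightarrow> \<rho> y < 0"
    using assms unfolding C1_chart_def by blast+
  show "continuous_on N \<rho>"
    using assms unfolding C1_chart_def
    by (meson continuous_at_imp_continuous_on has_derivative_continuous)
qed

text \<open>A nonzero value of \<rho> keeps its sign nearby and places x in the interior of U or of
  its complement.\<close>

lemma C1_chart_frontier:
  assumes c: "C1_chart U N \<rho> D" and x: "x \<in> N" "x \<in> frontier U"
  shows "\<rho> x = 0"
proof (rule ccontr)
  note C = C1_chartD[OF c]
  assume "\<rho> x \<noteq> 0"
  then consider "\<rho> x < 0" | "\<rho> x > 0" by linarith
  then show False
  proof cases
    case 1
    have "open {y \<in> N. \<rho> y < 0}"
      using continuous_open_preimage[OF C(2,1), of "{..<0}"] by (simp add: vimage_def Int_def)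
    then have "x \<in> interior U"
      by (rule interiorI) (use 1 x C(6) in auto)
    then show False using x by (simp add: frontier_def)
  next
    case 2
    have "open {y \<in> N. \<rho> y > 0}"
      using continuous_open_preimage[OF C(2,1), of "{0<..}"] by (simp add: vimage_def Int_def)
    moreover have "{y \<in> N. \<rho> y > 0} \<inter> U = {}" using C(6) by auto
    ultimately have "{y \<in> N. \<rho> y > 0} \<inter> closure U = {}" using open_Int_closure_eq_empty by blast
    then show False using 2 x by (auto simp: frontier_def)
  qed
qed

text \<open>The derivative of \<rho> along the ray at its starting point has the sign of D x . h,
  and \<rho> starts at 0.\<close>

lemma C1_chart_directional:
  assumes c: "C1_chart U N \<rho> D" and x: "x \<in> N" "\<rho> x = 0"
  shows "D x \<bullet> h < 0 \<Longrightarrow> \<forall>\<^sub>F s in at_right 0. x + s *\<^sub>R h \<in> U"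
    and "D x \<bullet> h > 0 \<Longrightarrow> \<forall>\<^sub>F s in at_right 0. x + s *\<^sub>R h \<notin> U"
proof -
  note C = C1_chartD[OF c]
  have "((\<lambda>s. x + s *\<^sub>R h) \<longlongrightarrow> x + 0 *\<^sub>R h) (at_right (0::real))" by (intro tendsto_intros)
  then have N: "\<forall>\<^sub>F s in at_right (0::real). x + s *\<^sub>R h \<in> N"
    using topological_tendstoD[of _ _ "at_right 0" N] C(1) x(1) by simp
  have "((\<lambda>s. \<rho> (x + s *\<^sub>R h)) has_derivative (\<lambda>s. D x \<bullet> (s *\<^sub>R h))) (at 0)"
    by (rule has_derivative_compose[of "\<lambda>s. x + s *\<^sub>R h" "\<lambda>s. s *\<^sub>R h" 0 UNIV \<rho>])
       (use C(4)[OF x(1)] in \<open>auto intro!: derivative_eq_intros\<close>)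
  then have d: "((\<lambda>s. \<rho> (x + s *\<^sub>R h)) has_real_derivative (D x \<bullet> h)) (at 0)"
    by (simp add: has_field_derivative_def mult.commute mult_commute_abs)
  show "\<forall>\<^sub>F s in at_right 0. x + s *\<^sub>R h \<in> U" if neg: "D x \<bullet> h < 0"
  proof -
    obtain d where "d > 0" "\<forall>s>0. s < d \<longrightarrow> \<rho> (x + s *\<^sub>R h) < 0"
      using DERIV_neg_dec_right[OF d neg] x(2) by auto
    then have "\<forall>\<^sub>F s in at_right 0. \<rho> (x + s *\<^sub>R h) < 0"
      by (auto simp: eventually_at_right_field)
    with N show ?thesis by eventually_elim (simp add: C(6))
  qed
  show "\<forall>\<^sub>F s in at_right 0. x + s *\<^sub>R h \<notin> U" if pos: "D x \<bullet> h > 0"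
  proof -
    obtain d where "d > 0" "\<forall>s>0. s < d \<longrightarrow> \<rho> (x + s *\<^sub>R h) > 0"
      using DERIV_pos_inc_right[OF d pos] x(2) by auto
    then have "\<forall>\<^sub>F s in at_right 0. \<rho> (x + s *\<^sub>R h) > 0"
      by (auto simp: eventually_at_right_field)
    with N show ?thesis by eventually_elim (simp add: C(6))
  qed
qed

lemma outer_unit_normalE:
  assumes "outer_unit_normal U x n"
  obtains N \<rho> D where "C1_chart U N \<rho> D" "x \<in> N" "x \<in> frontier U" "\<rho> x = 0" "D x = norm (D x) *\<^sub>R n" "norm (D x) > 0" "norm n = 1"
proof -
  obtain N \<rho> D where *: "C1_chart U N \<rho> D" "x \<in> N" "x \<in> frontier U" "n = D x /\<^sub>R norm (D x)"
    using assms unfolding outer_unit_normal_chart by auto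
  show thesis
    by (rule that[OF *(1-3)])
       (use *(4) C1_chart_frontier[OF *(1-3)] C1_chartD(5)[OF *(1,2)] in auto)
qed

lemma outer_unit_normal_directional:
  assumes "outer_unit_normal U x n"
  shows "n \<bullet> h < 0 \<Longrightarrow> \<forall>\<^sub>F s in at_right 0. x + s *\<^sub>R h \<in> U"
    and "n \<bullet> h > 0 \<Longrightarrow> \<forall>\<^sub>F s in at_right 0. x + s *\<^sub>R h \<notin> U"
proof -
  obtain N \<rho> D where *: "C1_chart U N \<rho> D" "x \<in> N" "\<rho> x = 0" "D x = norm (D x) *\<^sub>R n" "norm (D x) > 0"
    using outer_unit_normalE[OF assms] by metis
  have "D x \<bullet> h = norm (D x) * (n \<bullet> h)" using *(4) by (metis inner_scaleR_left)
  then show "n \<bullet> h < 0 \<Longrightarrow> \<forall>\<^sub>F s in at_right 0. x + s *\<^sub>R h \<in> U"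
    "n \<bullet> h > 0 \<Longrightarrow> \<forall>\<^sub>F s in at_right 0. x + s *\<^sub>R h \<notin> U"
    using C1_chart_directional[OF *(1-3), of h] *(5)
    by (simp_all add: mult_pos_neg mult_pos_pos)
qed

lemma outer_unit_normal_norm: "outer_unit_normal U x n \<Longrightarrow> norm n = 1"
  using outer_unit_normalE by metis

text \<open>Directions with n . h < 0 enter U and directions with m . h > 0 leave it, so the open
  half space of n lies in the closed half space of m. Two unit vectors related in this way
  coincide.\<close>

lemma outer_unit_normal_unique:
  assumes n: "outer_unit_normal U x n" and m: "outer_unit_normal U x m"
  shows "n = m"
proof -
  have half: "m \<bullet> h \<le> 0" if "n \<bullet> h < 0" for h
  proof (rule ccontr)
    assume "\<not> m \<bullet> h \<le> 0"
    then have "\<forall>\<^sub>F s in at_right 0. x + s *\<^sub>R h \<in> U" "\<forall>\<^sub>F s in at_right 0. x + s *\<^sub>R h \<notin> U"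
      using outer_unit_normal_directional(1)[OF n that] outer_unit_normal_directional(2)[OF m] by auto
    then have "\<forall>\<^sub>F s in at_right (0::real). False" by eventually_elim simp
    then show False by simp
  qed
  have nm: "norm n = 1" "norm m = 1" using n m outer_unit_normal_norm by auto
  have nn: "n \<bullet> n = 1" "m \<bullet> m = 1" using nm by (simp_all add: norm_eq_1)
  have le1: "m \<bullet> n \<le> 1" using norm_cauchy_schwarz[of m n] nm by simp
  have "1 - (m \<bullet> n)\<^sup>2 \<le> e" if "e > 0" for e
  proof -
    \<comment> \<open>The component of m orthogonal to n, tilted by -e n so that its product with n
      is -e < 0. Letting e tend to 0 leaves m = n or m = -n, and h = -n excludes the latter.\<close>
    have "m \<bullet> (m - (m \<bullet> n) *\<^sub>R n - e *\<^sub>R n) \<le> 0"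
      by (rule half) (use that nn in \<open>simp add: inner_diff_right inner_commute\<close>)
    then have "1 - (m \<bullet> n)\<^sup>2 \<le> e * (m \<bullet> n)"
      using nn by (simp add: inner_diff_right power2_eq_square)
    also have "\<dots> \<le> e" using that le1 by (simp add: mult_left_le)
    finally show ?thesis .
  qed
  then have "1 - (m \<bullet> n)\<^sup>2 \<le> 0" by (rule field_le_epsilon[where y=0, simplified])
  moreover have "m \<bullet> n \<ge> 0" using half[of "- n"] nn by simp
  ultimately have "m \<bullet> n \<ge> 1" using power2_le_imp_le[of 1 "m \<bullet> n"] by simp
  then have "(norm (n - m))\<^sup>2 \<le> 0"
    using nn by (simp add: power2_norm_eq_inner inner_diff_left inner_diff_right inner_commute)
  then show ?thesis by simp
qed

lemma unit_normal_eq: "outer_unit_normal U x n \<Longrightarrow> unit_normal U x = n"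
  unfolding unit_normal_def using outer_unit_normal_unique by blast

section \<open>Normals of the space-time cylinder\<close>

lemma outer_unit_normal_lateral:
  fixes U :: "'a::euclidean_space set" and T :: real
  assumes n: "outer_unit_normal U x n" and t: "0 < t" "t < T"
  shows "outer_unit_normal ({0<..<T} \<times> U) (t, x) (0, n)"
proof -
  obtain N \<rho> D where c: "C1_chart U N \<rho> D" "x \<in> N" "x \<in> frontier U" "n = D x /\<^sub>R norm (D x)"
    using n unfolding outer_unit_normal_chart by auto
  note C = C1_chartD[OF c(1)]
  have fr: "(t, x) \<in> frontier ({0<..<T} \<times> U)"
    using c(3) t
    by (auto simp: frontier_def closure_Times interior_Times closure_greaterThanLessThan)
  have chart: "C1_chart ({0<..<T} \<times> U) ({0<..<T} \<times> N) (\<rho> \<circ> snd) (\<lambda>y. (0, D (snd y)))"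
    unfolding C1_chart_def
  proof (intro conjI ballI)
    show "open ({0<..<T} \<times> N)" using C(1) by (simp add: open_Times)
    fix y :: "real \<times> 'a" assume y: "y \<in> {0<..<T} \<times> N"
    have "(\<rho> has_derivative (\<lambda>h. D (snd y) \<bullet> h)) (at (snd y))" using C(4) y by auto
    then have "((\<lambda>y. \<rho> (snd y)) has_derivative (\<lambda>h. D (snd y) \<bullet> snd h)) (at y)"
      using has_derivative_compose[OF has_derivative_snd[OF has_derivative_ident]] by blast
    then show "(\<rho> \<circ> snd has_derivative (\<lambda>h. (0, D (snd y)) \<bullet> h)) (at y)"
      by (simp add: comp_def inner_prod_def)
    show "(0, D (snd y)) \<noteq> 0" using C(5) y by (auto simp: zero_prod_def)
  next
    have "continuous_on ({0<..<T} \<times> N) (\<lambda>y. D (snd y))"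
      by (rule continuous_on_compose2[OF C(3)]) (auto intro!: continuous_intros)
    then show "continuous_on ({0<..<T} \<times> N) (\<lambda>y. (0, D (snd y)))"
      by (intro continuous_intros)
    show "{0<..<T} \<times> U \<inter> {0<..<T} \<times> N = {y \<in> {0<..<T} \<times> N. (\<rho> \<circ> snd) y < 0}"
      using C(6) by auto
  qed
  have "(0, n) = (0, D (snd (t, x))) /\<^sub>R norm (0::real, D (snd (t, x)))"
    using c(4) by (simp add: norm_Pair)
  then show ?thesis
    by (intro outer_unit_normalI[OF fr chart]) (use t c(2) in auto)
qed

lemma outer_unit_normal_top:
  fixes U :: "'a::euclidean_space set" and T :: real
  assumes U: "open U" "x \<in> U" and T: "T > 0"
  shows "outer_unit_normal ({0<..<T} \<times> U) (T, x) (1, 0)"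
proof -
  have fr: "(T, x) \<in> frontier ({0<..<T} \<times> U)"
    using U T closure_subset[of U]
    by (auto simp: frontier_def closure_Times interior_Times closure_greaterThanLessThan interior_open)
  \<comment> \<open>The neighbourhood contains only positive times, so inside it the cylinder is
    described by t < T alone.\<close>
  have chart: "C1_chart ({0<..<T} \<times> U) ({0<..} \<times> U) (\<lambda>y. fst y - T) (\<lambda>y. (1, 0))"
    unfolding C1_chart_def using U
    by (auto simp: open_Times inner_prod_def zero_prod_def intro!: derivative_eq_intros)
  show ?thesis
    by (rule outer_unit_normalI[OF fr chart]) (use U T in \<open>auto simp: norm_Pair\<close>)
qed
section \<open>Boundary points seen tangentially\<close>

text \<open>The union of all lines with direction v that meet A: exactly the starting points of the
  lines s |-> x + s v that hit A for some real s. For v = 0 it is A itself, so that the same lemmas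
  also yield plain null sets.\<close>

definition cylinder :: "'a::real_vector \<Rightarrow> 'a set \<Rightarrow> 'a set" where
  "cylinder v A = {x + s *\<^sub>R v | x s. x \<in> A}"

lemma cylinderI: "x \<in> A \<Longrightarrow> x + s *\<^sub>R v \<in> cylinder v A"
  unfolding cylinder_def by blast

lemma cylinder_mono: "A \<subseteq> B \<Longrightarrow> cylinder v A \<subseteq> cylinder v B"
  unfolding cylinder_def by blast

lemma cylinder_Un: "cylinder v (A \<union> B) = cylinder v A \<union> cylinder v B"
  unfolding cylinder_def by blast

text \<open>Lindelof extracts countably many of the local neighbourhoods that still cover A.\<close>

lemma negligible_cylinder_locally:
  fixes v :: "'a::euclidean_space"
  assumes "\<And>x. x \<in> A \<Longrightarrow> \<exists>B. open B \<and> x \<in> B \<and> negligible (cylinder v (A \<inter> B))"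
  shows "negligible (cylinder v A)"
proof -
  define F where "F = {B. open B \<and> negligible (cylinder v (A \<inter> B))}"
  have "\<And>B. B \<in> F \<Longrightarrow> open B" by (simp add: F_def)
  then obtain F' where F': "F' \<subseteq> F" "countable F'" "\<Union>F' = \<Union>F"
    using Lindelof[of F] by metis
  have "A \<subseteq> \<Union>F'" unfolding F'(3) F_def using assms by blast
  then have "cylinder v A \<subseteq> (\<Union>B\<in>F'. cylinder v (A \<inter> B))"
    unfolding cylinder_def by blast
  moreover have "negligible (\<Union>B\<in>F'. cylinder v (A \<inter> B))"
    using F' by (intro negligible_countable_Union) (auto simp: F_def)
  ultimately show ?thesis by (rule negligible_subset[rotated])
qed

text \<open>Adding s e does not change the component of p orthogonal to e, and the cone condition
  gives that component at least 3/4 of the squared length. The factor 2 is a convenient bound for 2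
  / sqrt 3.\<close>

lemma norm_le_twice_norm_plus:
  fixes p e :: "'a::real_inner"
  assumes e: "norm e = 1" and cone: "\<bar>e \<bullet> p\<bar> \<le> norm p / 2"
  shows "norm p \<le> 2 * norm (p + s *\<^sub>R e)"
proof -
  have "(e \<bullet> p)\<^sup>2 \<le> (norm p / 2)\<^sup>2"
    using power_mono[OF cone abs_ge_zero, of 2] by simp
  moreover have "e \<bullet> e = 1" using e by (simp add: norm_eq_1)
  then have "(norm (p + s *\<^sub>R e))\<^sup>2 = (norm p)\<^sup>2 - (e \<bullet> p)\<^sup>2 + (s + e \<bullet> p)\<^sup>2"
    unfolding power2_norm_eq_inner
    by (simp add: inner_add_left inner_add_right inner_commute power2_eq_square algebra_simps)
  moreover have "0 \<le> (s + e \<bullet> p)\<^sup>2" "0 \<le> (norm p)\<^sup>2" by simp_all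
  moreover have "(norm p / 2)\<^sup>2 = (norm p)\<^sup>2 / 4" by (simp add: power_divide)
  moreover have "(2 * norm (p + s *\<^sub>R e))\<^sup>2 = 4 * (norm (p + s *\<^sub>R e))\<^sup>2" by (simp add: power_mult_distrib)
  ultimately have "(norm p)\<^sup>2 \<le> (2 * norm (p + s *\<^sub>R e))\<^sup>2" by linarith
  then show ?thesis by (rule power2_le_imp_le) simp
qed

text \<open>
  Near a chart point the zero set of \<open>\<rho>\<close> is a graph of slope at most \<open>1 / \<surd>3\<close> over the
  hyperplane orthogonal to the gradient at the centre.
\<close>

lemma C1_chart_cone:
  assumes c: "C1_chart U N \<rho> D" and x: "x \<in> N"
  obtains r where "r > 0" "ball x r \<subseteq> N"
    "\<And>p. p \<in> ball x r \<Longrightarrow> D p \<bullet> (D x /\<^sub>R norm (D x)) > 0"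
    "\<And>p q. p \<in> ball x r \<Longrightarrow> q \<in> ball x r \<Longrightarrow> \<rho> p = 0 \<Longrightarrow> \<rho> q = 0 \<Longrightarrow>
        \<bar>(D x /\<^sub>R norm (D x)) \<bullet> (p - q)\<bar> \<le> norm (p - q) / 2"
proof -
  note C = C1_chartD[OF c]
  have Dx: "norm (D x) > 0" using C(5) x by simp
  obtain r1 where r1: "r1 > 0" "ball x r1 \<subseteq> N" using C(1) x openE by blast
  \<comment> \<open>Half of the gradient norm serves twice: it keeps D p . D x positive, and it
    becomes the slope 1/2 of the cone after division by norm (D x).\<close>
  obtain r2 where r2: "r2 > 0" "\<And>p. p \<in> N \<Longrightarrow> dist p x < r2 \<Longrightarrow> dist (D p) (D x) < norm (D x) / 2"
    using C(3) x Dx unfolding continuous_on_iff by (metis half_gt_zero)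
  define r where "r = min r1 r2"
  have r: "r > 0" "ball x r \<subseteq> N" using r1 r2 by (auto simp: r_def)
  have close: "norm (D p - D x) \<le> norm (D x) / 2" if "p \<in> ball x r" for p
  proof -
    have "dist p x < r2" "p \<in> N" using that r(2) by (auto simp: r_def dist_commute)
    then show ?thesis using r2(2)[of p] by (simp add: dist_norm)
  qed
  show thesis
  proof (rule that[OF r])
    fix p assume p: "p \<in> ball x r"
    have "D p \<bullet> D x = (norm (D x))\<^sup>2 + (D p - D x) \<bullet> D x"
      by (simp add: inner_diff_left power2_norm_eq_inner)
    moreover have "\<bar>(D p - D x) \<bullet> D x\<bar> \<le> norm (D x) / 2 * norm (D x)"
      using Cauchy_Schwarz_ineq2[of "D p - D x" "D x"] mult_right_mono[OF close[OF p], of "norm (D x)"]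
      by simp
    moreover have "0 < (norm (D x))\<^sup>2" "norm (D x) / 2 * norm (D x) = (norm (D x))\<^sup>2 / 2"
      using Dx by (simp_all add: power2_eq_square)
    ultimately have "D p \<bullet> D x > 0" by linarith
    then show "D p \<bullet> (D x /\<^sub>R norm (D x)) > 0" using Dx by simp
  next
    fix p q assume pq: "p \<in> ball x r" "q \<in> ball x r" "\<rho> p = 0" "\<rho> q = 0"
    \<comment> \<open>The mean value inequality for \<rho> minus its linear part at x. As \<rho>
      vanishes at p and q, only D x . (p - q) survives on the left.\<close>
    have "norm ((\<rho> p - D x \<bullet> p) - (\<rho> q - D x \<bullet> q)) \<le> norm (D x) / 2 * norm (p - q)"
    proof (rule differentiable_bound[of "ball x r" _ "\<lambda>y h. (D y - D x) \<bullet> h"])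
      fix y assume y: "y \<in> ball x r"
      have "(\<rho> has_derivative (\<lambda>h. D y \<bullet> h)) (at y within ball x r)"
        using C(4) r(2) y has_derivative_at_withinI by blast
      then show "((\<lambda>y. \<rho> y - D x \<bullet> y) has_derivative (\<lambda>h. (D y - D x) \<bullet> h)) (at y within ball x r)"
        by (auto intro!: derivative_eq_intros simp: inner_diff_left)
      show "onorm (\<lambda>h. (D y - D x) \<bullet> h) \<le> norm (D x) / 2"
      proof (rule onorm_le)
        fix h
        show "norm ((D y - D x) \<bullet> h) \<le> norm (D x) / 2 * norm h"
          using Cauchy_Schwarz_ineq2[of "D y - D x" h] mult_right_mono[OF close[OF y], of "norm h"]
          by simp
      qed
    qed (use pq in auto)
    moreover have "(\<rho> p - D x \<bullet> p) - (\<rho> q - D x \<bullet> q) = - (D x \<bullet> (p - q))"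
      using pq by (simp add: inner_diff_right)
    ultimately have "\<bar>D x \<bullet> (p - q)\<bar> \<le> norm (D x) * (norm (p - q) / 2)" by simp
    then have "\<bar>D x \<bullet> (p - q)\<bar> / norm (D x) \<le> norm (p - q) / 2"
      using Dx by (subst pos_divide_le_eq) (simp_all add: mult.commute)
    moreover have "(D x /\<^sub>R norm (D x)) \<bullet> (p - q) = D x \<bullet> (p - q) / norm (D x)"
      unfolding inner_scaleR_left divide_inverse by (rule mult.commute)
    ultimately show "\<bar>(D x /\<^sub>R norm (D x)) \<bullet> (p - q)\<bar> \<le> norm (p - q) / 2"
      by (simp only: abs_divide abs_norm_cancel)
  qed
qed

text \<open>Near x the boundary projects injectively along e to a hyperplane, and the inverse of the
  projection is Lipschitz with constant 2 by the cone condition. A Lipschitz image of a null set is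
  null. The localisation is the one for cylinders, with direction 0.\<close>

lemma negligible_C1_boundary_points:
  fixes U :: "'a::euclidean_space set"
  shows "negligible (C1_boundary_points U)"
proof -
  have "negligible (cylinder 0 (C1_boundary_points U))"
  proof (rule negligible_cylinder_locally)
    fix x assume "x \<in> C1_boundary_points U"
    then obtain n where n: "outer_unit_normal U x n" by (auto simp: C1_boundary_points_def)
    obtain N \<rho> D where c: "C1_chart U N \<rho> D" "x \<in> N" "x \<in> frontier U"
      using outer_unit_normalE[OF n] by metis
    define e where "e = D x /\<^sub>R norm (D x)"
    have e: "norm e = 1" using C1_chartD(5)[OF c(1,2)] by (simp add: e_def)
    obtain r where r: "r > 0" "ball x r \<subseteq> N"
      and cone: "\<And>p q. p \<in> ball x r \<Longrightarrow> q \<in> ball x r \<Longrightarrow> \<rho> p = 0 \<Longrightarrow> \<rho> q = 0 \<Longrightarrow>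
        \<bar>e \<bullet> (p - q)\<bar> \<le> norm (p - q) / 2"
      using C1_chart_cone[OF c(1,2)] unfolding e_def by metis
    define A where "A = {p \<in> ball x r. \<rho> p = 0}"
    define P where "P = (\<lambda>p. p - (e \<bullet> p) *\<^sub>R e)"
    define G where "G = inv_into A P"
    have bound: "norm (p - q) \<le> 2 * norm (P p - P q)" if "p \<in> A" "q \<in> A" for p q
      using norm_le_twice_norm_plus[OF e cone[of p q], of "- (e \<bullet> (p - q))"] that
      by (simp add: A_def P_def algebra_simps inner_diff_right)
    have inj: "inj_on P A"
      by (rule inj_onI) (use bound in force)
    have "negligible (G ` (P ` A))"
    proof (rule negligible_locally_Lipschitz_image)
      have "P ` A \<subseteq> {y. e \<bullet> y = 0}"
        using e by (auto simp: P_def inner_diff_right norm_eq_1)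
      moreover have "e \<noteq> 0" using e by auto
      ultimately show "negligible (P ` A)" using negligible_hyperplane[of e 0] negligible_subset by blast
      fix y assume y: "y \<in> P ` A"
      show "\<exists>T B. open T \<and> y \<in> T \<and> (\<forall>z\<in>P ` A \<inter> T. norm (G z - G y) \<le> B * norm (z - y))"
        using bound y inj by (intro exI[of _ UNIV] exI[of _ 2]) (auto simp: G_def)
    qed simp
    moreover have "G ` (P ` A) = A" unfolding G_def using inj by (simp add: image_image)
    ultimately have "negligible A" by simp
    moreover have "C1_boundary_points U \<inter> ball x r \<subseteq> A"
      using r(2) C1_chart_frontier[OF c(1)]
      by (auto simp: A_def C1_boundary_points_def outer_unit_normal_def)
    ultimately have "negligible (C1_boundary_points U \<inter> ball x r)" by (rule negligible_subset)
    moreover have "cylinder 0 B = B" for B :: "'a set" by (auto simp: cylinder_def)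
    ultimately show "\<exists>B. open B \<and> x \<in> B \<and> negligible (cylinder 0 (C1_boundary_points U \<inter> B))"
      using r(1) by (intro exI[of _ "ball x r"]) auto
  qed
  then show ?thesis by (simp add: cylinder_def)
qed

text \<open>
  The cylinder over the tangency set is the image of \<open>p + s e \<mapsto> p + s v\<close>, where \<open>e\<close> is the
  gradient direction at the centre of a chart and \<open>p\<close> runs through the zero set of \<open>\<rho>\<close>; the
  range of its derivative is orthogonal to the gradient at \<open>p\<close> if that is orthogonal to \<open>v\<close>.
\<close>

lemma negligible_cylinder_tangency:
  fixes U :: "'a::euclidean_space set"
  assumes dim: "DIM('a) = 2 \<or> DIM('a) = 3"
  shows "negligible (cylinder v {x. \<exists>n. outer_unit_normal U x n \<and> n \<bullet> v = 0})" (is "negligible (cylinder v ?Z)")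
proof (rule negligible_cylinder_locally)
  fix x assume "x \<in> ?Z"
  then obtain n where n: "outer_unit_normal U x n" by blast
  obtain N \<rho> D where c: "C1_chart U N \<rho> D" "x \<in> N" "x \<in> frontier U"
    using outer_unit_normalE[OF n] by metis
  note C = C1_chartD[OF c(1)]
  define e where "e = D x /\<^sub>R norm (D x)"
  have e: "norm e = 1" using C(5)[OF c(2)] by (simp add: e_def)
  obtain r where r: "r > 0" "ball x r \<subseteq> N"
    and De: "\<And>p. p \<in> ball x r \<Longrightarrow> D p \<bullet> e > 0"
    and cone: "\<And>p q. p \<in> ball x r \<Longrightarrow> q \<in> ball x r \<Longrightarrow> \<rho> p = 0 \<Longrightarrow> \<rho> q = 0 \<Longrightarrow>
        \<bar>e \<bullet> (p - q)\<bar> \<le> norm (p - q) / 2"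
    using C1_chart_cone[OF c(1,2)] unfolding e_def by metis
  define A where "A = {p \<in> ball x r. \<rho> p = 0 \<and> D p \<bullet> v = 0}"
  have bound: "norm (p - q) \<le> 2 * norm ((p + s *\<^sub>R e) - (q + s' *\<^sub>R e))" if "p \<in> A" "q \<in> A" for p q s s'
    using norm_le_twice_norm_plus[OF e cone[of p q], of "s - s'"] that
    by (simp add: A_def algebra_simps)
  have "\<forall>y\<in>cylinder e A. \<exists>p s. p \<in> A \<and> y = p + s *\<^sub>R e" by (auto simp: cylinder_def)
  \<comment> \<open>By \<open>bound\<close>, y determines its base point P y and its height, and P
    is Lipschitz although it is obtained by choice.\<close>
  then obtain P \<sigma> where P: "\<And>y. y \<in> cylinder e A \<Longrightarrow> P y \<in> A \<and> y = P y + \<sigma> y *\<^sub>R e" by metis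
  define f where "f = (\<lambda>y. P y + \<sigma> y *\<^sub>R v)"
  \<comment> \<open>Write a displacement h as dp + ds e with dp tangent to the zero set of \<rho>,
    so that D . dp = 0 to first order. Then ds = (D . h) / (D . e), and f moves by dp + ds v = h -
    ds (e - v).\<close>
  define f' where "f' = (\<lambda>y h. h - ((D (P y) \<bullet> h) / (D (P y) \<bullet> e)) *\<^sub>R (e - v))"
  have "negligible (f ` cylinder e A)"
  proof (rule Sard_dim_2_3[OF dim, of _ f f'])
    fix y assume y: "y \<in> cylinder e A"
    have p: "P y \<in> A" "P y \<in> ball x r" "P y \<in> N" "\<rho> (P y) = 0" "D (P y) \<bullet> v = 0"
      using P[OF y] r(2) by (auto simp: A_def)
    have De': "D (P y) \<bullet> e > 0" using De p(2) .
    have "D (P y) \<bullet> f' y h = 0" for h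
      using De' p(5) by (simp add: f'_def inner_diff_right)
    moreover have "D (P y) \<noteq> 0" using C(5) p(3) .
    ultimately show "\<exists>D. D \<noteq> 0 \<and> (\<forall>h. D \<bullet> f' y h = 0)" by blast
    show "(f has_derivative f' y) (at y within cylinder e A)"
      unfolding has_derivative_within_alt
    proof (intro conjI allI impI)
      show "bounded_linear (f' y)"
        unfolding f'_def
        by (intro bounded_linear_sub bounded_linear_ident bounded_linear_scaleR_const
            bounded_linear_divide[THEN bounded_linear_compose] bounded_linear_inner_right)
      fix \<epsilon> :: real assume \<epsilon>: "\<epsilon> > 0"
      \<comment> \<open>Chosen so that the estimate below ends with exactly \<epsilon>; the summand
        1 keeps K positive when e = v.\<close>
      define K where "K = 2 * (norm (e - v) + 1) / (D (P y) \<bullet> e)"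
      have K: "K > 0" using De' norm_ge_zero[of "e - v"] by (auto simp: K_def intro!: divide_pos_pos mult_pos_pos add_nonneg_pos)
      obtain d where d: "d > 0"
        "\<And>q. norm (q - P y) < d \<Longrightarrow> norm (\<rho> q - \<rho> (P y) - D (P y) \<bullet> (q - P y)) \<le> \<epsilon> / K * norm (q - P y)"
        using C(4)[OF p(3)] \<epsilon> K unfolding has_derivative_at_alt by (meson divide_pos_pos)
      show "\<exists>d>0. \<forall>z\<in>cylinder e A. norm (z - y) < d \<longrightarrow> norm (f z - f y - f' y (z - y)) \<le> \<epsilon> * norm (z - y)"
      \<comment> \<open>Base points move at most twice as far as the points of the cylinder, so half
        of the radius d keeps P z within d of P y.\<close>
      proof (intro exI[of _ "d / 2"] conjI ballI impI)
        fix z assume z: "z \<in> cylinder e A" "norm (z - y) < d / 2"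
        define dp ds where "dp = P z - P y" and "ds = \<sigma> z - \<sigma> y"
        have zy: "z - y = dp + ds *\<^sub>R e"
          using P[OF z(1)] P[OF y] by (metis (no_types, lifting) add_diff_add dp_def ds_def scaleR_left_diff_distrib)
        have dp: "norm dp \<le> 2 * norm (z - y)"
          using bound[of "P z" "P y" "\<sigma> z" "\<sigma> y"] P[OF z(1)] P[OF y] by (metis dp_def)
        have "norm (\<rho> (P z) - \<rho> (P y) - D (P y) \<bullet> dp) \<le> \<epsilon> / K * norm dp"
          unfolding dp_def by (rule d(2)) (use dp z(2) dp_def in simp)
        moreover have "\<rho> (P z) = 0" using P[OF z(1)] by (simp add: A_def)
        ultimately have Ddp: "\<bar>D (P y) \<bullet> dp\<bar> \<le> \<epsilon> / K * norm dp" using p(4) by simp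
        have "f z - f y = dp + ds *\<^sub>R v"
          by (simp add: f_def dp_def ds_def algebra_simps)
        moreover have "f' y (z - y) = dp + ds *\<^sub>R e - ((D (P y) \<bullet> dp) / (D (P y) \<bullet> e) + ds) *\<^sub>R (e - v)"
          using De' unfolding f'_def zy by (simp add: inner_add_right add_divide_distrib)
        ultimately have "f z - f y - f' y (z - y) = ((D (P y) \<bullet> dp) / (D (P y) \<bullet> e)) *\<^sub>R (e - v)"
          by (simp add: algebra_simps)
        then have "norm (f z - f y - f' y (z - y)) = \<bar>D (P y) \<bullet> dp\<bar> / (D (P y) \<bullet> e) * norm (e - v)"
          using De' by simp
        also have "\<dots> \<le> (\<epsilon> / K * (2 * norm (z - y))) / (D (P y) \<bullet> e) * (norm (e - v) + 1)"
        proof (intro mult_mono divide_right_mono)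
          have "\<epsilon> / K * norm dp \<le> \<epsilon> / K * (2 * norm (z - y))"
            using dp \<epsilon> K by (intro mult_left_mono) auto
          then show "\<bar>D (P y) \<bullet> dp\<bar> \<le> \<epsilon> / K * (2 * norm (z - y))" using Ddp by linarith
        qed (use De' \<epsilon> K in auto)
        also have "\<dots> = \<epsilon> / K * (2 * norm (z - y)) * (K / 2)"
        proof -
          have "norm (e - v) + 1 = K / 2 * (D (P y) \<bullet> e)" using De' by (simp add: K_def)
          show ?thesis unfolding \<open>norm (e - v) + 1 = _\<close> using De' by simp
        qed
        also have "\<dots> = \<epsilon> * norm (z - y)" using K by simp
        finally show "norm (f z - f y - f' y (z - y)) \<le> \<epsilon> * norm (z - y)" .
      qed (use d(1) in simp)
    qed
  qed
  moreover have "cylinder v (?Z \<inter> ball x r) \<subseteq> f ` cylinder e A"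
  proof
    fix z assume "z \<in> cylinder v (?Z \<inter> ball x r)"
    then obtain p s m where p: "z = p + s *\<^sub>R v" "p \<in> ball x r" "outer_unit_normal U p m" "m \<bullet> v = 0"
      by (auto simp: cylinder_def)
    have fr: "p \<in> frontier U" using p(3) by (simp add: outer_unit_normal_def)
    have pN: "p \<in> N" using p(2) r(2) by blast
    have "outer_unit_normal U p (D p /\<^sub>R norm (D p))"
      by (rule outer_unit_normalI[OF fr c(1) pN refl])
    then have "m = D p /\<^sub>R norm (D p)" using outer_unit_normal_unique p(3) by blast
    then have "D p \<bullet> v = 0" using p(4) C(5)[OF pN] by simp
    then have pA: "p \<in> A" using p(2) C1_chart_frontier[OF c(1) pN fr] by (simp add: A_def)
    define y where "y = p + s *\<^sub>R e"
    have y: "y \<in> cylinder e A" unfolding y_def using pA by (rule cylinderI)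
    \<comment> \<open>The Lipschitz bound doubles as uniqueness of the decomposition: the chosen
      base point of p + s e is p.\<close>
    have "norm (P y - p) \<le> 2 * norm ((P y + \<sigma> y *\<^sub>R e) - (p + s *\<^sub>R e))"
      using bound P[OF y] pA by blast
    also have "(P y + \<sigma> y *\<^sub>R e) - (p + s *\<^sub>R e) = 0" using P[OF y] by (simp add: y_def)
    finally have "P y = p" by simp
    moreover from this have "\<sigma> y *\<^sub>R e = s *\<^sub>R e" using P[OF y] by (metis add_left_cancel y_def)
    then have "\<sigma> y = s" using e by auto
    ultimately have "f y = z" by (simp add: f_def p(1))
    then show "z \<in> f ` cylinder e A" using y by blast
  qed
  ultimately have "negligible (cylinder v (?Z \<inter> ball x r))" by (rule negligible_subset)
  then show "\<exists>B. open B \<and> x \<in> B \<and> negligible (cylinder v (?Z \<inter> B))"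
    using r(1) by (intro exI[of _ "ball x r"]) auto
qed
section \<open>Cylinders over Hausdorff null sets\<close>

text \<open>
  A set of diameter at most \<open>\<eta>\<close>, swept over a segment of length \<open>2 R\<close>, is covered by about
  \<open>2 R / \<eta>\<close> balls of radius \<open>2 \<eta>\<close>, which have total volume of order \<open>\<eta> ^ (DIM('a) - 1)\<close>.
\<close>

lemma swept_set_cover:
  fixes v :: "'a::euclidean_space"
  assumes B: "bounded B" "diameter B \<le> \<eta>" and \<eta>: "0 < \<eta>" "\<eta> \<le> 1" and v: "norm v \<le> 1" and R: "R \<ge> 0"
  obtains T where "T \<in> sets borel" "{x + s *\<^sub>R v | x s. x \<in> B \<and> \<bar>s\<bar> \<le> R} \<subseteq> T"
    "emeasure lborel T \<le> ennreal ((2 * R + 5) * unit_ball_vol (real DIM('a)) * 2 ^ DIM('a) * \<eta> ^ (DIM('a) - 1))"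
proof (cases "B = {}")
  case True
  then show thesis using that[of "{}"] by simp
next
  case False
  then obtain b where b: "b \<in> B" by blast
  define K where "K = \<lceil>R / \<eta>\<rceil> + 1"
  define T where "T = (\<Union>k\<in>{- K..K}. cball (b + (of_int k * \<eta>) *\<^sub>R v) (2 * \<eta>))"
  have K: "0 \<le> K" "of_int K \<le> R / \<eta> + 2"
  proof -
    have "0 \<le> R / \<eta>" using R \<eta> by simp
    then show "0 \<le> K" "of_int K \<le> R / \<eta> + 2" unfolding K_def by linarith+
  qed
  show thesis
  proof (rule that)
    show "T \<in> sets borel" unfolding T_def by (intro borel_closed closed_UN) auto
    show "{x + s *\<^sub>R v | x s. x \<in> B \<and> \<bar>s\<bar> \<le> R} \<subseteq> T"
    proof clarify
      fix x s assume x: "x \<in> B" and s: "\<bar>s\<bar> \<le> R"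
      define k where "k = \<lfloor>s / \<eta>\<rfloor>"
      have ks: "of_int k * \<eta> \<le> s" "s < (of_int k + 1) * \<eta>"
        using \<eta> floor_correct[of "s / \<eta>"]
        by (simp_all add: k_def pos_le_divide_eq[symmetric] pos_divide_less_eq[symmetric])
      have "s / \<eta> \<le> R / \<eta>" "- (R / \<eta>) \<le> s / \<eta>"
        using s \<eta> divide_right_mono[of s R \<eta>] divide_right_mono[of "- R" s \<eta>] by auto
      then have "k \<in> {- K..K}"
        unfolding k_def K_def by (auto; linarith)
      moreover have "norm ((b + (of_int k * \<eta>) *\<^sub>R v) - (x + s *\<^sub>R v)) \<le> 2 * \<eta>"
      proof -
        have "norm ((b + (of_int k * \<eta>) *\<^sub>R v) - (x + s *\<^sub>R v)) = norm ((b - x) + (of_int k * \<eta> - s) *\<^sub>R v)"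
          by (simp add: algebra_simps)
        also have "\<dots> \<le> norm (b - x) + \<bar>of_int k * \<eta> - s\<bar> * norm v"
          by (metis norm_triangle_ineq norm_scaleR)
        also have "norm (b - x) \<le> \<eta>"
          using diameter_bounded_bound[OF B(1) b x] B(2) by (simp add: dist_norm)
        also have "\<bar>of_int k * \<eta> - s\<bar> * norm v \<le> \<bar>of_int k * \<eta> - s\<bar> * 1"
          using v by (intro mult_left_mono) auto
        also have "\<bar>of_int k * \<eta> - s\<bar> * 1 \<le> \<eta>" using ks by (simp add: algebra_simps)
        finally show ?thesis by simp
      qed
      ultimately show "x + s *\<^sub>R v \<in> T" by (auto simp: T_def dist_norm)
    qed
    have "emeasure lborel T \<le> (\<Sum>k\<in>{- K..K}. emeasure lborel (cball (b + (of_int k * \<eta>) *\<^sub>R v) (2 * \<eta>)))"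
      unfolding T_def by (rule emeasure_subadditive_finite) auto
    also have "\<dots> = (\<Sum>k\<in>{- K..K}. ennreal (unit_ball_vol (real DIM('a)) * (2 * \<eta>) ^ DIM('a)))"
      using \<eta> by (simp add: emeasure_cball)
    also have "\<dots> = ennreal (of_int (2 * K + 1)) * ennreal (unit_ball_vol (real DIM('a)) * (2 * \<eta>) ^ DIM('a))"
      using K by (simp add: ennreal_of_nat_eq_real_of_nat algebra_simps)
    also have "\<dots> = ennreal (of_int (2 * K + 1) * (unit_ball_vol (real DIM('a)) * (2 * \<eta>) ^ DIM('a)))"
      using K \<eta> by (intro ennreal_mult[symmetric]) auto
    also have "\<dots> \<le> ennreal (((2 * R + 5) / \<eta>) * (unit_ball_vol (real DIM('a)) * (2 * \<eta>) ^ DIM('a)))"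
    proof (intro ennreal_leI mult_right_mono)
      \<comment> \<open>The number of balls is at most 2 R / \<eta> + 5; the constant 5 is absorbed
        by \<eta> <= 1. The division by \<eta> costs one power of \<eta> in the total
        volume.\<close>
      have "real_of_int (2 * K + 1) \<le> 2 * (R / \<eta>) + 5" using K by simp
      also have "\<dots> \<le> 2 * (R / \<eta>) + 5 / \<eta>" using \<eta> by (simp add: field_simps)
      finally show "real_of_int (2 * K + 1) \<le> (2 * R + 5) / \<eta>" by (simp add: add_divide_distrib)
    qed (use \<eta> in auto)
    also have "((2 * R + 5) / \<eta>) * (unit_ball_vol (real DIM('a)) * (2 * \<eta>) ^ DIM('a))
        = (2 * R + 5) * unit_ball_vol (real DIM('a)) * 2 ^ DIM('a) * \<eta> ^ (DIM('a) - 1)"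
    proof -
      have "\<eta> ^ DIM('a) = \<eta> * \<eta> ^ (DIM('a) - 1)" by (simp add: power_eq_if)
      then show ?thesis using \<eta> by (simp add: power_mult_distrib)
    qed
    finally show "emeasure lborel T \<le> ennreal ((2 * R + 5) * unit_ball_vol (real DIM('a)) * 2 ^ DIM('a) * \<eta> ^ (DIM('a) - 1))" .
  qed
qed

text \<open>Already the covers at scale \<delta> = 1 have infimum 0. The diameters are replaced by
  positive radii because sets of diameter 0 would give no usable ball radius in
  \<open>swept_set_cover\<close>.\<close>

lemma hausdorff_null_cover:
  fixes A :: "'a::metric_space set"
  assumes null: "hausdorff_outer m A = 0" and m: "m \<ge> 1" and \<epsilon>: "\<epsilon> > 0"
  obtains U \<eta> where "A \<subseteq> (\<Union>i::nat. U i)" "\<And>i. bounded (U i)" "\<And>i. diameter (U i) \<le> \<eta> i"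
    "\<And>i. 0 < \<eta> i" "\<And>i. \<eta> i \<le> 1" "(\<Sum>i. ennreal (\<eta> i ^ m)) \<le> ennreal \<epsilon>"
proof -
  define u where "u = unit_ball_vol (real m) / 2 ^ m"
  have u: "u > 0" by (simp add: u_def)
  have ub: "unit_ball_vol (real m) \<noteq> 0" using unit_ball_vol_pos[of "real m"] by linarith
  \<comment> \<open>The genuine diameters contribute at most e / u to the sum and the substituted
    radii at most e, in total e (1 / u + 1).\<close>
  define e where "e = min 1 (\<epsilon> / (1 / u + 1))"
  have pos: "1 / u + 1 > 0" using u by (simp add: add_pos_pos)
  then have e: "e > 0" "e \<le> 1" using \<epsilon> by (auto simp: e_def)
  have "e \<le> \<epsilon> / (1 / u + 1)" by (simp add: e_def)
  then have e3: "e * (1 / u + 1) \<le> \<epsilon>" using pos by (simp only: pos_le_divide_eq)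
  let ?C = "{U :: nat \<Rightarrow> 'a set. A \<subseteq> (\<Union>i. U i) \<and> (\<forall>i. bounded (U i) \<and> diameter (U i) \<le> 1)}"
  have "(INF U\<in>?C. (\<Sum>i. ennreal (unit_ball_vol (real m) * (diameter (U i) / 2) ^ m))) \<le> hausdorff_outer m A"
    unfolding hausdorff_outer_def by (rule SUP_upper2[of "1::real"]) auto
  also have "\<dots> < ennreal e" using null e by simp
  finally obtain U where U: "U \<in> ?C"
    "(\<Sum>i. ennreal (unit_ball_vol (real m) * (diameter (U i) / 2) ^ m)) < ennreal e"
    unfolding INF_less_iff by blast
  \<comment> \<open>Degenerate sets receive the terms of a geometric series with sum e; as m >= 1
    and these numbers are at most 1, their m-th powers are no larger.\<close>
  define \<eta> where "\<eta> i = (if diameter (U i) > 0 then diameter (U i) else e * (1 / 2) ^ Suc i)" for i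
  have d: "diameter (U i) \<ge> 0" "diameter (U i) \<le> 1" for i using U(1) diameter_ge_0 by auto
  have pw: "e * (1 / 2) ^ Suc i \<le> 1" for i
    using e power_le_one[of "1/2::real" "Suc i"] by (intro mult_le_one) auto
  have \<eta>: "0 < \<eta> i" "\<eta> i \<le> 1" for i
    using d e pw by (auto simp: \<eta>_def)
  show thesis
  proof (rule that)
    show "diameter (U i) \<le> \<eta> i" for i
      using d[of i] e by (auto simp: \<eta>_def not_less intro: order_trans)
    have le: "ennreal (\<eta> i ^ m) \<le> ennreal (1 / u) * ennreal (unit_ball_vol (real m) * (diameter (U i) / 2) ^ m)
        + ennreal (e * (1 / 2) ^ Suc i)" for i
    proof (cases "diameter (U i) > 0")
      case True
      have "\<eta> i ^ m = (1 / u) * (unit_ball_vol (real m) * (diameter (U i) / 2) ^ m)"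
        using True ub by (simp add: \<eta>_def u_def power_divide)
      then have "ennreal (\<eta> i ^ m) = ennreal (1 / u) * ennreal (unit_ball_vol (real m) * (diameter (U i) / 2) ^ m)"
        using u ennreal_mult'[of "1 / u"] by (simp only: zero_le_divide_1_iff less_imp_le)
      then show ?thesis by simp
    next
      case False
      have "\<eta> i ^ m \<le> \<eta> i ^ 1" using \<eta> m by (intro power_decreasing) (auto intro: less_imp_le)
      then have "ennreal (\<eta> i ^ m) \<le> ennreal (e * (1 / 2) ^ Suc i)"
        using False by (intro ennreal_leI) (simp add: \<eta>_def)
      then show ?thesis by (simp add: add_increasing)
    qed
    have "(\<Sum>i. ennreal (\<eta> i ^ m)) \<le> (\<Sum>i. ennreal (1 / u) * ennreal (unit_ball_vol (real m) * (diameter (U i) / 2) ^ m)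
        + ennreal (e * (1 / 2) ^ Suc i))"
      by (intro suminf_le le) auto
    also have "\<dots> = ennreal (1 / u) * (\<Sum>i. ennreal (unit_ball_vol (real m) * (diameter (U i) / 2) ^ m)) + ennreal e"
    proof -
      have "(\<lambda>i. e * (1 / 2) ^ Suc i) sums (e * 1)" by (intro sums_mult power_half_series)
      then have "(\<Sum>i. ennreal (e * (1 / 2) ^ Suc i)) = ennreal (e * 1)"
        using e by (intro suminf_ennreal_eq) auto
      then show ?thesis
        by (subst suminf_add[symmetric]) (simp_all only: ennreal_suminf_cmult summableI mult_1_right)
    qed
    also have "\<dots> \<le> ennreal (1 / u) * ennreal e + ennreal e"
      by (intro add_right_mono mult_left_mono less_imp_le[OF U(2)] zero_le)
    also have "\<dots> = ennreal (e * (1 / u + 1))"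
      using u e by (simp add: ennreal_mult''[symmetric] ennreal_plus[symmetric] algebra_simps del: ennreal_plus)
    also have "\<dots> \<le> ennreal \<epsilon>" using e3 by (rule ennreal_leI)
    finally show "(\<Sum>i. ennreal (\<eta> i ^ m)) \<le> ennreal \<epsilon>" .
  qed (use U(1) \<eta> in auto)
qed

text \<open>For sweeps of length 2 R the volume over the i-th covering set is at most C times the
  (n-1)-st power of its radius, with C depending only on R and the dimension n. So covers of small
  total content sweep out small volume; finally R runs through the naturals.\<close>

lemma negligible_cylinder_hausdorff_null:
  fixes A :: "'a::euclidean_space set"
  assumes null: "hausdorff_outer (DIM('a) - 1) A = 0" and dim: "DIM('a) \<ge> 2" and v: "norm v \<le> 1"
  shows "negligible (cylinder v A)"
proof -
  have R: "negligible {x + s *\<^sub>R v | x s. x \<in> A \<and> \<bar>s\<bar> \<le> real R}" for R :: nat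
    unfolding negligible_outer_le
  proof (intro allI impI)
    fix e :: real assume e: "e > 0"
    define C where "C = (2 * real R + 5) * unit_ball_vol (real DIM('a)) * 2 ^ DIM('a)"
    have C: "C > 0" by (simp add: C_def add_nonneg_pos)
    obtain U \<eta> where U: "A \<subseteq> (\<Union>i::nat. U i)" "\<And>i. bounded (U i)" "\<And>i. diameter (U i) \<le> \<eta> i"
      "\<And>i. 0 < \<eta> i" "\<And>i. \<eta> i \<le> 1" "(\<Sum>i. ennreal (\<eta> i ^ (DIM('a) - 1))) \<le> ennreal (e / C)"
      by (rule hausdorff_null_cover[OF null, of "e / C"]) (use dim e C in auto)
    have "\<exists>T. T \<in> sets borel \<and> {x + s *\<^sub>R v | x s. x \<in> U i \<and> \<bar>s\<bar> \<le> real R} \<subseteq> T \<and>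
        emeasure lborel T \<le> ennreal (C * \<eta> i ^ (DIM('a) - 1))" for i
      unfolding C_def
      by (rule swept_set_cover[OF U(2)[of i] U(3)[of i] U(4)[of i] U(5)[of i] v of_nat_0_le_iff])
         (intro exI conjI)
    then obtain T where T': "\<forall>i. T i \<in> sets borel \<and> {x + s *\<^sub>R v | x s. x \<in> U i \<and> \<bar>s\<bar> \<le> real R} \<subseteq> T i \<and>
        emeasure lborel (T i) \<le> ennreal (C * \<eta> i ^ (DIM('a) - 1))"
      using choice[of "\<lambda>i T. T \<in> sets borel \<and> {x + s *\<^sub>R v | x s. x \<in> U i \<and> \<bar>s\<bar> \<le> real R} \<subseteq> T \<and>
        emeasure lborel T \<le> ennreal (C * \<eta> i ^ (DIM('a) - 1))"] by auto
    have T: "T i \<in> sets borel" "{x + s *\<^sub>R v | x s. x \<in> U i \<and> \<bar>s\<bar> \<le> real R} \<subseteq> T i"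
        "emeasure lborel (T i) \<le> ennreal (C * \<eta> i ^ (DIM('a) - 1))" for i
      using spec[OF T', of i] by simp_all
    have TU: "(\<Union>i. T i) \<in> sets borel" using T(1) by auto
    have "emeasure lborel (\<Union>i. T i) \<le> (\<Sum>i. emeasure lborel (T i))"
      by (rule emeasure_subadditive_countably) (use T(1) in auto)
    also have "\<dots> \<le> (\<Sum>i. ennreal C * ennreal (\<eta> i ^ (DIM('a) - 1)))"
      using T(3) C by (intro suminf_le) (auto simp: ennreal_mult')
    also have "\<dots> \<le> ennreal C * ennreal (e / C)"
      unfolding ennreal_suminf_cmult by (intro mult_left_mono U(6)) auto
    also have "\<dots> = ennreal e" using C e by (simp add: ennreal_mult'[symmetric])
    finally have le: "emeasure lebesgue (\<Union>i. T i) \<le> ennreal e" using TU by simp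
    show "\<exists>T. {x + s *\<^sub>R v | x s. x \<in> A \<and> \<bar>s\<bar> \<le> real R} \<subseteq> T \<and> T \<in> lmeasurable \<and> measure lebesgue T \<le> e"
    proof (intro exI conjI)
      show "{x + s *\<^sub>R v | x s. x \<in> A \<and> \<bar>s\<bar> \<le> real R} \<subseteq> (\<Union>i. T i)" using U(1) T(2) by blast
      show "(\<Union>i. T i) \<in> lmeasurable"
        using TU le by (intro fmeasurableI) (auto simp: le_less_trans)
      show "measure lebesgue (\<Union>i. T i) \<le> e"
        unfolding measure_def using enn2real_mono[OF le] e by simp
    qed
  qed
  have "cylinder v A \<subseteq> (\<Union>R::nat. {x + s *\<^sub>R v | x s. x \<in> A \<and> \<bar>s\<bar> \<le> real R})"
  proof
    fix y assume "y \<in> cylinder v A"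
    then obtain x s where "y = x + s *\<^sub>R v" "x \<in> A" by (auto simp: cylinder_def)
    moreover obtain R where "\<bar>s\<bar> \<le> real R" using real_arch_simple by blast
    ultimately show "y \<in> (\<Union>R::nat. {x + s *\<^sub>R v | x s. x \<in> A \<and> \<bar>s\<bar> \<le> real R})" by blast
  qed
  moreover have "negligible (\<Union>R::nat. {x + s *\<^sub>R v | x s. x \<in> A \<and> \<bar>s\<bar> \<le> real R})"
    by (intro negligible_countable_Union) (use R in auto)
  ultimately show ?thesis by (rule negligible_subset[rotated])
qed

lemma piecewise_C1_boundaryE:
  fixes U :: "'a::euclidean_space set"
  assumes "piecewise_C1_boundary U"
  obtains N where "frontier U \<subseteq> C1_boundary_points U \<union> N" "hausdorff_outer (DIM('a) - 1) N = 0"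
proof -
  obtain F where "\<forall>S\<in>F. S \<subseteq> C1_boundary_points U" "hausdorff_outer (DIM('a) - 1) (frontier U - \<Union>F) = 0"
    using assms unfolding piecewise_C1_boundary_def
    by (elim exE conjE) (rule that, simp_all)
  then show thesis by (intro that[of "frontier U - \<Union>F"]) auto
qed

text \<open>The C1 part is null by the graph argument, the remainder is its own cylinder in
  direction 0.\<close>

lemma negligible_frontier_piecewise_C1:
  fixes U :: "'a::euclidean_space set"
  assumes U: "piecewise_C1_boundary U" and dim: "DIM('a) \<ge> 2"
  shows "negligible (frontier U)"
proof -
  obtain N where N: "frontier U \<subseteq> C1_boundary_points U \<union> N" "hausdorff_outer (DIM('a) - 1) N = 0"
    using U by (rule piecewise_C1_boundaryE)
  have "negligible (cylinder 0 N)" using N(2) dim by (intro negligible_cylinder_hausdorff_null) auto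
  then have "negligible N" by (simp add: cylinder_def)
  then show ?thesis
    using N(1) negligible_C1_boundary_points negligible_Un negligible_subset by metis
qed

text \<open>A boundary point without a transversal normal is either a tangency point of the C1 part
  or belongs to the Hausdorff null remainder.\<close>

lemma negligible_cylinder_bad_boundary:
  fixes U :: "'a::euclidean_space set"
  assumes U: "piecewise_C1_boundary U" and dim: "DIM('a) = 2 \<or> DIM('a) = 3" and v: "norm v \<le> 1"
  shows "negligible (cylinder v {x \<in> frontier U. \<not> (\<exists>n. outer_unit_normal U x n \<and> n \<bullet> v \<noteq> 0)})"
proof -
  obtain N where N: "frontier U \<subseteq> C1_boundary_points U \<union> N" "hausdorff_outer (DIM('a) - 1) N = 0"
    using U by (rule piecewise_C1_boundaryE)
  have "negligible (cylinder v N)" using N(2) dim v by (intro negligible_cylinder_hausdorff_null) auto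
  then have "negligible (cylinder v ({x. \<exists>n. outer_unit_normal U x n \<and> n \<bullet> v = 0} \<union> N))"
    unfolding cylinder_Un using negligible_cylinder_tangency[OF dim, of v U] by (rule negligible_Un[rotated])
  then show ?thesis
  proof (rule negligible_subset, intro cylinder_mono subsetI)
    fix x assume x: "x \<in> {x \<in> frontier U. \<not> (\<exists>n. outer_unit_normal U x n \<and> n \<bullet> v \<noteq> 0)}"
    then consider n where "outer_unit_normal U x n" | "x \<in> N"
      using N(1) unfolding C1_boundary_points_def by blast
    then show "x \<in> {x. \<exists>n. outer_unit_normal U x n \<and> n \<bullet> v = 0} \<union> N"
      by cases (use x in blast)+
  qed
qed

section \<open>Integration along characteristics\<close>

text \<open>If the right end point belonged to the set, adding it to the component would produce a
  larger connected subset.\<close>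

lemma bounded_open_component_interval:
  fixes O' :: "real set"
  assumes O': "open O'" "bounded O'" and C: "C \<in> components O'"
  obtains a b where "a < b" "C = {a<..<b}" "b \<notin> O'"
proof -
  have Cp: "C \<noteq> {}" "open C" "connected C" "C \<subseteq> O'"
    using open_components[OF O'(1) C] in_components_nonempty[OF C] in_components_connected[OF C]
      in_components_subset[OF C] by simp_all
  have bd: "bdd_above C" "bdd_below C"
    using bounded_subset[OF O'(2) Cp(4)] bounded_imp_bdd_above bounded_imp_bdd_below by auto
  define a b where "a = Inf C" and "b = Sup C"
  have "C \<subseteq> {a<..<b}"
  proof
    fix c assume c: "c \<in> C"
    then obtain d where d: "d > 0" "ball c d \<subseteq> C" using Cp(2) openE by blast
    then have "c - d / 2 \<in> C" "c + d / 2 \<in> C" by (auto simp: dist_real_def subset_eq)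
    then have "a \<le> c - d / 2" "c + d / 2 \<le> b"
      using bd by (auto simp: a_def b_def intro: cInf_lower cSup_upper)
    then show "c \<in> {a<..<b}" using d(1) by simp
  qed
  moreover have "{a<..<b} \<subseteq> C"
  proof
    fix x assume x: "x \<in> {a<..<b}"
    obtain p where p: "p \<in> C" "p < x" using cInf_lessD[OF Cp(1)] x by (auto simp: a_def)
    obtain q where q: "q \<in> C" "x < q" using less_cSupE[OF _ Cp(1)] x by (auto simp: b_def)
    have "{p..q} \<subseteq> C" using connected_contains_Icc[OF Cp(3) p(1) q(1)] .
    then show "x \<in> C" using p q by auto
  qed
  ultimately have eq: "C = {a<..<b}" by blast
  then have ab: "a < b" using Cp(1) by auto
  have "b \<notin> O'"
  proof
    assume b: "b \<in> O'"
    have "{a<..b} \<subseteq> C"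
    proof (rule components_maximal[OF C])
      show "{a<..b} \<subseteq> O'" using eq Cp(4) b by (auto simp: le_less)
      show "C \<inter> {a<..b} \<noteq> {}" using eq ab dense[of a b] by fastforce
    qed (simp add: is_interval_connected)
    then show False using eq ab by auto
  qed
  with that ab eq show thesis by blast
qed

text \<open>On a component (a, b) the integral is \<phi> b - \<phi> a, where \<phi> b = 0 since b is
  an exit point and \<phi> a >= 0. There may be infinitely many components, so finite unions exhaust
  the set and the integrals pass to the limit.\<close>

lemma open_set_integral_derivative_nonpos:
  fixes \<phi> \<phi>' :: "real \<Rightarrow> real"
  assumes O': "open O'" "bounded O'"
    and der: "\<And>t. (\<phi> has_real_derivative \<phi>' t) (at t)" and cont: "continuous_on UNIV \<phi>'"
    and pos: "\<And>t. \<phi> t \<ge> 0"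
    and exit: "\<And>d e. d < e \<Longrightarrow> {d<..<e} \<subseteq> O' \<Longrightarrow> e \<notin> O' \<Longrightarrow> \<phi> e = 0"
  shows "(\<integral>t. indicator O' t * \<phi>' t \<partial>lborel) \<le> 0"
proof (cases "O' = {}")
  case False
  let ?K = "components O'"
  have op: "open C" if "C \<in> ?K" for C using that O'(1) open_components by blast
  obtain R where R: "O' \<subseteq> {-R..R}"
    using O'(2) by (auto simp: bounded_iff abs_le_iff subset_eq) (metis minus_le_iff)
  have intR: "set_integrable lborel {-R..R} \<phi>'"
    by (rule borel_integrable_atLeastAtMost') (rule continuous_on_subset[OF cont subset_UNIV])
  have int: "set_integrable lborel B \<phi>'" if "B \<in> sets borel" "B \<subseteq> {-R..R}" for B
    using set_integrable_subset[OF intR] that by auto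
  have one: "(LINT t:C|lborel. \<phi>' t) \<le> 0" if C: "C \<in> ?K" for C
  proof -
    obtain a b where ab: "a < b" "C = {a<..<b}" "b \<notin> O'"
      using bounded_open_component_interval[OF O' C] by metis
    have "(LINT t:C|lborel. \<phi>' t) = (\<integral>t. \<phi>' t * indicator {a..b} t \<partial>lborel)"
      unfolding set_lebesgue_integral_def ab(2)
    proof (rule integral_cong_AE)
      have "AE t in lborel. t \<noteq> a \<and> t \<noteq> b"
        using AE_lborel_singleton[of a] AE_lborel_singleton[of b] by eventually_elim simp
      then show "AE t in lborel. indicator {a<..<b} t *\<^sub>R \<phi>' t = \<phi>' t * indicator {a..b} t"
        by eventually_elim (auto simp: indicator_def)
    qed (use borel_measurable_continuous_onI[OF cont] in auto)
    also have "\<dots> = \<phi> b - \<phi> a"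
      by (rule integral_FTC_Icc_real) (use ab der cont in \<open>auto simp: continuous_on_eq_continuous_at\<close>)
    also have "\<phi> b = 0"
      using exit[OF ab(1)] ab in_components_subset[OF C] by blast
    finally show ?thesis using pos[of a] by simp
  qed
  have fin: "(LINT t:\<Union>F|lborel. \<phi>' t) \<le> 0" if "finite F" "F \<subseteq> ?K" for F
    using that
  proof (induction F rule: finite_induct)
    case empty
    then show ?case by (simp add: set_lebesgue_integral_def)
  next
    case (insert C F)
    have sub: "C \<subseteq> {-R..R}" "\<Union>F \<subseteq> {-R..R}" using insert.prems in_components_subset R by blast+
    have "C \<inter> \<Union>F = {}"
      using insert.hyps insert.prems pairwise_disjoint_components[of O'] by (force simp: pairwise_def)
    then have "(LINT t:\<Union>(insert C F)|lborel. \<phi>' t) = (LINT t:C|lborel. \<phi>' t) + (LINT t:\<Union>F|lborel. \<phi>' t)"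
      unfolding Union_insert using insert.prems sub op
      by (intro set_integral_Un int) (auto intro!: borel_open open_Union)
    then show ?case using one[of C] insert by auto
  qed
  have cnt: "countable ?K"
  proof (rule countable_disjoint_open_subsets)
    show "pairwise disjnt ?K"
      using pairwise_disjoint_components[of O'] unfolding pairwise_def disjnt_def .
  qed (rule op)
  have ne: "?K \<noteq> {}" using False by (simp add: components_eq_empty)
  \<comment> \<open>The enumeration of the components may repeat itself; taking its image as a set
    removes the repetitions.\<close>
  define A where "A n = \<Union>(from_nat_into ?K ` {..<n})" for n :: nat
  have AK: "from_nat_into ?K ` {..<n} \<subseteq> ?K" for n using from_nat_into[OF ne] by auto
  have UA: "(\<Union>n. A n) = O'"
  proof -
    have "(\<Union>n. A n) = \<Union>(range (from_nat_into ?K))" by (auto simp: A_def)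
    also have "\<dots> = O'" using range_from_nat_into[OF ne cnt] Union_components by simp
    finally show ?thesis .
  qed
  have "(\<lambda>n. LINT t:A n|lborel. \<phi>' t) \<longlonglongrightarrow> (LINT t:(\<Union>n. A n)|lborel. \<phi>' t)"
  proof (rule set_integral_cont_up)
    show "A n \<in> sets lborel" for n
      unfolding A_def using AK op by (auto intro!: borel_open open_Union)
    show "incseq A"
      unfolding incseq_def A_def by (intro allI impI Union_mono image_mono) auto
    show "set_integrable lborel (\<Union>n. A n) \<phi>'"
      unfolding UA using R O'(1) by (intro int) auto
  qed
  then have "(LINT t:O'|lborel. \<phi>' t) \<le> 0"
    unfolding UA
  proof (rule LIMSEQ_le_const2)
    show "\<exists>N. \<forall>n\<ge>N. (LINT t:A n|lborel. \<phi>' t) \<le> 0"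
      unfolding A_def using fin AK by auto
  qed
  then show ?thesis by (simp add: set_lebesgue_integral_def)
qed simp

text \<open>The shear (t, x) |-> (t, x + t v) is a translation in x for each fixed t, so translation
  invariance and Fubini replace the general change of variables. Integrability of the sheared
  function is obtained in the same way from the norms of the sections.\<close>

lemma lborel_integral_shear:
  fixes G :: "real \<times> 'a::euclidean_space \<Rightarrow> real"
  assumes G: "integrable lborel G"
  shows "(\<integral>y. G y \<partial>lborel) = (\<integral>x. (\<integral>t. G (t, x + t *\<^sub>R v) \<partial>lborel) \<partial>lborel)"
proof -
  have lp: "lborel = (lborel :: real measure) \<Otimes>\<^sub>M (lborel :: 'a measure)" by (rule lborel_prod[symmetric])
  have G': "integrable (lborel \<Otimes>\<^sub>M lborel) G" using G by (simp add: lborel_prod)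
  have Gm [measurable]: "G \<in> borel_measurable borel" using G by auto
  have shift: "integral\<^sup>L lborel (\<lambda>x. g (x + c)) = integral\<^sup>L lborel g"
    if [measurable]: "g \<in> borel_measurable borel" for g :: "'a \<Rightarrow> real" and c
  proof -
    have "integral\<^sup>L lborel g = integral\<^sup>L (distr lborel borel ((+) c)) g" by (simp add: lborel_distr_plus)
    also have "\<dots> = integral\<^sup>L lborel (\<lambda>x. g (c + x))" by (subst integral_distr) auto
    finally show ?thesis by (simp add: add.commute)
  qed
  have shifti: "integrable lborel (\<lambda>x. g (x + c))"
    if "integrable lborel g" for g :: "'a \<Rightarrow> real" and c
  proof -
    have "integrable (distr lborel borel ((+) c)) g" using that by (simp add: lborel_distr_plus)
    then show ?thesis using that by (subst (asm) integrable_distr_eq) (auto simp: add.commute)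
  qed
  have sec: "(\<lambda>x. G (t, x)) \<in> borel_measurable borel" for t
    by (rule measurable_compose[OF _ Gm]) simp
  have "(\<lambda>y. (fst y, snd y + fst y *\<^sub>R v)) \<in> borel_measurable borel"
    by (intro borel_measurable_continuous_onI continuous_intros)
  then have Sm: "(\<lambda>y. G (fst y, snd y + fst y *\<^sub>R v)) \<in> borel_measurable borel"
    by (rule measurable_compose[OF _ Gm])
  have i: "integrable (lborel \<Otimes>\<^sub>M lborel) (\<lambda>y. G (fst y, snd y + fst y *\<^sub>R v))"
  proof (rule lborel_pair.Fubini_integrable)
    show "(\<lambda>y. G (fst y, snd y + fst y *\<^sub>R v)) \<in> borel_measurable (lborel \<Otimes>\<^sub>M lborel)"
      using Sm by (simp add: lborel_prod)
    have "integrable lborel (\<lambda>t. \<integral>x. norm (G (t, x)) \<partial>lborel)"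
      using lborel_pair.integrable_fst'[OF integrable_norm[OF G']] by simp
    then show "integrable lborel (\<lambda>t. \<integral>x. norm (G (fst (t, x), snd (t, x) + fst (t, x) *\<^sub>R v)) \<partial>lborel)"
      using shift[of "\<lambda>x. norm (G (t, x))" "t *\<^sub>R v" for t] sec by simp
    show "AE t in lborel. integrable lborel (\<lambda>x. G (fst (t, x), snd (t, x) + fst (t, x) *\<^sub>R v))"
      using lborel_pair.AE_integrable_fst'[OF G'] by eventually_elim (simp add: shifti[of "\<lambda>x. G (t, x)" for t])
  qed
  have "(\<integral>y. G y \<partial>lborel) = (\<integral>t. (\<integral>x. G (t, x) \<partial>lborel) \<partial>lborel)"
    unfolding lp using lborel_pair.integral_fst'[OF G'] by simp
  also have "\<dots> = (\<integral>t. (\<integral>x. G (t, x + t *\<^sub>R v) \<partial>lborel) \<partial>lborel)"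
    using shift[OF sec] by simp
  also have "\<dots> = (\<integral>x. (\<integral>t. G (t, x + t *\<^sub>R v) \<partial>lborel) \<partial>lborel)"
    using lborel_pair.Fubini_integral[of "\<lambda>t x. G (t, x + t *\<^sub>R v)"] i by (simp add: case_prod_beta')
  finally show ?thesis .
qed

section \<open>Transport along characteristics\<close>

lemma derivative_along_line:
  fixes h :: "real \<times> 'a::euclidean_space \<Rightarrow> real"
  assumes der: "\<And>y. h differentiable (at y)"
    and cont: "continuous_on UNIV (\<lambda>y. frechet_derivative h (at y) (advection v))"
  shows "((\<lambda>t. h (t, x + t *\<^sub>R v)) has_real_derivative
           frechet_derivative h (at (t, x + t *\<^sub>R v)) (advection v)) (at t)"
    and "continuous_on UNIV (\<lambda>t. frechet_derivative h (at (t, x + t *\<^sub>R v)) (advection v))"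
proof -
  have d: "(h has_derivative frechet_derivative h (at y)) (at y)" for y
    using der frechet_derivative_works by blast
  have "((\<lambda>t. (t, x + t *\<^sub>R v)) has_derivative (\<lambda>s. s *\<^sub>R advection v)) (at t)"
    unfolding advection_def by (auto intro!: derivative_eq_intros)
  from has_derivative_compose[OF this d]
  have "((\<lambda>t. h (t, x + t *\<^sub>R v)) has_derivative
      (\<lambda>s. frechet_derivative h (at (t, x + t *\<^sub>R v)) (s *\<^sub>R advection v))) (at t)" .
  then show "((\<lambda>t. h (t, x + t *\<^sub>R v)) has_real_derivative
      frechet_derivative h (at (t, x + t *\<^sub>R v)) (advection v)) (at t)"
    using linear_scale[OF has_derivative_linear[OF d]]
    by (simp add: has_field_derivative_def mult_commute_abs)
  show "continuous_on UNIV (\<lambda>t. frechet_derivative h (at (t, x + t *\<^sub>R v)) (advection v))"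
    by (rule continuous_on_compose2[OF cont]) (auto intro!: continuous_intros)
qed

lemma supp_outside: "y \<notin> supp f \<Longrightarrow> f y = 0"
  using closure_subset[of "{x. f x \<noteq> 0}"] by (auto simp: supp_def)

lemma frechet_derivative_outside_supp:
  fixes f :: "'a::euclidean_space \<Rightarrow> real"
  assumes "y \<notin> supp f"
  shows "frechet_derivative f (at y) = (\<lambda>_. 0)"
proof -
  have "((\<lambda>_. 0) has_derivative (\<lambda>_. 0)) (at y)" by simp
  then have "(f has_derivative (\<lambda>_. 0)) (at y)"
    by (rule has_derivative_transform_within_open[where s="- supp f"])
       (use assms supp_outside in \<open>auto simp: supp_def\<close>)
  then show ?thesis by (rule frechet_eq)
qed

lemma integrable_continuous_compact_support:
  fixes f :: "'a::euclidean_space \<Rightarrow> real"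
  assumes f: "continuous_on UNIV f" and K: "compact K" and out: "\<And>y. y \<notin> K \<Longrightarrow> f y = 0"
  shows "integrable lborel f"
proof -
  have "integrable lborel (\<lambda>y. indicator K y *\<^sub>R f y)"
    using borel_integrable_compact[OF K continuous_on_subset[OF f subset_UNIV]]
    by (simp add: indicator_def if_distrib cong: if_cong)
  moreover have "(\<lambda>y. indicator K y *\<^sub>R f y) = f"
    using out by (auto simp: indicator_def fun_eq_iff)
  ultimately show ?thesis by simp
qed

text \<open>On each characteristic the integral is a difference of two values of h at times so large
  that the time coordinate alone lies outside the support.\<close>

lemma transport_integral_zero:
  fixes h :: "real \<times> 'a::euclidean_space \<Rightarrow> real"
  assumes der: "\<And>y. h differentiable (at y)"
    and cont: "continuous_on UNIV (\<lambda>y. frechet_derivative h (at y) (advection v))"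
    and supp: "compact (supp h)"
  shows "(\<integral>y. frechet_derivative h (at y) (advection v) \<partial>lborel) = 0"
proof -
  obtain R where R: "\<And>y. y \<in> supp h \<Longrightarrow> norm y \<le> R"
    using compact_imp_bounded[OF supp] by (auto simp: bounded_iff)
  have "(\<integral>t. frechet_derivative h (at (t, x + t *\<^sub>R v)) (advection v) \<partial>lborel) = 0" for x
  proof -
    define a where "a = \<bar>R\<bar> + 1"
    have out: "(t, x + t *\<^sub>R v) \<notin> supp h" if "\<bar>t\<bar> \<ge> a" for t
      using R[of "(t, x + t *\<^sub>R v)"] norm_fst_le[of t "x + t *\<^sub>R v"] that by (force simp: a_def)
    have "(\<integral>t. frechet_derivative h (at (t, x + t *\<^sub>R v)) (advection v) \<partial>lborel) =
        (\<integral>t. frechet_derivative h (at (t, x + t *\<^sub>R v)) (advection v) * indicator {-a..a} t \<partial>lborel)"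
    proof (rule Bochner_Integration.integral_cong)
      fix t show "frechet_derivative h (at (t, x + t *\<^sub>R v)) (advection v) =
          frechet_derivative h (at (t, x + t *\<^sub>R v)) (advection v) * indicator {-a..a} t"
        using frechet_derivative_outside_supp[OF out[of t]]
        by (cases "\<bar>t\<bar> \<ge> a") (auto simp: indicator_def)
    qed simp
    also have "\<dots> = h (a, x + a *\<^sub>R v) - h (- a, x + (- a) *\<^sub>R v)"
      by (rule integral_FTC_Icc_real)
         (use derivative_along_line[OF der cont, of x] in \<open>auto simp: a_def continuous_on_eq_continuous_at\<close>)
    also have "\<dots> = 0" using supp_outside[OF out[of a]] supp_outside[OF out[of "-a"]] by (simp add: a_def)
    finally show ?thesis .
  qed
  moreover have "integrable lborel (\<lambda>y. frechet_derivative h (at y) (advection v))"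
    by (rule integrable_continuous_compact_support[OF cont supp])
       (simp add: frechet_derivative_outside_supp)
  ultimately show ?thesis using lborel_integral_shear[of _ v] by simp
qed

lemma AE_lborel_not_negligible:
  assumes "negligible N"
  shows "AE x in lborel. x \<notin> N"
proof -
  have "AE x in lebesgue. x \<notin> N"
    using assms AE_not_in unfolding negligible_iff_null_sets by blast
  then show ?thesis by (simp add: AE_completion_iff)
qed

text \<open>
  Fubini along the characteristics \<open>t \<mapsto> (t, x + t v)\<close>: almost every one of them leaves the
  cylinder only through boundary points where the boundary is \<open>C\<^sup>1\<close> and \<open>k \<bullet> n > 0\<close>.
\<close>

lemma transport_integral_nonpos:
  fixes h :: "real \<times> 'a::euclidean_space \<Rightarrow> real"
  assumes dim: "DIM('a) = 2 \<or> DIM('a) = 3" and \<Omega>: "open \<Omega>" "piecewise_C1_boundary \<Omega>" and T: "T > 0"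
    and Q: "Q = {0<..<T} \<times> \<Omega>" and v: "norm v = 1"
    and der: "\<And>y. h differentiable (at y)"
    and cont: "continuous_on UNIV (\<lambda>y. frechet_derivative h (at y) (advection v))"
    and int: "integrable lborel (\<lambda>y. frechet_derivative h (at y) (advection v))"
    and pos: "\<And>y. h y \<ge> 0"
    and out: "\<And>y. (y, v) \<in> outflow Q \<Longrightarrow> h y = 0"
  shows "(\<integral>y. indicator Q y * frechet_derivative h (at y) (advection v) \<partial>lborel) \<le> 0"
proof -
  define Bad where "Bad = {x \<in> frontier \<Omega>. \<not> (\<exists>n. outer_unit_normal \<Omega> x n \<and> n \<bullet> v \<noteq> 0)}"
  have outI: "(y, v) \<in> outflow Q" if n: "outer_unit_normal Q y n" and "advection v \<bullet> n > 0" for y n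
  proof -
    have "y \<in> C1_boundary_points Q" unfolding C1_boundary_points_def using n by blast
    then show ?thesis using that unit_normal_eq[OF n] v by (simp add: outflow_def)
  qed
  have "negligible (cylinder v Bad)"
    unfolding Bad_def using negligible_cylinder_bad_boundary[OF \<Omega>(2) dim] v by simp
  \<comment> \<open>The starting points of the characteristics that meet the edge {T} x frontier
    \<Omega> at the final time.\<close>
  moreover have "negligible ((+) (- T *\<^sub>R v) ` frontier \<Omega>)"
    by (intro negligible_translation negligible_frontier_piecewise_C1 \<Omega>(2)) (use dim in auto)
  ultimately have "AE x in lborel. x \<notin> cylinder v Bad \<and> x \<notin> (+) (- T *\<^sub>R v) ` frontier \<Omega>"
    by (intro AE_conjI AE_lborel_not_negligible)
  then have line: "AE x in lborel. (\<integral>t. indicator Q (t, x + t *\<^sub>R v) *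
      frechet_derivative h (at (t, x + t *\<^sub>R v)) (advection v) \<partial>lborel) \<le> 0"
  proof eventually_elim
    case (elim x)
    define O' where "O' = {t. 0 < t \<and> t < T \<and> x + t *\<^sub>R v \<in> \<Omega>}"
    have "open ((\<lambda>t. x + t *\<^sub>R v) -` \<Omega>)"
      by (intro open_vimage \<Omega>(1) continuous_intros)
    then have "open ({0<..<T} \<inter> (\<lambda>t. x + t *\<^sub>R v) -` \<Omega>)" by (intro open_Int) auto
    moreover have "O' = {0<..<T} \<inter> (\<lambda>t. x + t *\<^sub>R v) -` \<Omega>" by (auto simp: O'_def)
    ultimately have O': "open O'" "bounded O'"
      using bounded_subset[of "{0<..<T}" O'] by auto
    have "(\<integral>t. indicator O' t * frechet_derivative h (at (t, x + t *\<^sub>R v)) (advection v) \<partial>lborel) \<le> 0"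
    proof (rule open_set_integral_derivative_nonpos[OF O' derivative_along_line[OF der cont] pos])
      fix d e :: real assume de: "d < e" "{d<..<e} \<subseteq> O'" "e \<notin> O'"
      have s: "0 < s" "s < T" "x + s *\<^sub>R v \<in> \<Omega>" if "d < s" "s < e" for s
        using de(2) that by (auto simp: O'_def)
      have e0: "0 < e" using s(1)[of "(d + e) / 2"] de(1) by simp
      have eT: "e \<le> T"
      proof (rule ccontr)
        assume "\<not> e \<le> T"
        then obtain r where "max T d < r" "r < e" using de(1) dense[of "max T d" e] by auto
        then show False using s(2)[of r] by simp
      qed
      define p where "p = x + e *\<^sub>R v"
      have "((\<lambda>s. x + s *\<^sub>R v) \<longlongrightarrow> p) (at_left e)"
        unfolding p_def by (intro tendsto_intros)
      moreover have "\<forall>\<^sub>F s in at_left e. x + s *\<^sub>R v \<in> closure \<Omega>"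
        using eventually_at_left_real[OF de(1)]
        by eventually_elim (use s(3) closure_subset[of \<Omega>] in auto)
      ultimately have pc: "p \<in> closure \<Omega>"
        by (rule Lim_in_closed_set[OF closed_closure _ trivial_limit_at_left_real, rotated 1])
      show "h (e, x + e *\<^sub>R v) = 0"
      proof (cases "e = T")
        case True
        have "p \<notin> frontier \<Omega>"
        proof
          assume "p \<in> frontier \<Omega>"
          then have "- T *\<^sub>R v + p \<in> (+) (- T *\<^sub>R v) ` frontier \<Omega>" by (rule imageI)
          then show False using elim True by (simp add: p_def)
        qed
        then have "p \<in> \<Omega>" using pc \<Omega>(1) by (simp add: frontier_def interior_open)
        from outer_unit_normal_top[OF \<Omega>(1) this T] have "outer_unit_normal Q (T, p) (1, 0)" unfolding Q .
        then have "(((T, p)), v) \<in> outflow Q" by (rule outI) (simp add: advection_def)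
        then show ?thesis using out True by (simp add: p_def)
      next
        case False
        then have eT': "e < T" using eT by simp
        then have "p \<notin> \<Omega>" using de(3) e0 by (simp add: O'_def p_def)
        then have pf: "p \<in> frontier \<Omega>" using pc \<Omega>(1) by (simp add: frontier_def interior_open)
        have "p + (- e) *\<^sub>R v = x" by (simp add: p_def)
        then have "p \<notin> Bad" using elim cylinderI[of p Bad "- e" v] by auto
        then obtain n where n: "outer_unit_normal \<Omega> p n" "n \<bullet> v \<noteq> 0" using pf by (auto simp: Bad_def)
        \<comment> \<open>With n . v < 0 the backward ray from p would leave \<Omega>, but the
          characteristic reached p from inside.\<close>
        have "n \<bullet> v > 0"
        proof (rule ccontr)
          assume "\<not> n \<bullet> v > 0"
          then have "n \<bullet> (- v) > 0" using n(2) by simp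
          then have "\<forall>\<^sub>F s in at_right 0. p + s *\<^sub>R (- v) \<notin> \<Omega>"
            by (rule outer_unit_normal_directional(2)[OF n(1)])
          moreover have "\<forall>\<^sub>F s in at_right 0. p + s *\<^sub>R (- v) \<in> \<Omega>"
          proof -
            have "\<forall>\<^sub>F s in at_right 0. s \<in> {0<..<e - d}" using de(1) by (intro eventually_at_right_real) simp
            then show ?thesis
            proof eventually_elim
              case (elim r)
              then have "x + (e - r) *\<^sub>R v \<in> \<Omega>" by (intro s(3)) auto
              then show ?case by (simp add: p_def algebra_simps)
            qed
          qed
          ultimately have "\<forall>\<^sub>F s in at_right (0::real). False" by eventually_elim simp
          then show False by simp
        qed
        moreover have "outer_unit_normal Q (e, p) (0, n)"
          unfolding Q by (rule outer_unit_normal_lateral[OF n(1) e0 eT'])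
        ultimately have "((e, p), v) \<in> outflow Q"
          by (intro outI) (auto simp: advection_def inner_commute)
        then show ?thesis using out by (simp add: p_def)
      qed
    qed
    moreover have "indicator O' t = (indicator Q (t, x + t *\<^sub>R v) :: real)" for t
      by (auto simp: O'_def Q indicator_def)
    ultimately show ?case by simp
  qed
  have oQ: "open Q" unfolding Q using \<Omega>(1) by (simp add: open_Times)
  have "integrable lborel (\<lambda>y. indicator Q y *\<^sub>R frechet_derivative h (at y) (advection v))"
    by (rule integrable_mult_indicator[OF _ int]) (use oQ in simp)
  then have "(\<integral>y. indicator Q y * frechet_derivative h (at y) (advection v) \<partial>lborel) =
     (\<integral>x. (\<integral>t. indicator Q (t, x + t *\<^sub>R v) *
      frechet_derivative h (at (t, x + t *\<^sub>R v)) (advection v) \<partial>lborel) \<partial>lborel)"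
    using lborel_integral_shear[of "\<lambda>y. indicator Q y * frechet_derivative h (at y) (advection v)" v]
    by simp
  also have "\<dots> \<le> 0"
  proof -
    have "0 \<le> (\<integral>x. - (\<integral>t. indicator Q (t, x + t *\<^sub>R v) *
      frechet_derivative h (at (t, x + t *\<^sub>R v)) (advection v) \<partial>lborel) \<partial>lborel)"
      by (rule integral_nonneg_AE) (use line in eventually_elim, simp)
    then show ?thesis by simp
  qed
  finally show ?thesis .
qed

section \<open>The weak kinetic derivative\<close>

lemma H1_eq_rep: "H1_eq (rep_H1_sphere w) (rep_H1_sphere w)"
  using Quotient3_rep_reflp[OF Quotient3_H1_sphere] by blast

lemma rep_H1_functions: "rep_H1_sphere w \<in> H1_functions"
  using H1_eq_rep[of w] by (simp add: H1_eq_def)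

lemma rep_L2: "rep_H1_sphere w \<in> L2_functions sphere_measure"
  by (rule H1_L2(1)[OF rep_H1_functions])

text \<open>Representatives are arbitrary choices in their classes, so identities between them, here
  and below, hold only almost everywhere on the sphere.\<close>

lemma rep_abs_H1:
  assumes "\<phi> \<in> H1_functions"
  shows "AE v in sphere_measure. rep_H1_sphere (abs_H1_sphere \<phi>) v = \<phi> v"
proof -
  have "H1_eq \<phi> \<phi>" using assms by (simp add: H1_eq_def)
  then have "H1_eq (rep_H1_sphere (abs_H1_sphere \<phi>)) \<phi>"
    by (rule rep_abs_rsp_left[OF Quotient3_H1_sphere])
  then show ?thesis by (simp add: H1_eq_def)
qed

lemma rep_add: "AE v in sphere_measure. rep_H1_sphere (w + w') v = rep_H1_sphere w v + rep_H1_sphere w' v"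
proof -
  have "w + w' = abs_H1_sphere (\<lambda>v. rep_H1_sphere w v + rep_H1_sphere w' v)"
    by (simp add: plus_H1_sphere_def)
  then show ?thesis using rep_abs_H1[OF H1_add[OF rep_H1_functions rep_H1_functions]] by metis
qed

lemma rep_scaleR: "AE v in sphere_measure. rep_H1_sphere (c *\<^sub>R w) v = c * rep_H1_sphere w v"
proof -
  have "c *\<^sub>R w = abs_H1_sphere (\<lambda>v. c *\<^sub>R rep_H1_sphere w v)"
    by (simp add: scaleR_H1_sphere_def)
  then show ?thesis using rep_abs_H1[OF H1_scale[OF rep_H1_functions], of c w] by simp
qed

lemma rep_L2_le_norm: "sqrt (\<integral>v. (rep_H1_sphere w v)\<^sup>2 \<partial>sphere_measure) \<le> norm w"
proof -
  have "w \<bullet> w = H1_inner (rep_H1_sphere w) (rep_H1_sphere w)"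
    by (simp add: inner_H1_sphere_def)
  then have "(\<integral>v. (rep_H1_sphere w v)\<^sup>2 \<partial>sphere_measure) \<le> w \<bullet> w"
    by (simp add: H1_inner_def power2_eq_square)
  then show ?thesis by (simp add: norm_H1_sphere_def)
qed

text \<open>The embedding of L2 of the sphere into the dual of V in the Gelfand triple.\<close>

definition sphere_functional :: "('a::euclidean_space \<Rightarrow> real) \<Rightarrow> 'a H1_sphere \<Rightarrow> real" where
  "sphere_functional h w = (\<integral>v. rep_H1_sphere w v * h v \<partial>sphere_measure)"

lemma sphere_functional_add:
  assumes h: "h \<in> L2_functions sphere_measure"
  shows "sphere_functional h (w + w') = sphere_functional h w + sphere_functional h w'"
proof -
  have "sphere_functional h (w + w') =
      (\<integral>v. rep_H1_sphere w v * h v + rep_H1_sphere w' v * h v \<partial>sphere_measure)"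
    unfolding sphere_functional_def
  proof (rule integral_cong_AE)
    show "AE v in sphere_measure. rep_H1_sphere (w + w') v * h v =
        rep_H1_sphere w v * h v + rep_H1_sphere w' v * h v"
      using rep_add[of w w'] by eventually_elim (simp add: distrib_right)
  qed (use L2_mult_integrable[OF rep_L2 h] in auto)
  also have "\<dots> = sphere_functional h w + sphere_functional h w'"
    unfolding sphere_functional_def
    by (rule Bochner_Integration.integral_add) (rule L2_mult_integrable[OF rep_L2 h])+
  finally show ?thesis .
qed

lemma sphere_functional_scaleR:
  assumes h: "h \<in> L2_functions sphere_measure"
  shows "sphere_functional h (c *\<^sub>R w) = c * sphere_functional h w"
proof -
  have "sphere_functional h (c *\<^sub>R w) = (\<integral>v. c * (rep_H1_sphere w v * h v) \<partial>sphere_measure)"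
    unfolding sphere_functional_def
  proof (rule integral_cong_AE)
    show "AE v in sphere_measure. rep_H1_sphere (c *\<^sub>R w) v * h v = c * (rep_H1_sphere w v * h v)"
      using rep_scaleR[of c w] by eventually_elim simp
  qed (use L2_mult_integrable[OF rep_L2 h] in auto)
  then show ?thesis by (simp add: sphere_functional_def)
qed

lemma sphere_functional_bound:
  assumes h: "h \<in> L2_functions sphere_measure"
  shows "\<bar>sphere_functional h w\<bar> \<le> norm w * sqrt (\<integral>v. (h v)\<^sup>2 \<partial>sphere_measure)"
  unfolding sphere_functional_def
  by (rule order_trans[OF L2_Cauchy_Schwarz[OF rep_L2 h] mult_right_mono[OF rep_L2_le_norm]]) simp

lemma sphere_functional_tendsto:
  assumes h: "h \<in> L2_functions sphere_measure" and u: "u \<longlonglongrightarrow> w"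
  shows "(\<lambda>n. sphere_functional h (u n)) \<longlonglongrightarrow> sphere_functional h w"
proof -
  have "bounded_linear (sphere_functional h)"
    by (rule bounded_linear_intro[where K="sqrt (\<integral>v. (h v)\<^sup>2 \<partial>sphere_measure)"])
       (use sphere_functional_add[OF h] sphere_functional_scaleR[OF h] sphere_functional_bound[OF h] in auto)
  then show ?thesis using u by (rule bounded_linear.tendsto)
qed

text \<open>Functional and argument both depend on y. Along a simple approximation of p the argument
  takes finitely many values, for which measurability is assumed; continuity of each functional
  gives the limit.\<close>

lemma (in complete_measure) sphere_functional_measurable:
  assumes h: "\<And>y. h y \<in> L2_functions sphere_measure"
    and m: "\<And>w. (\<lambda>y. sphere_functional (h y) w) \<in> borel_measurable M"
    and p: "strongly_measurable M p"
  shows "(\<lambda>y. sphere_functional (h y) (p y)) \<in> borel_measurable M"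
proof -
  obtain s where s: "\<forall>n::nat. simple_function M (s n)" "AE x in M. (\<lambda>n. s n x) \<longlonglongrightarrow> p x"
    by (rule strongly_measurableE[OF p]) (rule that)
  show ?thesis
  proof (rule borel_measurable_AE_LIMSEQ)
    show "AE y in M. (\<lambda>n. sphere_functional (h y) (s n y)) \<longlonglongrightarrow> sphere_functional (h y) (p y)"
      using s(2) by eventually_elim (rule sphere_functional_tendsto[OF h])
    fix n
    have sn: "simple_function M (s n)" using s(1) by blast
    show "(\<lambda>y. sphere_functional (h y) (s n y)) \<in> borel_measurable M"
    proof (rule measurable_compose_countable'[where g="s n" and I="s n ` space M" and f="\<lambda>w y. sphere_functional (h y) w"])
      show "s n \<in> M \<rightarrow>\<^sub>M count_space (s n ` space M)"
        using simple_functionD(2)[OF sn] by (auto intro!: measurableI)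
      show "countable (s n ` space M)"
        using simple_functionD(1)[OF sn] by (rule countable_finite)
    qed (rule m)
  qed
qed

section \<open>Velocity integrals and weights from test functions\<close>

lemma L2_sphere_bounded:
  fixes h :: "'a::euclidean_space \<Rightarrow> real"
  assumes h: "h \<in> borel_measurable borel" and B: "\<And>v. norm v = 1 \<Longrightarrow> \<bar>h v\<bar> \<le> B"
    and g: "g \<in> L2_functions sphere_measure"
  shows "(\<lambda>v. g v * h v) \<in> L2_functions sphere_measure"
    and "(\<integral>v. (g v * h v)\<^sup>2 \<partial>sphere_measure) \<le> B\<^sup>2 * (\<integral>v. (g v)\<^sup>2 \<partial>sphere_measure)"
proof -
  have [measurable]: "g \<in> borel_measurable sphere_measure" "h \<in> borel_measurable sphere_measure"
    using g h by (auto simp: L2_functions_def)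
  have i: "integrable sphere_measure (\<lambda>v. B\<^sup>2 * (g v)\<^sup>2)" using g by (simp add: L2_functions_def)
  have ae: "AE v in sphere_measure. (g v * h v)\<^sup>2 \<le> B\<^sup>2 * (g v)\<^sup>2"
    using AE_sphere_measure
  proof eventually_elim
    case (elim v)
    have "(h v)\<^sup>2 \<le> B\<^sup>2" using power_mono[OF B[OF elim] abs_ge_zero, of 2] by simp
    then have "(g v)\<^sup>2 * (h v)\<^sup>2 \<le> (g v)\<^sup>2 * B\<^sup>2" by (intro mult_left_mono) auto
    then show ?case by (simp add: power_mult_distrib mult.commute)
  qed
  have j: "integrable sphere_measure (\<lambda>v. (g v * h v)\<^sup>2)"
    by (rule Bochner_Integration.integrable_bound[OF i]) (use ae in \<open>auto elim: eventually_mono\<close>)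
  then show "(\<lambda>v. g v * h v) \<in> L2_functions sphere_measure" by (simp add: L2_functions_def)
  have "(\<integral>v. (g v * h v)\<^sup>2 \<partial>sphere_measure) \<le> (\<integral>v. B\<^sup>2 * (g v)\<^sup>2 \<partial>sphere_measure)"
    by (rule integral_mono_AE[OF j i ae])
  then show "(\<integral>v. (g v * h v)\<^sup>2 \<partial>sphere_measure) \<le> B\<^sup>2 * (\<integral>v. (g v)\<^sup>2 \<partial>sphere_measure)" by simp
qed

text \<open>The sphere measure lives on the ambient Borel sets, so the product with
  \<open>borel\<close> is again a Borel algebra, where continuity of F yields joint
  measurability.\<close>

lemma borel_measurable_sphere_integral:
  fixes F :: "'b::euclidean_space \<Rightarrow> 'a::euclidean_space \<Rightarrow> real"
  assumes F: "continuous_on UNIV (\<lambda>z. F (fst z) (snd z))" and g: "g \<in> borel_measurable sphere_measure"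
  shows "(\<lambda>y. \<integral>v. g v * F y v \<partial>sphere_measure) \<in> borel_measurable borel"
proof -
  interpret S: finite_measure "sphere_measure :: 'a measure" by (rule finite_sphere_measure)
  have sets_eq: "sets (borel \<Otimes>\<^sub>M sphere_measure) = sets (borel :: ('b \<times> 'a) measure)"
    by (simp add: borel_prod[symmetric] cong: sets_pair_measure_cong)
  have [measurable]: "g \<in> borel_measurable borel" using g by simp
  have Fm [measurable]: "(\<lambda>z. F (fst z) (snd z)) \<in> borel_measurable borel"
    by (rule borel_measurable_continuous_onI[OF F])
  have "(\<lambda>z. g (snd z) * F (fst z) (snd z)) \<in> borel_measurable (borel :: ('b \<times> 'a) measure)"
    by (intro borel_measurable_times Fm measurable_compose[OF _ \<open>g \<in> borel_measurable borel\<close>]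
        borel_measurable_continuous_onI continuous_intros)
  then have "(\<lambda>(y, v). g v * F y v) \<in> borel_measurable (borel \<Otimes>\<^sub>M sphere_measure)"
    by (simp add: case_prod_beta' measurable_cong_sets[OF sets_eq refl])
  then show ?thesis by (rule S.borel_measurable_lebesgue_integral)
qed

lemma test_function_facts:
  assumes "test_function U \<psi>"
  shows "smooth \<psi>" "compact (supp \<psi>)" "supp \<psi> \<subseteq> U" "continuous_on UNIV \<psi>" "\<psi> differentiable (at y)"
proof -
  show s: "smooth \<psi>" "compact (supp \<psi>)" "supp \<psi> \<subseteq> U" using assms by (auto simp: test_function_def)
  show "continuous_on UNIV \<psi>" using smooth_continuous[OF s(1)] .
  have "Ck (Suc 0) \<psi>" using s(1) by (simp only: smooth_def)
  then show "\<psi> differentiable (at y)" by simp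
qed

lemma continuous_zero_outside_compact_bounded:
  fixes f :: "'a::euclidean_space \<Rightarrow> real"
  assumes f: "continuous_on UNIV f" and K: "compact K" and out: "\<And>y. y \<notin> K \<Longrightarrow> f y = 0"
  obtains B where "B \<ge> 0" "\<And>y. \<bar>f y\<bar> \<le> B"
proof -
  have "bounded (f ` K)"
    using compact_continuous_image[OF continuous_on_subset[OF f subset_UNIV] K] compact_imp_bounded by blast
  then obtain B where B: "\<And>y. y \<in> K \<Longrightarrow> \<bar>f y\<bar> \<le> B" by (auto simp: bounded_iff)
  show thesis
  proof (rule that[of "max B 0"])
    show "\<bar>f y\<bar> \<le> max B 0" for y using B[of y] out[of y] by (cases "y \<in> K") auto
  qed simp
qed

lemma lebesgue_on_borel_measurable:
  fixes f :: "'a::euclidean_space \<Rightarrow> real"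
  assumes "f \<in> borel_measurable borel"
  shows "f \<in> borel_measurable (lebesgue_on Q)"
proof -
  have "f \<in> borel_measurable lebesgue" by (rule measurable_completion) (use assms in simp)
  then show ?thesis by (rule measurable_restrict_space1)
qed

lemma L2_lebesgue_on_compact:
  fixes f :: "'a::euclidean_space \<Rightarrow> real"
  assumes Q: "open Q" and f: "f \<in> borel_measurable borel" and K: "compact K"
    and B: "\<And>y. \<bar>f y\<bar> \<le> B" and out: "\<And>y. y \<notin> K \<Longrightarrow> f y = 0"
  shows "f \<in> L2_functions (lebesgue_on Q)"
proof -
  have Ql: "Q \<in> sets lebesgue" using Q by (simp add: borel_open sets_completionI_sets)
  have "integrable lborel (\<lambda>y. (f y)\<^sup>2)"
  proof (rule Bochner_Integration.integrable_bound)
    show "integrable lborel (\<lambda>y. B\<^sup>2 * indicator K y :: real)"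
      using emeasure_bounded_finite[OF compact_imp_bounded[OF K]] K
      by (auto intro!: integrable_mult_right simp: borel_compact)
    show "AE y in lborel. norm ((f y)\<^sup>2) \<le> norm (B\<^sup>2 * indicator K y :: real)"
    proof (rule AE_I2)
      fix y show "norm ((f y)\<^sup>2) \<le> norm (B\<^sup>2 * indicator K y :: real)"
        using power_mono[OF B[of y] abs_ge_zero, of 2] out[of y] by (cases "y \<in> K") auto
    qed
  qed (use f in simp)
  then have "integrable lebesgue (\<lambda>y. (f y)\<^sup>2)" using f by (subst integrable_completion) auto
  then have "integrable lebesgue (\<lambda>y. indicator Q y *\<^sub>R (f y)\<^sup>2)"
    by (rule integrable_mult_indicator[OF Ql])
  then have "integrable (lebesgue_on Q) (\<lambda>y. (f y)\<^sup>2)"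
    by (subst integrable_restrict_space) (use Ql in auto)
  then show ?thesis using lebesgue_on_borel_measurable[OF f] by (simp add: L2_functions_def)
qed

lemma test_function_L2: "open Q \<Longrightarrow> test_function Q \<psi> \<Longrightarrow> \<psi> \<in> L2_functions (lebesgue_on Q)"
proof -
  assume Q: "open Q" and \<psi>: "test_function Q \<psi>"
  note t = test_function_facts[OF \<psi>]
  obtain B where "\<And>y. \<bar>\<psi> y\<bar> \<le> B"
    using continuous_zero_outside_compact_bounded[OF t(4,2) supp_outside[of _ \<psi>]] by metis
  then show ?thesis
    by (rule L2_lebesgue_on_compact[OF Q borel_measurable_continuous_onI[OF t(4)] t(2) _ supp_outside[of _ \<psi>]])
qed
lemma frechet_derivative_jointly_continuous:
  fixes \<psi> :: "'a::euclidean_space \<Rightarrow> real" and \<alpha> w :: "'b::topological_space \<Rightarrow> 'a"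
  assumes \<psi>: "smooth \<psi>" and \<alpha>: "continuous_on UNIV \<alpha>" and w: "continuous_on UNIV w"
  shows "continuous_on UNIV (\<lambda>z. frechet_derivative \<psi> (at (\<alpha> z)) (w z))"
proof -
  have "Ck (Suc 0) \<psi>" using \<psi> by (simp only: smooth_def)
  then have d: "\<psi> differentiable (at x)" for x by simp
  have "frechet_derivative \<psi> (at (\<alpha> z)) (w z) =
      (\<Sum>b\<in>Basis. (w z \<bullet> b) * frechet_derivative \<psi> (at (\<alpha> z)) b)" for z
  proof -
    interpret bounded_linear "frechet_derivative \<psi> (at (\<alpha> z))"
      using d by (meson frechet_derivative_works has_derivative_bounded_linear)
    have "frechet_derivative \<psi> (at (\<alpha> z)) (\<Sum>b\<in>Basis. (w z \<bullet> b) *\<^sub>R b) =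
        (\<Sum>b\<in>Basis. (w z \<bullet> b) * frechet_derivative \<psi> (at (\<alpha> z)) b)"
      by (simp add: sum scaleR)
    then show ?thesis by (simp add: euclidean_representation)
  qed
  moreover have "continuous_on UNIV (\<lambda>z. frechet_derivative \<psi> (at (\<alpha> z)) b)" for b
    by (rule continuous_on_compose2[OF smooth_partial_continuous[OF \<psi> continuous_on_const] \<alpha>]) auto
  ultimately show ?thesis using w by (auto intro!: continuous_intros)
qed

lemma continuous_advection: "continuous_on UNIV f \<Longrightarrow> continuous_on UNIV (\<lambda>z. advection (f z))"
  unfolding advection_def by (intro continuous_intros)

text \<open>The field (1, v) is unbounded on the ambient space; the uniform bound comes from
  compactness of the support of \<psi> times the unit sphere.\<close>

lemma L2_kinetic_weight:
  fixes \<psi> :: "real \<times> 'a::euclidean_space \<Rightarrow> real"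
  assumes \<psi>: "test_function U \<psi>" and g: "g \<in> L2_functions sphere_measure"
  shows "(\<lambda>v. g v * frechet_derivative \<psi> (at y) (advection v)) \<in> L2_functions sphere_measure"
    and "\<exists>B\<ge>0. \<forall>y. sqrt (\<integral>v. (g v * frechet_derivative \<psi> (at y) (advection v))\<^sup>2 \<partial>sphere_measure)
            \<le> B * indicator (supp \<psi>) y"
proof -
  note t = test_function_facts[OF \<psi>]
  have c: "continuous_on UNIV (\<lambda>z. frechet_derivative \<psi> (at (fst z)) (advection (snd z)))"
    by (intro frechet_derivative_jointly_continuous t continuous_advection continuous_intros)
  have "bounded ((\<lambda>z. frechet_derivative \<psi> (at (fst z)) (advection (snd z))) ` (supp \<psi> \<times> sphere 0 1))"
    by (intro compact_imp_bounded compact_continuous_image continuous_on_subset[OF c] compact_Times t) auto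
  then obtain B0 where B0: "\<And>y v. y \<in> supp \<psi> \<Longrightarrow> norm v = 1 \<Longrightarrow>
      \<bar>frechet_derivative \<psi> (at y) (advection v)\<bar> \<le> B0"
    by (force simp: bounded_iff)
  define B where "B = max B0 0"
  have B: "\<bar>frechet_derivative \<psi> (at y) (advection v)\<bar> \<le> B" if "norm v = 1" for y v
    using B0[OF _ that, of y] frechet_derivative_outside_supp[of y \<psi>]
    by (cases "y \<in> supp \<psi>") (auto simp: B_def)
  have m: "(\<lambda>v. frechet_derivative \<psi> (at y) (advection v)) \<in> borel_measurable borel" for y
    by (intro borel_measurable_continuous_onI frechet_derivative_jointly_continuous t
        continuous_advection continuous_intros)
  show "(\<lambda>v. g v * frechet_derivative \<psi> (at y) (advection v)) \<in> L2_functions sphere_measure"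
    by (rule L2_sphere_bounded(1)[OF m B g])
  show "\<exists>B\<ge>0. \<forall>y. sqrt (\<integral>v. (g v * frechet_derivative \<psi> (at y) (advection v))\<^sup>2 \<partial>sphere_measure)
            \<le> B * indicator (supp \<psi>) y"
  proof (intro exI conjI allI)
    show "B * sqrt (\<integral>v. (g v)\<^sup>2 \<partial>sphere_measure) \<ge> 0" by (simp add: B_def)
    show "sqrt (\<integral>v. (g v * frechet_derivative \<psi> (at y) (advection v))\<^sup>2 \<partial>sphere_measure)
        \<le> B * sqrt (\<integral>v. (g v)\<^sup>2 \<partial>sphere_measure) * indicator (supp \<psi>) y" for y
    proof (cases "y \<in> supp \<psi>")
      case True
      have "sqrt (\<integral>v. (g v * frechet_derivative \<psi> (at y) (advection v))\<^sup>2 \<partial>sphere_measure)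
          \<le> sqrt (B\<^sup>2 * (\<integral>v. (g v)\<^sup>2 \<partial>sphere_measure))"
        by (rule real_sqrt_le_mono[OF L2_sphere_bounded(2)[OF m B g]])
      then show ?thesis using True by (simp add: real_sqrt_mult B_def)
    next
      case False
      then show ?thesis by (simp add: frechet_derivative_outside_supp)
    qed
  qed
qed

text \<open>The inner integral of the weak formulation, read as an L2 functional applied to p(y), so
  that linearity, bounds and measurability come from \<open>sphere_functional\<close>.\<close>

definition kinetic_pairing where
  "kinetic_pairing \<psi> \<phi> w y =
     sphere_functional (\<lambda>v. rep_H1_sphere \<phi> v * frechet_derivative \<psi> (at y) (advection v)) w"

lemma weak_kinetic_derivative_iff:
  "weak_kinetic_derivative Q p r \<longleftrightarrow> r \<in> bochner_L2 (lebesgue_on Q) \<and>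
     (\<forall>\<psi> \<phi>. test_function Q \<psi> \<longrightarrow>
        (\<integral>y. blinfun_apply (r y) \<phi> * \<psi> y \<partial>lebesgue_on Q) =
        - (\<integral>y. kinetic_pairing \<psi> \<phi> (p y) y \<partial>lebesgue_on Q))"
  unfolding weak_kinetic_derivative_def kinetic_pairing_def sphere_functional_def
  by (simp add: mult.assoc)

section \<open>Uniqueness and linearity of the weak kinetic derivative\<close>

context
  fixes Q :: "(real \<times> 'a::euclidean_space) set"
  assumes Q: "open Q"
begin

lemma Q_lebesgue: "Q \<in> sets lebesgue"
  using Q by (simp add: borel_open sets_completionI_sets)

lemma complete_Q: "complete_measure (lebesgue_on Q)"
  by (rule complete_lebesgue_on[OF Q_lebesgue])

text \<open>The majorant is |p(y)| times a constant on the compact support of \<psi>, a product of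
  two L2 functions.\<close>

lemma kinetic_pairing_integrable:
  assumes p: "p \<in> bochner_L2 (lebesgue_on Q)" and \<psi>: "test_function Q \<psi>"
  shows "integrable (lebesgue_on Q) (\<lambda>y. kinetic_pairing \<psi> \<phi> (p y) y)"
proof -
  note t = test_function_facts[OF \<psi>]
  interpret complete_measure "lebesgue_on Q" by (rule complete_Q)
  note h = L2_kinetic_weight[OF \<psi> rep_L2[of \<phi>]]
  obtain B where B: "B \<ge> 0" "\<And>y. sqrt (\<integral>v. (rep_H1_sphere \<phi> v * frechet_derivative \<psi> (at y) (advection v))\<^sup>2 \<partial>sphere_measure)
      \<le> B * indicator (supp \<psi>) y"
    using h(2) by blast
  show ?thesis
  proof (rule Bochner_Integration.integrable_bound)
    have [measurable]: "supp \<psi> \<in> sets borel" unfolding supp_def by simp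
    have "(\<lambda>y. B * indicator (supp \<psi>) y) \<in> borel_measurable borel" by measurable
    then have "(\<lambda>y. B * indicator (supp \<psi>) y) \<in> L2_functions (lebesgue_on Q)"
      by (rule L2_lebesgue_on_compact[OF Q _ t(2), where B=B])
         (use B(1) in \<open>auto simp: indicator_def\<close>)
    then show "integrable (lebesgue_on Q) (\<lambda>y. norm (p y) * (B * indicator (supp \<psi>) y))"
      by (intro L2_mult_integrable bochner_L2_norm complete_Q p)
    show "AE y in lebesgue_on Q. norm (kinetic_pairing \<psi> \<phi> (p y) y)
        \<le> norm (norm (p y) * (B * indicator (supp \<psi>) y))"
    proof (rule AE_I2)
      fix y
      have "\<bar>kinetic_pairing \<psi> \<phi> (p y) y\<bar> \<le> norm (p y) * (B * indicator (supp \<psi>) y)"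
        unfolding kinetic_pairing_def
        by (rule order_trans[OF sphere_functional_bound[OF h(1)] mult_left_mono[OF B(2)]]) simp
      then show "norm (kinetic_pairing \<psi> \<phi> (p y) y) \<le> norm (norm (p y) * (B * indicator (supp \<psi>) y))"
        by simp
    qed
    show "(\<lambda>y. kinetic_pairing \<psi> \<phi> (p y) y) \<in> borel_measurable (lebesgue_on Q)"
      unfolding kinetic_pairing_def
    proof (rule sphere_functional_measurable[OF h(1)])
      show "strongly_measurable (lebesgue_on Q) p" using p by (simp add: bochner_L2_def)
      fix w
      have "(\<lambda>y. \<integral>v. (rep_H1_sphere w v * rep_H1_sphere \<phi> v) *
          frechet_derivative \<psi> (at y) (advection v) \<partial>sphere_measure) \<in> borel_measurable borel"
        by (rule borel_measurable_sphere_integral)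
           (use L2_mult_integrable[OF rep_L2 rep_L2] in \<open>auto intro!: frechet_derivative_jointly_continuous
              t continuous_advection continuous_intros\<close>)
      then show "(\<lambda>y. sphere_functional (\<lambda>v. rep_H1_sphere \<phi> v * frechet_derivative \<psi> (at y) (advection v)) w)
          \<in> borel_measurable (lebesgue_on Q)"
        unfolding sphere_functional_def by (intro lebesgue_on_borel_measurable) (simp add: mult.assoc)
    qed
  qed
qed

lemma blinfun_apply_L2:
  fixes r :: "real \<times> 'a \<Rightarrow> 'b::real_normed_vector \<Rightarrow>\<^sub>L real"
  assumes r: "r \<in> bochner_L2 (lebesgue_on Q)"
  shows "(\<lambda>y. blinfun_apply (r y) \<phi>) \<in> L2_functions (lebesgue_on Q)"
proof -
  interpret complete_measure "lebesgue_on Q" by (rule complete_Q)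
  have "strongly_measurable (lebesgue_on Q) (\<lambda>y. blinfun_apply (r y) \<phi>)"
    using r strongly_measurable_blinfun_apply[OF _ strongly_measurable_const] by (auto simp: bochner_L2_def)
  note sm = this
  have "(\<lambda>y. norm \<phi> * norm (r y)) \<in> L2_functions (lebesgue_on Q)"
    using L2_scale[OF bochner_L2_norm[OF complete_Q r], of "norm \<phi>"] by simp
  moreover have "AE y in lebesgue_on Q. norm (blinfun_apply (r y) \<phi>) \<le> norm \<phi> * norm (r y)"
    using norm_blinfun[of "r y" \<phi> for y] by (auto simp: mult.commute)
  ultimately have "(\<lambda>y. blinfun_apply (r y) \<phi>) \<in> bochner_L2 (lebesgue_on Q)"
    by (rule bochner_L2I[OF complete_Q sm])
  then show ?thesis
    using strongly_measurable_imp_borel[OF sm] by (simp add: bochner_L2_def L2_functions_def)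
qed

lemma blinfun_test_integrable:
  assumes r: "r \<in> bochner_L2 (lebesgue_on Q)" and \<psi>: "test_function Q \<psi>"
  shows "integrable (lebesgue_on Q) (\<lambda>y. blinfun_apply (r y) \<phi> * \<psi> y)"
  by (rule L2_mult_integrable[OF blinfun_apply_L2[OF r] test_function_L2[OF Q \<psi>]])

lemma weak_kinetic_derivative_L2: "weak_kinetic_derivative Q p r \<Longrightarrow> r \<in> bochner_L2 (lebesgue_on Q)"
  by (simp add: weak_kinetic_derivative_def)

text \<open>For each \<phi> the fundamental lemma gives <r - r', \<phi>> = 0 off a null set that
  depends on \<phi>; strong measurability of r - r' removes the dependence. This makes the choice in
  \<open>kinetic_derivative\<close> harmless.\<close>

lemma weak_kinetic_derivative_unique:
  assumes p: "p \<in> bochner_L2 (lebesgue_on Q)" "p' \<in> bochner_L2 (lebesgue_on Q)"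
    and r: "weak_kinetic_derivative Q p r" "weak_kinetic_derivative Q p' r'"
    and ae: "AE y in lebesgue_on Q. p y = p' y"
  shows "AE y in lebesgue_on Q. r y = r' y"
proof -
  have rL: "r \<in> bochner_L2 (lebesgue_on Q)" "r' \<in> bochner_L2 (lebesgue_on Q)"
    using r weak_kinetic_derivative_L2 by auto
  have d: "(\<lambda>y. r y - r' y) \<in> bochner_L2 (lebesgue_on Q)"
    by (rule bochner_L2_diff[OF complete_Q rL])
  have "AE y in lebesgue_on Q. blinfun_apply (r y - r' y) \<phi> = 0" for \<phi>
  proof (rule fundamental_lemma_open[OF Q])
    show "(\<lambda>y. blinfun_apply (r y - r' y) \<phi>) \<in> L2_functions (lebesgue_on Q)"
      by (rule blinfun_apply_L2[OF d])
    fix \<psi> assume \<psi>: "test_function Q \<psi>"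
    have "(\<integral>y. kinetic_pairing \<psi> \<phi> (p y) y \<partial>lebesgue_on Q) = (\<integral>y. kinetic_pairing \<psi> \<phi> (p' y) y \<partial>lebesgue_on Q)"
      by (rule integral_cong_AE)
         (use kinetic_pairing_integrable[OF p(1) \<psi>] kinetic_pairing_integrable[OF p(2) \<psi>] ae in auto)
    then have "(\<integral>y. blinfun_apply (r y) \<phi> * \<psi> y \<partial>lebesgue_on Q) = (\<integral>y. blinfun_apply (r' y) \<phi> * \<psi> y \<partial>lebesgue_on Q)"
      using r \<psi> unfolding weak_kinetic_derivative_iff by simp
    then show "(\<integral>y. blinfun_apply (r y - r' y) \<phi> * \<psi> y \<partial>lebesgue_on Q) = 0"
      using blinfun_test_integrable[OF rL(1) \<psi>, of \<phi>] blinfun_test_integrable[OF rL(2) \<psi>, of \<phi>]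
      by (simp add: blinfun.diff_left left_diff_distrib)
  qed
  then have "AE y in lebesgue_on Q. r y - r' y = 0"
    using d by (intro strongly_measurable_blinfun_AE_zero) (auto simp: bochner_L2_def)
  then show ?thesis by eventually_elim simp
qed

lemma weak_kinetic_derivative_add:
  assumes p: "p \<in> bochner_L2 (lebesgue_on Q)" "p' \<in> bochner_L2 (lebesgue_on Q)"
    and r: "weak_kinetic_derivative Q p r" "weak_kinetic_derivative Q p' r'"
  shows "weak_kinetic_derivative Q (\<lambda>y. p y + p' y) (\<lambda>y. r y + r' y)"
proof -
  have rL: "r \<in> bochner_L2 (lebesgue_on Q)" "r' \<in> bochner_L2 (lebesgue_on Q)"
    using r weak_kinetic_derivative_L2 by auto
  show ?thesis
    unfolding weak_kinetic_derivative_iff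
  proof (intro conjI allI impI)
    show "(\<lambda>y. r y + r' y) \<in> bochner_L2 (lebesgue_on Q)" by (rule bochner_L2_add[OF complete_Q rL])
    fix \<psi> \<phi> assume \<psi>: "test_function Q \<psi>"
    have "kinetic_pairing \<psi> \<phi> (p y + p' y) y = kinetic_pairing \<psi> \<phi> (p y) y + kinetic_pairing \<psi> \<phi> (p' y) y" for y
      unfolding kinetic_pairing_def by (rule sphere_functional_add[OF L2_kinetic_weight(1)[OF \<psi> rep_L2]])
    then show "(\<integral>y. blinfun_apply (r y + r' y) \<phi> * \<psi> y \<partial>lebesgue_on Q) =
        - (\<integral>y. kinetic_pairing \<psi> \<phi> (p y + p' y) y \<partial>lebesgue_on Q)"
      using blinfun_test_integrable[OF rL(1) \<psi>, of \<phi>] blinfun_test_integrable[OF rL(2) \<psi>, of \<phi>]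
        kinetic_pairing_integrable[OF p(1) \<psi>, of \<phi>] kinetic_pairing_integrable[OF p(2) \<psi>, of \<phi>] r \<psi>
      unfolding weak_kinetic_derivative_iff by (simp add: blinfun.add_left distrib_right)
  qed
qed

lemma weak_kinetic_derivative_scaleR:
  assumes r: "weak_kinetic_derivative Q p r"
  shows "weak_kinetic_derivative Q (\<lambda>y. c *\<^sub>R p y) (\<lambda>y. c *\<^sub>R r y)"
  unfolding weak_kinetic_derivative_iff
proof (intro conjI allI impI)
  show "(\<lambda>y. c *\<^sub>R r y) \<in> bochner_L2 (lebesgue_on Q)"
    using r bochner_L2_scaleR weak_kinetic_derivative_L2 by blast
  fix \<psi> \<phi> assume \<psi>: "test_function Q \<psi>"
  have "kinetic_pairing \<psi> \<phi> (c *\<^sub>R p y) y = c * kinetic_pairing \<psi> \<phi> (p y) y" for y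
    unfolding kinetic_pairing_def by (rule sphere_functional_scaleR[OF L2_kinetic_weight(1)[OF \<psi> rep_L2]])
  then show "(\<integral>y. blinfun_apply (c *\<^sub>R r y) \<phi> * \<psi> y \<partial>lebesgue_on Q) =
      - (\<integral>y. kinetic_pairing \<psi> \<phi> (c *\<^sub>R p y) y \<partial>lebesgue_on Q)"
    using r \<psi> unfolding weak_kinetic_derivative_iff by (simp add: blinfun.scaleR_left mult.assoc)
qed

lemma H1_FP_D:
  assumes "p \<in> H1_FP Q"
  shows "p \<in> bochner_L2 (lebesgue_on Q)" "weak_kinetic_derivative Q p (kinetic_derivative Q p)"
    "kinetic_derivative Q p \<in> bochner_L2 (lebesgue_on Q)"
proof -
  show "p \<in> bochner_L2 (lebesgue_on Q)" using assms by (simp add: H1_FP_def)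
  show w: "weak_kinetic_derivative Q p (kinetic_derivative Q p)"
  proof -
    obtain r where "weak_kinetic_derivative Q p r" using assms by (auto simp: H1_FP_def)
    then show ?thesis unfolding kinetic_derivative_def by (rule someI[of "weak_kinetic_derivative Q p"])
  qed
  show "kinetic_derivative Q p \<in> bochner_L2 (lebesgue_on Q)"
    by (rule weak_kinetic_derivative_L2[OF w])
qed

lemma H1_FP_I:
  "p \<in> bochner_L2 (lebesgue_on Q) \<Longrightarrow> weak_kinetic_derivative Q p r \<Longrightarrow> p \<in> H1_FP Q"
  by (auto simp: H1_FP_def)

lemma H1_FP_add:
  "p \<in> H1_FP Q \<Longrightarrow> p' \<in> H1_FP Q \<Longrightarrow> (\<lambda>y. p y + p' y) \<in> H1_FP Q"
  by (rule H1_FP_I[OF bochner_L2_add[OF complete_Q H1_FP_D(1) H1_FP_D(1)]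
        weak_kinetic_derivative_add[OF H1_FP_D(1) H1_FP_D(1) H1_FP_D(2) H1_FP_D(2)]])

lemma H1_FP_scaleR: "p \<in> H1_FP Q \<Longrightarrow> (\<lambda>y. c *\<^sub>R p y) \<in> H1_FP Q"
  by (rule H1_FP_I[OF bochner_L2_scaleR[OF H1_FP_D(1)] weak_kinetic_derivative_scaleR[OF H1_FP_D(2)]])

lemma H1_FP_diff: "p \<in> H1_FP Q \<Longrightarrow> p' \<in> H1_FP Q \<Longrightarrow> (\<lambda>y. p y - p' y) \<in> H1_FP Q"
  using H1_FP_add[OF _ H1_FP_scaleR[of p' "-1"], of p] by simp

lemma kinetic_derivative_add:
  assumes "p \<in> H1_FP Q" "p' \<in> H1_FP Q"
  shows "AE y in lebesgue_on Q. kinetic_derivative Q (\<lambda>y. p y + p' y) y =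
           kinetic_derivative Q p y + kinetic_derivative Q p' y"
proof (rule weak_kinetic_derivative_unique)
  note s = H1_FP_add[OF assms]
  show "(\<lambda>y. p y + p' y) \<in> bochner_L2 (lebesgue_on Q)" "(\<lambda>y. p y + p' y) \<in> bochner_L2 (lebesgue_on Q)"
    by (rule H1_FP_D(1)[OF s])+
  show "weak_kinetic_derivative Q (\<lambda>y. p y + p' y) (kinetic_derivative Q (\<lambda>y. p y + p' y))"
    by (rule H1_FP_D(2)[OF s])
  show "weak_kinetic_derivative Q (\<lambda>y. p y + p' y) (\<lambda>y. kinetic_derivative Q p y + kinetic_derivative Q p' y)"
    by (rule weak_kinetic_derivative_add[OF H1_FP_D(1)[OF assms(1)] H1_FP_D(1)[OF assms(2)]
          H1_FP_D(2)[OF assms(1)] H1_FP_D(2)[OF assms(2)]])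
qed simp

lemma kinetic_derivative_scaleR:
  assumes "p \<in> H1_FP Q"
  shows "AE y in lebesgue_on Q. kinetic_derivative Q (\<lambda>y. c *\<^sub>R p y) y = c *\<^sub>R kinetic_derivative Q p y"
proof (rule weak_kinetic_derivative_unique)
  note s = H1_FP_scaleR[OF assms, of c]
  show "(\<lambda>y. c *\<^sub>R p y) \<in> bochner_L2 (lebesgue_on Q)" "(\<lambda>y. c *\<^sub>R p y) \<in> bochner_L2 (lebesgue_on Q)"
    by (rule H1_FP_D(1)[OF s])+
  show "weak_kinetic_derivative Q (\<lambda>y. c *\<^sub>R p y) (kinetic_derivative Q (\<lambda>y. c *\<^sub>R p y))"
    by (rule H1_FP_D(2)[OF s])
  show "weak_kinetic_derivative Q (\<lambda>y. c *\<^sub>R p y) (\<lambda>y. c *\<^sub>R kinetic_derivative Q p y)"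
    by (rule weak_kinetic_derivative_scaleR[OF H1_FP_D(2)[OF assms]])
qed simp

lemma kinetic_derivative_diff:
  assumes "p \<in> H1_FP Q" "p' \<in> H1_FP Q"
  shows "AE y in lebesgue_on Q. kinetic_derivative Q (\<lambda>y. p y - p' y) y =
           kinetic_derivative Q p y - kinetic_derivative Q p' y"
  using kinetic_derivative_add[OF assms(1) H1_FP_scaleR[OF assms(2), of "-1"]]
    kinetic_derivative_scaleR[OF assms(2), of "-1"]
  by eventually_elim simp

lemma kinetic_derivative_AE_eq:
  assumes "p \<in> H1_FP Q" "p' \<in> H1_FP Q" "AE y in lebesgue_on Q. p y = p' y"
  shows "AE y in lebesgue_on Q. kinetic_derivative Q p y = kinetic_derivative Q p' y"
  by (rule weak_kinetic_derivative_unique[OF H1_FP_D(1)[OF assms(1)] H1_FP_D(1)[OF assms(2)]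
        H1_FP_D(2)[OF assms(1)] H1_FP_D(2)[OF assms(2)] assms(3)])

end

section \<open>The sign of the boundary term\<close>

text \<open>F is bounded with compact support, so C times the L1 norm of g on the projection of K
  dominates the inner integrals of the absolute value; this is the integrability on the product that
  Fubini asks for.\<close>

lemma sphere_Fubini:
  fixes F :: "'b::euclidean_space \<times> 'a::euclidean_space \<Rightarrow> real"
  assumes F: "F \<in> borel_measurable borel" and C: "\<And>z. \<bar>F z\<bar> \<le> C"
    and K: "compact K" and out: "\<And>z. z \<notin> K \<Longrightarrow> F z = 0"
    and g: "integrable sphere_measure g"
  shows "(\<integral>y. (\<integral>v. g v * F (y, v) \<partial>sphere_measure) \<partial>lborel) =
         (\<integral>v. g v * (\<integral>y. F (y, v) \<partial>lborel) \<partial>sphere_measure)"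
proof -
  interpret S: finite_measure "sphere_measure :: 'a measure" by (rule finite_sphere_measure)
  interpret P: pair_sigma_finite "lborel :: 'b measure" "sphere_measure :: 'a measure" ..
  have sets_eq: "sets (lborel \<Otimes>\<^sub>M sphere_measure) = sets (borel :: ('b \<times> 'a) measure)"
    by (simp add: borel_prod[symmetric] cong: sets_pair_measure_cong)
  have gm: "g \<in> borel_measurable borel" using borel_measurable_integrable[OF g] by simp
  have "(\<lambda>z. g (snd z) * F z) \<in> borel_measurable (borel :: ('b \<times> 'a) measure)"
    by (intro borel_measurable_times F measurable_compose[OF _ gm] borel_measurable_continuous_onI continuous_intros)
  then have m: "(\<lambda>z. g (snd z) * F z) \<in> borel_measurable (lborel \<Otimes>\<^sub>M sphere_measure)"
    by (simp add: measurable_cong_sets[OF sets_eq refl])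
  have C0: "C \<ge> 0" using C[of undefined] by linarith
  have sec: "integrable sphere_measure (\<lambda>v. g v * F (y, v))" for y
  proof (rule Bochner_Integration.integrable_bound)
    show "integrable sphere_measure (\<lambda>v. C * g v)" using g by simp
    show "(\<lambda>v. g v * F (y, v)) \<in> borel_measurable sphere_measure"
      using measurable_compose[OF measurable_Pair1'[of y lborel sphere_measure] m] by simp
    show "AE v in sphere_measure. norm (g v * F (y, v)) \<le> norm (C * g v)"
      using mult_left_mono[OF C abs_ge_zero] C0 by (auto simp: abs_mult mult.commute)
  qed
  have "integrable (lborel \<Otimes>\<^sub>M sphere_measure) (\<lambda>z. g (snd z) * F z)"
  proof (rule P.Fubini_integrable[OF m])
    show "AE y in lborel. integrable sphere_measure (\<lambda>v. g (snd (y, v)) * F (y, v))"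
      using sec by simp
    show "integrable lborel (\<lambda>y. \<integral>v. norm (g (snd (y, v)) * F (y, v)) \<partial>sphere_measure)"
    proof (rule Bochner_Integration.integrable_bound)
      have cK: "compact (fst ` K)" by (intro compact_continuous_image continuous_intros K)
      show "integrable lborel (\<lambda>y. (C * (\<integral>v. \<bar>g v\<bar> \<partial>sphere_measure)) * indicator (fst ` K) y :: real)"
        using emeasure_bounded_finite[OF compact_imp_bounded[OF cK]] cK
        by (auto intro!: integrable_mult_right simp: borel_compact)
      show "(\<lambda>y. \<integral>v. norm (g (snd (y, v)) * F (y, v)) \<partial>sphere_measure) \<in> borel_measurable lborel"
        using m by (intro S.borel_measurable_lebesgue_integral) (simp add: case_prod_beta')
      show "AE y in lborel. norm (\<integral>v. norm (g (snd (y, v)) * F (y, v)) \<partial>sphere_measure)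
          \<le> norm ((C * (\<integral>v. \<bar>g v\<bar> \<partial>sphere_measure)) * indicator (fst ` K) y :: real)"
      proof (rule AE_I2)
        fix y
        have n: "norm (\<integral>v. norm (g (snd (y, v)) * F (y, v)) \<partial>sphere_measure) =
            (\<integral>v. \<bar>g v * F (y, v)\<bar> \<partial>sphere_measure)" by simp
        show "norm (\<integral>v. norm (g (snd (y, v)) * F (y, v)) \<partial>sphere_measure)
            \<le> norm ((C * (\<integral>v. \<bar>g v\<bar> \<partial>sphere_measure)) * indicator (fst ` K) y :: real)"
        proof (cases "y \<in> fst ` K")
          case True
          have "(\<integral>v. \<bar>g v * F (y, v)\<bar> \<partial>sphere_measure) \<le> (\<integral>v. C * \<bar>g v\<bar> \<partial>sphere_measure)"
            using integrable_abs[OF sec[of y]] g mult_left_mono[OF C abs_ge_zero]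
            by (intro integral_mono) (auto simp: abs_mult mult.commute)
          then show ?thesis unfolding n using True C0 by simp
        next
          case False
          then have "F (y, v) = 0" for v using out[of "(y, v)"] by force
          then show ?thesis by simp
        qed
      qed
    qed
  qed
  then show ?thesis
    using P.Fubini_integral[of "\<lambda>y v. g v * F (y, v)"] by (simp add: case_prod_beta')
qed

section \<open>Classical derivatives along the advection field\<close>

definition kinetic_gradient :: "((real \<times> 'a::euclidean_space) \<times> 'a \<Rightarrow> real) \<Rightarrow> real \<times> 'a \<Rightarrow> 'a \<Rightarrow> real" where
  "kinetic_gradient f y v = frechet_derivative f (at (y, v)) (advection v, 0)"

lemma kinetic_gradient_continuous:
  assumes "smooth f"
  shows "continuous_on UNIV (\<lambda>z. kinetic_gradient f (fst z) (snd z))"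
  unfolding kinetic_gradient_def
  by (intro frechet_derivative_jointly_continuous assms continuous_intros continuous_advection)

lemma slice_derivative:
  fixes f :: "(real \<times> 'a::euclidean_space) \<times> 'a \<Rightarrow> real"
  assumes f: "test_function U f"
  shows "((\<lambda>y. f (y, v)) has_derivative (\<lambda>h. frechet_derivative f (at (y, v)) (h, 0))) (at y)"
proof -
  have "(f has_derivative frechet_derivative f (at (y, v))) (at (y, v))"
    using test_function_facts(5)[OF f] frechet_derivative_works by blast
  moreover have "((\<lambda>y. (y, v)) has_derivative (\<lambda>h. (h, 0))) (at y)"
    by (auto intro!: derivative_eq_intros)
  ultimately show ?thesis
    using has_derivative_compose[of "\<lambda>y. (y, v)" "\<lambda>h. (h, 0)" y UNIV f] by simp
qed

lemma kinetic_gradient_outside: "z \<notin> supp f \<Longrightarrow> kinetic_gradient f (fst z) (snd z) = 0"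
  by (simp add: kinetic_gradient_def frechet_derivative_outside_supp)

lemma kinetic_gradient_bounded:
  assumes f: "test_function U f"
  obtains C where "C \<ge> 0" "\<And>y v. \<bar>kinetic_gradient f y v\<bar> \<le> C"
proof -
  note t = test_function_facts[OF f]
  obtain C where C: "C \<ge> 0" "\<And>z. \<bar>kinetic_gradient f (fst z) (snd z)\<bar> \<le> C"
    using continuous_zero_outside_compact_bounded[OF kinetic_gradient_continuous[OF t(1)] t(2)
        kinetic_gradient_outside[of _ f]] by blast
  show thesis
  proof (rule that[OF C(1)])
    show "\<bar>kinetic_gradient f y v\<bar> \<le> C" for y v using C(2)[of "(y, v)"] by simp
  qed
qed

lemma sphere_one_L2: "(\<lambda>v. 1 :: real) \<in> L2_functions sphere_measure"
proof -
  interpret S: finite_measure "sphere_measure :: 'a::euclidean_space measure" by (rule finite_sphere_measure)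
  show "(\<lambda>v. 1 :: real) \<in> L2_functions (sphere_measure :: 'a measure)" by (simp add: L2_functions_def)
qed

lemma slice_L2:
  fixes F :: "'b::euclidean_space \<Rightarrow> 'a::euclidean_space \<Rightarrow> real"
  assumes F: "continuous_on UNIV (\<lambda>z. F (fst z) (snd z))" and C: "\<And>y v. \<bar>F y v\<bar> \<le> C"
  shows "F y \<in> L2_functions sphere_measure"
    and "sqrt (\<integral>v. (F y v)\<^sup>2 \<partial>sphere_measure) \<le> sqrt (C\<^sup>2 * (\<integral>v. 1 \<partial>(sphere_measure :: 'a measure)))"
proof -
  have "continuous_on UNIV (\<lambda>v. (y, v))"
    by (intro continuous_on_Pair continuous_on_const continuous_on_id)
  then have "continuous_on UNIV (\<lambda>v. F y v)"
    using continuous_on_compose2[OF F, of UNIV "\<lambda>v. (y, v)"] by simp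
  then have m: "F y \<in> borel_measurable borel" by (intro borel_measurable_continuous_onI) simp
  show "F y \<in> L2_functions sphere_measure"
    using L2_sphere_bounded(1)[OF m C sphere_one_L2] by simp
  show "sqrt (\<integral>v. (F y v)\<^sup>2 \<partial>sphere_measure) \<le> sqrt (C\<^sup>2 * (\<integral>v. 1 \<partial>(sphere_measure :: 'a measure)))"
    using L2_sphere_bounded(2)[OF m C sphere_one_L2] by simp
qed

lemma lebesgue_on_integral_borel:
  fixes h :: "'a::euclidean_space \<Rightarrow> real"
  assumes Q: "open Q" and h: "h \<in> borel_measurable borel"
  shows "(\<integral>y. h y \<partial>lebesgue_on Q) = (\<integral>y. indicator Q y * h y \<partial>lborel)"
proof -
  have Ql: "Q \<in> sets lebesgue" using Q by (simp add: borel_open sets_completionI_sets)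
  have "(\<integral>y. h y \<partial>lebesgue_on Q) = (\<integral>y. indicator Q y *\<^sub>R h y \<partial>lebesgue)"
    by (rule integral_restrict_space) (use Ql in simp)
  also have "\<dots> = (\<integral>y. indicator Q y *\<^sub>R h y \<partial>lborel)"
    by (rule integral_completion) (use Q h in auto)
  finally show ?thesis by simp
qed

text \<open>For fixed v the integrand is the advection derivative of f(., v) \<psi>, whose compact
  support comes from \<psi>.\<close>

lemma kinetic_integration_by_parts:
  fixes f :: "(real \<times> 'a::euclidean_space) \<times> 'a \<Rightarrow> real"
  assumes f: "test_function U f" and \<psi>: "test_function U' \<psi>"
  shows "(\<integral>y. f (y, v) * frechet_derivative \<psi> (at y) (advection v) + kinetic_gradient f y v * \<psi> y \<partial>lborel) = 0"
proof -
  note t = test_function_facts[OF f] and t' = test_function_facts[OF \<psi>]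
  let ?h = "\<lambda>y. f (y, v) * \<psi> y"
  have d: "(?h has_derivative (\<lambda>k. f (y, v) * frechet_derivative \<psi> (at y) k +
      frechet_derivative f (at (y, v)) (k, 0) * \<psi> y)) (at y)" for y
    by (rule has_derivative_mult[OF slice_derivative[OF f]])
       (use t'(5) frechet_derivative_works in blast)
  have fr: "frechet_derivative ?h (at y) (advection v) =
      f (y, v) * frechet_derivative \<psi> (at y) (advection v) + kinetic_gradient f y v * \<psi> y" for y
    using frechet_eq[OF d[of y]] by (simp add: kinetic_gradient_def)
  have "continuous_on UNIV (\<lambda>y::real \<times> 'a. (y, v))"
    by (intro continuous_on_Pair continuous_on_const continuous_on_id)
  then have "continuous_on UNIV (\<lambda>y. f (y, v))" "continuous_on UNIV (\<lambda>y. kinetic_gradient f y v)"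
    using continuous_on_compose2[OF t(4), of UNIV "\<lambda>y. (y, v)"]
      continuous_on_compose2[OF kinetic_gradient_continuous[OF t(1)], of UNIV "\<lambda>y. (y, v)"]
    by auto
  then have c: "continuous_on UNIV (\<lambda>y. frechet_derivative ?h (at y) (advection v))"
    unfolding fr by (intro continuous_intros t' frechet_derivative_jointly_continuous)
  have "supp ?h \<subseteq> supp \<psi>" unfolding supp_def by (rule closure_mono) auto
  moreover have "closed (supp ?h)" by (simp add: supp_def)
  ultimately have "compact (supp ?h)"
    using t'(2) compact_Int_closed[of "supp \<psi>" "supp ?h"] by (simp add: Int_absorb1)
  then have "(\<integral>y. frechet_derivative ?h (at y) (advection v) \<partial>lborel) = 0"
    using d by (intro transport_integral_zero c) (auto simp: differentiable_def)
  then show ?thesis by (simp add: fr)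
qed
text \<open>Weak and classical derivative are compared by testing: after exchanging the integrals
  over Q and over the sphere, integration by parts holds for each velocity separately. The
  exceptional null set still depends on \<phi>.\<close>

lemma kinetic_derivative_represented:
  assumes Q: "open Q" and q: "q \<in> H1_FP Q" and f: "test_function UNIV f" and rep: "represents Q q f"
  shows "AE y in lebesgue_on Q. blinfun_apply (kinetic_derivative Q q y) \<phi> =
           sphere_functional (kinetic_gradient f y) \<phi>"
proof -
  note t = test_function_facts[OF f] and D = H1_FP_D[OF Q q]
  obtain C where C: "C \<ge> 0" "\<And>y v. \<bar>kinetic_gradient f y v\<bar> \<le> C"
    using kinetic_gradient_bounded[OF f] by metis
  define g where "g = rep_H1_sphere \<phi>"
  have gi: "integrable sphere_measure g"
    using L2_mult_integrable[OF rep_L2[of \<phi>] sphere_one_L2] by (simp add: g_def)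
  have gm: "g \<in> borel_measurable sphere_measure" using gi by auto
  define R where "R y = sphere_functional (kinetic_gradient f y) \<phi>" for y
  have Rm: "R \<in> borel_measurable borel"
    unfolding R_def sphere_functional_def g_def[symmetric]
    by (rule borel_measurable_sphere_integral[OF kinetic_gradient_continuous[OF t(1)] gm])
  note kL = slice_L2[OF kinetic_gradient_continuous[OF t(1)] C(2)]
  have RL: "R \<in> L2_functions (lebesgue_on Q)"
  proof (rule L2_lebesgue_on_compact[OF Q Rm])
    show "compact (fst ` supp f)" by (intro compact_continuous_image continuous_intros t)
    show "\<bar>R y\<bar> \<le> norm \<phi> * sqrt (C\<^sup>2 * (\<integral>v. 1 \<partial>(sphere_measure :: 'a measure)))" for y
      unfolding R_def
      by (rule order_trans[OF sphere_functional_bound[OF kL(1)] mult_left_mono[OF kL(2)]]) simp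
    show "R y = 0" if y: "y \<notin> fst ` supp f" for y
    proof -
      have "kinetic_gradient f y v = 0" for v
        using kinetic_gradient_outside[of "(y, v)" f] y by force
      then show ?thesis by (simp add: R_def sphere_functional_def)
    qed
  qed
  have "AE y in lebesgue_on Q. blinfun_apply (kinetic_derivative Q q y) \<phi> - R y = 0"
  proof (rule fundamental_lemma_open[OF Q])
    show "(\<lambda>y. blinfun_apply (kinetic_derivative Q q y) \<phi> - R y) \<in> L2_functions (lebesgue_on Q)"
      using L2_add[OF blinfun_apply_L2[OF Q D(3), of \<phi>] L2_scale[OF RL, of "-1"]] by simp
    fix \<psi> assume \<psi>: "test_function Q \<psi>"
    note t' = test_function_facts[OF \<psi>]
    define F where "F z = f z * frechet_derivative \<psi> (at (fst z)) (advection (snd z)) +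
        kinetic_gradient f (fst z) (snd z) * \<psi> (fst z)" for z
    define g1 where "g1 y = (\<integral>v. g v * (f (y, v) * frechet_derivative \<psi> (at y) (advection v)) \<partial>sphere_measure)" for y
    have c1: "continuous_on UNIV (\<lambda>z. f (fst z, snd z) * frechet_derivative \<psi> (at (fst z)) (advection (snd z)))"
      using t(4) by (simp add: continuous_on_mult frechet_derivative_jointly_continuous t' continuous_advection
          continuous_on_fst continuous_on_snd continuous_on_id)
    have c2: "continuous_on UNIV (\<lambda>z. kinetic_gradient f (fst z) (snd z) * \<psi> (fst z))"
      by (intro continuous_on_mult kinetic_gradient_continuous t continuous_on_compose2[OF t'(4)]
          continuous_on_fst continuous_on_id subset_UNIV)
    have cF: "continuous_on UNIV F"
      using continuous_on_add[OF c1 c2] by (simp add: F_def[abs_def])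
    have outF: "F z = 0" if "z \<notin> supp f" for z
      using supp_outside[OF that] kinetic_gradient_outside[OF that] by (simp add: F_def)
    have g1m: "g1 \<in> borel_measurable borel"
      unfolding g1_def by (rule borel_measurable_sphere_integral[OF c1 gm])
    have pair: "AE y in lebesgue_on Q. kinetic_pairing \<psi> \<phi> (q y) y = g1 y"
      using rep unfolding represents_def
    proof eventually_elim
      case (elim y)
      have "continuous_on UNIV (\<lambda>v. (y, v))"
        by (intro continuous_on_Pair continuous_on_const continuous_on_id)
      then have "continuous_on UNIV (\<lambda>v. f (y, v) * frechet_derivative \<psi> (at y) (advection v))"
        using continuous_on_compose2[OF c1, of UNIV "\<lambda>v. (y, v)"] by simp
      then have "integrable sphere_measure (\<lambda>v. g v * (f (y, v) * frechet_derivative \<psi> (at y) (advection v)))"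
        by (rule L2_sphere_test_integrable[OF gi])
      moreover have "integrable sphere_measure (\<lambda>v. rep_H1_sphere (q y) v *
          (rep_H1_sphere \<phi> v * frechet_derivative \<psi> (at y) (advection v)))"
        by (rule L2_mult_integrable[OF rep_L2 L2_kinetic_weight(1)[OF \<psi> rep_L2]])
      moreover have "AE v in sphere_measure. rep_H1_sphere (q y) v *
          (rep_H1_sphere \<phi> v * frechet_derivative \<psi> (at y) (advection v)) =
          g v * (f (y, v) * frechet_derivative \<psi> (at y) (advection v))"
        using elim by eventually_elim (simp add: g_def)
      ultimately show ?case
        unfolding kinetic_pairing_def sphere_functional_def g1_def by (intro integral_cong_AE) auto
    qed
    have g1i: "integrable (lebesgue_on Q) g1"
      by (rule integrable_cong_AE_imp[OF kinetic_pairing_integrable[OF Q D(1) \<psi>] lebesgue_on_borel_measurable[OF g1m] pair])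
    have Ri: "integrable (lebesgue_on Q) (\<lambda>y. R y * \<psi> y)"
      by (rule L2_mult_integrable[OF RL test_function_L2[OF Q \<psi>]])
    have "(\<integral>y. kinetic_pairing \<psi> \<phi> (q y) y \<partial>lebesgue_on Q) = (\<integral>y. g1 y \<partial>lebesgue_on Q)"
      using kinetic_pairing_integrable[OF Q D(1) \<psi>] g1i pair by (intro integral_cong_AE) auto
    then have kd: "(\<integral>y. blinfun_apply (kinetic_derivative Q q y) \<phi> * \<psi> y \<partial>lebesgue_on Q) = - (\<integral>y. g1 y \<partial>lebesgue_on Q)"
      using D(2) \<psi> unfolding weak_kinetic_derivative_iff by simp
    have sum: "g1 y + R y * \<psi> y = (\<integral>v. g v * F (y, v) \<partial>sphere_measure)" for y
    proof -
      have "continuous_on UNIV (\<lambda>v. (y, v))"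
        by (intro continuous_on_Pair continuous_on_const continuous_on_id)
      then have c: "continuous_on UNIV (\<lambda>v. f (y, v) * frechet_derivative \<psi> (at y) (advection v))"
        "continuous_on UNIV (\<lambda>v. kinetic_gradient f y v * \<psi> y)"
        using continuous_on_compose2[OF c1, of UNIV "\<lambda>v. (y, v)"] continuous_on_compose2[OF c2, of UNIV "\<lambda>v. (y, v)"]
        by simp_all
      have "R y * \<psi> y = (\<integral>v. g v * (kinetic_gradient f y v * \<psi> y) \<partial>sphere_measure)"
        by (simp add: R_def sphere_functional_def g_def mult.assoc[symmetric])
      then show ?thesis
        using L2_sphere_test_integrable[OF gi c(1)] L2_sphere_test_integrable[OF gi c(2)]
        by (simp add: g1_def F_def distrib_left)
    qed
    \<comment> \<open>Outside Q the test function and its derivative vanish, so the integral over Q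
      is one over the whole space, where no boundary term arises.\<close>
    have zero: "indicator Q y * (g1 y + R y * \<psi> y) = g1 y + R y * \<psi> y" for y
    proof (cases "y \<in> Q")
      case False
      then have "y \<notin> supp \<psi>" using t'(3) by blast
      then show ?thesis
        using False supp_outside[of y \<psi>] by (simp add: g1_def frechet_derivative_outside_supp)
    qed simp
    obtain B where B: "\<And>z. \<bar>F z\<bar> \<le> B"
      using continuous_zero_outside_compact_bounded[OF cF t(2) outF] by metis
    have "(\<integral>y. g1 y \<partial>lebesgue_on Q) + (\<integral>y. R y * \<psi> y \<partial>lebesgue_on Q) =
        (\<integral>y. g1 y + R y * \<psi> y \<partial>lebesgue_on Q)"
      using g1i Ri by simp
    also have "\<dots> = (\<integral>y. g1 y + R y * \<psi> y \<partial>lborel)"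
      using lebesgue_on_integral_borel[OF Q, of "\<lambda>y. g1 y + R y * \<psi> y"] g1m Rm
        borel_measurable_continuous_onI[OF t'(4)] by (simp add: zero)
    also have "\<dots> = (\<integral>y. (\<integral>v. g v * F (y, v) \<partial>sphere_measure) \<partial>lborel)" by (simp only: sum)
    also have "\<dots> = (\<integral>v. g v * (\<integral>y. F (y, v) \<partial>lborel) \<partial>sphere_measure)"
      by (rule sphere_Fubini[OF borel_measurable_continuous_onI[OF cF] B t(2) outF gi])
    also have "\<dots> = 0"
      using kinetic_integration_by_parts[OF f \<psi>] by (simp add: F_def)
    finally show "(\<integral>y. (blinfun_apply (kinetic_derivative Q q y) \<phi> - R y) * \<psi> y \<partial>lebesgue_on Q) = 0"
      using kd Ri blinfun_test_integrable[OF Q D(3) \<psi>, of \<phi>] by (simp add: left_diff_distrib)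
  qed
  then show ?thesis by eventually_elim (simp add: R_def)
qed

text \<open>The pairing of the derivative with q itself becomes the integral of f k . \<nabla>f,
  which is half of k . \<nabla>(f^2); for each unit velocity
  \<open>transport_integral_nonpos\<close> applies to f(., v)^2.\<close>

lemma kinetic_energy_nonpos_smooth:
  fixes \<Omega> :: "'a::euclidean_space set"
  assumes dim: "DIM('a) = 2 \<or> DIM('a) = 3" and \<Omega>: "open \<Omega>" "piecewise_C1_boundary \<Omega>" and T: "T > 0"
    and Q: "Q = {0<..<T} \<times> \<Omega>" and q: "q \<in> H1_FP Q"
    and f: "smooth_vanishing_on_outflow Q f" and rep: "represents Q q f"
  shows "(\<integral>y. blinfun_apply (kinetic_derivative Q q y) (q y) \<partial>lebesgue_on Q) \<le> 0"
proof -
  have oQ: "open Q" unfolding Q using \<Omega>(1) by (simp add: open_Times)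
  have ft: "test_function UNIV f" and fz: "\<And>z. z \<in> outflow Q \<Longrightarrow> f z = 0"
    using f by (auto simp: smooth_vanishing_on_outflow_def)
  note t = test_function_facts[OF ft] and D = H1_FP_D[OF oQ q]
  obtain C where C: "C \<ge> 0" "\<And>y v. \<bar>kinetic_gradient f y v\<bar> \<le> C"
    using kinetic_gradient_bounded[OF ft] by metis
  note kL = slice_L2[OF kinetic_gradient_continuous[OF t(1)] C(2)]
  define G where "G z = f z * kinetic_gradient f (fst z) (snd z)" for z
  have cG: "continuous_on UNIV G"
    unfolding G_def by (intro continuous_on_mult t kinetic_gradient_continuous)
  have outG: "G z = 0" if "z \<notin> supp f" for z using supp_outside[OF that] by (simp add: G_def)
  obtain B where B: "B \<ge> 0" "\<And>z. \<bar>G z\<bar> \<le> B"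
    using continuous_zero_outside_compact_bounded[OF cG t(2) outG] by metis
  have "strongly_measurable (lebesgue_on Q) q" using D(1) by (simp add: bochner_L2_def)
  then obtain s where s: "\<forall>n::nat. simple_function (lebesgue_on Q) (s n)"
      "AE y in lebesgue_on Q. (\<lambda>n. s n y) \<longlonglongrightarrow> q y"
    by (rule strongly_measurableE) (rule that)
  \<comment> \<open>The formula for the derivative is available for one fixed \<phi> at a time, but
    q(y) varies with y. It holds simultaneously for the countably many values of the approximating
    simple functions and passes to their limit q(y).\<close>
  define V where "V = (\<Union>n. s n ` space (lebesgue_on Q))"
  have "countable V"
    unfolding V_def using simple_functionD(1)[OF s(1)[rule_format]] by (simp add: countable_finite)
  then have "AE y in lebesgue_on Q. \<forall>\<phi>\<in>V. blinfun_apply (kinetic_derivative Q q y) \<phi> =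
           sphere_functional (kinetic_gradient f y) \<phi>"
    using kinetic_derivative_represented[OF oQ q ft rep] by (simp add: AE_ball_countable)
  then have "AE y in lebesgue_on Q. blinfun_apply (kinetic_derivative Q q y) (q y) =
           (\<integral>v. 1 * G (y, v) \<partial>sphere_measure)"
    using s(2) rep[unfolded represents_def] AE_space[of "lebesgue_on Q"]
  proof eventually_elim
    case (elim y)
    have "(\<lambda>n. blinfun_apply (kinetic_derivative Q q y) (s n y)) \<longlonglongrightarrow> blinfun_apply (kinetic_derivative Q q y) (q y)"
      by (intro tendsto_intros elim(2))
    moreover have "(\<lambda>n. sphere_functional (kinetic_gradient f y) (s n y)) \<longlonglongrightarrow>
        sphere_functional (kinetic_gradient f y) (q y)"
      by (rule sphere_functional_tendsto[OF kL(1) elim(2)])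
    moreover have "blinfun_apply (kinetic_derivative Q q y) (s n y) =
        sphere_functional (kinetic_gradient f y) (s n y)" for n
      using elim(1,4) by (auto simp: V_def)
    ultimately have "blinfun_apply (kinetic_derivative Q q y) (q y) = sphere_functional (kinetic_gradient f y) (q y)"
      using LIMSEQ_unique by (simp only:)
    also have "\<dots> = (\<integral>v. 1 * G (y, v) \<partial>sphere_measure)"
      unfolding sphere_functional_def
    proof (rule integral_cong_AE)
      show "AE v in sphere_measure. rep_H1_sphere (q y) v * kinetic_gradient f y v = 1 * G (y, v)"
        using elim(3) by eventually_elim (simp add: G_def)
      show "(\<lambda>v. rep_H1_sphere (q y) v * kinetic_gradient f y v) \<in> borel_measurable sphere_measure"
        using L2_mult_integrable[OF rep_L2 kL(1)] by auto
      have "continuous_on UNIV (\<lambda>v. (y, v))"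
        by (intro continuous_on_Pair continuous_on_const continuous_on_id)
      then have "continuous_on UNIV (\<lambda>v. G (y, v))"
        using continuous_on_compose2[OF cG, of UNIV "\<lambda>v. (y, v)"] by simp
      then have "(\<lambda>v. G (y, v)) \<in> borel_measurable borel" by (rule borel_measurable_continuous_onI)
      then show "(\<lambda>v. 1 * G (y, v)) \<in> borel_measurable sphere_measure" by simp
    qed
    finally show ?case .
  qed
  moreover have m: "(\<lambda>y. \<integral>v. 1 * G (y, v) \<partial>sphere_measure) \<in> borel_measurable borel"
    using cG by (intro borel_measurable_sphere_integral) auto
  ultimately have "(\<integral>y. blinfun_apply (kinetic_derivative Q q y) (q y) \<partial>lebesgue_on Q) =
      (\<integral>y. (\<integral>v. 1 * G (y, v) \<partial>sphere_measure) \<partial>lebesgue_on Q)"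
    using blinfun_pairing_measurable[OF complete_Q[OF oQ] D(3,1)] lebesgue_on_borel_measurable[OF m]
    by (intro integral_cong_AE)
  also have "\<dots> = (\<integral>y. indicator Q y * (\<integral>v. 1 * G (y, v) \<partial>sphere_measure) \<partial>lborel)"
    by (rule lebesgue_on_integral_borel[OF oQ m])
  also have "\<dots> = (\<integral>y. (\<integral>v. 1 * (indicator Q (fst (y, v)) * G (y, v)) \<partial>sphere_measure) \<partial>lborel)"
    by simp
  also have "\<dots> = (\<integral>v. 1 * (\<integral>y. indicator Q (fst (y, v)) * G (y, v) \<partial>lborel) \<partial>sphere_measure)"
  proof (rule sphere_Fubini)
    show "(\<lambda>z. indicator Q (fst z) * G z) \<in> borel_measurable borel"
    proof (intro borel_measurable_times borel_measurable_continuous_onI[OF cG])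
      have "(indicator Q :: _ \<Rightarrow> real) \<in> borel_measurable borel" using oQ by simp
      then show "(\<lambda>z. indicator Q (fst z) :: real) \<in> borel_measurable borel"
        by (rule measurable_compose[rotated]) (intro borel_measurable_continuous_onI continuous_intros)
    qed
    show "\<bar>indicator Q (fst z) * G z\<bar> \<le> B" for z using B by (auto simp: indicator_def)
    show "indicator Q (fst z) * G z = 0" if "z \<notin> supp f" for z using outG[OF that] by simp
    show "integrable sphere_measure (\<lambda>v. 1 :: real)"
      using sphere_one_L2 by (simp add: L2_functions_def)
  qed (rule t)
  also have "\<dots> \<le> 0"
  proof -
    have "AE v in sphere_measure. (\<integral>y. indicator Q y * G (y, v) \<partial>lborel) \<le> 0"
      using AE_sphere_measure
    proof eventually_elim
      case (elim v)
      \<comment> \<open>The square is nonnegative, vanishes wherever f does, and has advection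
        derivative 2 G.\<close>
      let ?h = "\<lambda>y. f (y, v) * f (y, v)"
      have d: "(?h has_derivative (\<lambda>k. f (y, v) * frechet_derivative f (at (y, v)) (k, 0) +
          frechet_derivative f (at (y, v)) (k, 0) * f (y, v))) (at y)" for y
        by (rule has_derivative_mult[OF slice_derivative[OF ft] slice_derivative[OF ft]])
      have fr: "frechet_derivative ?h (at y) (advection v) = 2 * G (y, v)" for y
        using frechet_eq[OF d[of y]] by (simp add: kinetic_gradient_def G_def)
      have "continuous_on UNIV (\<lambda>y. (y, v))"
        by (intro continuous_on_Pair continuous_on_const continuous_on_id)
      then have c: "continuous_on UNIV (\<lambda>y. 2 * G (y, v))"
        using continuous_on_compose2[OF cG, of UNIV "\<lambda>y. (y, v)"] by (intro continuous_on_mult_left) simp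
      have i: "integrable lborel (\<lambda>y. 2 * G (y, v))"
      proof (rule integrable_continuous_compact_support[OF c])
        show "compact (fst ` supp f)" by (intro compact_continuous_image continuous_intros t)
        show "2 * G (y, v) = 0" if "y \<notin> fst ` supp f" for y
          using outG[of "(y, v)"] that by force
      qed
      have "(\<integral>y. indicator Q y * frechet_derivative ?h (at y) (advection v) \<partial>lborel) \<le> 0"
      proof (rule transport_integral_nonpos[OF dim \<Omega> T Q elim])
        show "?h differentiable (at y)" for y unfolding differentiable_def by (rule exI, rule d)
        show "?h y = 0" if "(y, v) \<in> outflow Q" for y using fz[OF that] by simp
      qed (use c i in \<open>simp_all only: fr zero_le_square\<close>)
      then have "(\<integral>y. 2 * (indicator Q y * G (y, v)) \<partial>lborel) \<le> 0"
        by (simp only: fr mult.left_commute)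
      then show ?case by simp
    qed
    then have "0 \<le> (\<integral>v. - (\<integral>y. indicator Q y * G (y, v) \<partial>lborel) \<partial>sphere_measure)"
      by (intro integral_nonneg_AE) (auto elim: eventually_mono)
    then show ?thesis by simp
  qed
  finally show ?thesis .
qed

text \<open>The energy is a bounded quadratic functional in the graph norm. Replacing p by a smooth
  approximation q = p - w costs three terms, each of order |w|.\<close>

lemma kinetic_energy_nonpos:
  fixes \<Omega> :: "'a::euclidean_space set"
  assumes dim: "DIM('a) = 2 \<or> DIM('a) = 3" and \<Omega>: "open \<Omega>" "piecewise_C1_boundary \<Omega>" and T: "T > 0"
    and Q: "Q = {0<..<T} \<times> \<Omega>" and p: "p \<in> H1_FP_outflow Q"
  shows "(\<integral>y. blinfun_apply (kinetic_derivative Q p y) (p y) \<partial>lebesgue_on Q) \<le> 0"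
proof (rule field_le_epsilon)
  have oQ: "open Q" unfolding Q using \<Omega>(1) by (simp add: open_Times)
  note cQ = complete_Q[OF oQ]
  have pH: "p \<in> H1_FP Q" using p by (simp add: H1_FP_outflow_def)
  note Dp = H1_FP_D[OF oQ pH]
  let ?M = "lebesgue_on Q"
  fix e :: real assume e: "e > 0"
  \<comment> \<open>The sum of the factors of d in the three error terms; the 1 belongs to the term
    quadratic in w, where one factor d <= 1 is dropped.\<close>
  define S where "S = bochner_norm ?M (kinetic_derivative Q p) + bochner_norm ?M p + 1"
  have S: "S \<ge> 1" by (simp add: S_def bochner_norm_nonneg)
  define d where "d = min 1 (e / S)"
  have d: "d > 0" "d \<le> 1" "d * S \<le> e" using S e by (auto simp: d_def min_def field_simps)
  obtain f q where q: "smooth_vanishing_on_outflow Q f" "q \<in> H1_FP Q" "represents Q q f"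
      "H1_FP_norm Q (\<lambda>y. p y - q y) < d"
    using p d(1) unfolding H1_FP_outflow_def by blast
  note Dq = H1_FP_D[OF oQ q(2)]
  define w where "w = (\<lambda>y. p y - q y)"
  have wH: "w \<in> H1_FP Q" unfolding w_def by (rule H1_FP_diff[OF oQ pH q(2)])
  note Dw = H1_FP_D[OF oQ wH]
  have wn: "bochner_norm ?M w \<le> d" "bochner_norm ?M (kinetic_derivative Q w) \<le> d"
  proof -
    have le: "sqrt ((bochner_norm ?M w)\<^sup>2 + (bochner_norm ?M (kinetic_derivative Q w))\<^sup>2) \<le> d"
      using q(4) by (simp add: H1_FP_norm_def w_def)
    show "bochner_norm ?M w \<le> d"
      by (rule order_trans[OF real_sqrt_sum_squares_ge1 le])
    show "bochner_norm ?M (kinetic_derivative Q w) \<le> d"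
      by (rule order_trans[OF real_sqrt_sum_squares_ge2 le])
  qed
  let ?P = "\<lambda>r u. (\<integral>y. blinfun_apply (r y) (u y) \<partial>?M)"
  have ae: "AE y in ?M. blinfun_apply (kinetic_derivative Q q y) (q y) =
      blinfun_apply (kinetic_derivative Q p y) (p y) - blinfun_apply (kinetic_derivative Q p y) (w y)
      - blinfun_apply (kinetic_derivative Q w y) (p y) + blinfun_apply (kinetic_derivative Q w y) (w y)"
    using kinetic_derivative_diff[OF oQ pH q(2)]
    by eventually_elim (simp add: w_def blinfun.diff_left blinfun.diff_right)
  note int = blinfun_pairing_integrable[OF cQ]
  have "?P (kinetic_derivative Q q) q = (\<integral>y. blinfun_apply (kinetic_derivative Q p y) (p y)
      - blinfun_apply (kinetic_derivative Q p y) (w y)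
      - blinfun_apply (kinetic_derivative Q w y) (p y) + blinfun_apply (kinetic_derivative Q w y) (w y) \<partial>?M)"
    using ae int[OF Dq(3,1)] int[OF Dp(3,1)] int[OF Dp(3) Dw(1)] int[OF Dw(3) Dp(1)] int[OF Dw(3,1)]
    by (intro integral_cong_AE) auto
  also have "\<dots> = ?P (kinetic_derivative Q p) p - ?P (kinetic_derivative Q p) w
      - ?P (kinetic_derivative Q w) p + ?P (kinetic_derivative Q w) w"
    using int[OF Dp(3,1)] int[OF Dp(3) Dw(1)] int[OF Dw(3) Dp(1)] int[OF Dw(3,1)] by simp
  finally have eq: "?P (kinetic_derivative Q p) p = ?P (kinetic_derivative Q q) q + ?P (kinetic_derivative Q p) w
      + ?P (kinetic_derivative Q w) p - ?P (kinetic_derivative Q w) w" by simp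
  note bd = blinfun_pairing_bound[OF cQ]
  have "?P (kinetic_derivative Q q) q \<le> 0"
    by (rule kinetic_energy_nonpos_smooth[OF dim \<Omega> T Q q(2,1,3)])
  moreover have "\<bar>?P (kinetic_derivative Q p) w\<bar> \<le> bochner_norm ?M (kinetic_derivative Q p) * d"
    by (rule order_trans[OF bd[OF Dp(3) Dw(1)] mult_left_mono[OF wn(1) bochner_norm_nonneg]])
  moreover have "\<bar>?P (kinetic_derivative Q w) p\<bar> \<le> d * bochner_norm ?M p"
    by (rule order_trans[OF bd[OF Dw(3) Dp(1)] mult_right_mono[OF wn(2) bochner_norm_nonneg]])
  moreover have "\<bar>?P (kinetic_derivative Q w) w\<bar> \<le> d * 1"
    by (rule order_trans[OF bd[OF Dw(3,1)] mult_mono[OF wn(2)]]) (use wn(1) d bochner_norm_nonneg in auto)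
  ultimately have "?P (kinetic_derivative Q p) p \<le> d * S"
    unfolding eq S_def by (simp add: algebra_simps abs_le_iff)
  then show "?P (kinetic_derivative Q p) p \<le> 0 + e" using d(3) by simp
qed

section \<open>Positive definite systems\<close>

lemma sum_insert_split:
  fixes c :: "'i \<Rightarrow> real"
  assumes "finite I" "k \<notin> I"
  shows "(\<Sum>j\<in>insert k I. c j * (\<Sum>i\<in>insert k I. A i j * c i)) =
    c k * ((\<Sum>i\<in>I. A i k * c i) + A k k * c k) + (\<Sum>j\<in>I. c j * ((\<Sum>i\<in>I. A i j * c i) + A k j * c k))"
  using assms by (simp add: add.commute)

text \<open>
  Gaussian elimination without pivoting: every Schur complement of a positive definite (not
  necessarily symmetric) matrix is again positive definite, and all operations preserve
  measurability of the entries in the parameter \<open>y\<close>.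
\<close>

lemma measurable_positive_definite_system:
  fixes A :: "'i \<Rightarrow> 'i \<Rightarrow> 'y \<Rightarrow> real" and F :: "'i \<Rightarrow> 'y \<Rightarrow> real"
  assumes "finite I"
    and "\<And>i j. i \<in> I \<Longrightarrow> j \<in> I \<Longrightarrow> A i j \<in> borel_measurable M"
    and "\<And>j. j \<in> I \<Longrightarrow> F j \<in> borel_measurable M"
  shows "\<exists>x. (\<forall>i\<in>I. x i \<in> borel_measurable M) \<and>
    (\<forall>y. (\<forall>c. (\<exists>i\<in>I. c i \<noteq> 0) \<longrightarrow> (\<Sum>j\<in>I. c j * (\<Sum>i\<in>I. A i j y * c i)) > 0) \<longrightarrow>
         (\<forall>j\<in>I. (\<Sum>i\<in>I. A i j y * x i y) = F j y))"
  using assms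
proof (induction I arbitrary: A F rule: finite_induct)
  case empty
  then show ?case by simp
next
  case (insert k I)
  \<comment> \<open>Where the pivot vanishes, division returns 0: the functions stay measurable, and
    a solution is claimed only at points y with a positive definite matrix.\<close>
  define A' where "A' i j y = A i j y - A k j y * A i k y / A k k y" for i j y
  define F' where "F' j y = F j y - A k j y * F k y / A k k y" for j y
  have Am [measurable]: "A i j \<in> borel_measurable M" if "i \<in> insert k I" "j \<in> insert k I" for i j
    using insert.prems(1) that .
  have Fm: "F j \<in> borel_measurable M" if "j \<in> insert k I" for j using insert.prems(2) that .
  have "\<exists>x. (\<forall>i\<in>I. x i \<in> borel_measurable M) \<and>
    (\<forall>y. (\<forall>c. (\<exists>i\<in>I. c i \<noteq> 0) \<longrightarrow> (\<Sum>j\<in>I. c j * (\<Sum>i\<in>I. A' i j y * c i)) > 0) \<longrightarrow>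
         (\<forall>j\<in>I. (\<Sum>i\<in>I. A' i j y * x i y) = F' j y))"
  proof (rule insert.IH)
    show "A' i j \<in> borel_measurable M" if "i \<in> I" "j \<in> I" for i j
      unfolding A'_def[abs_def] using that
      by (intro borel_measurable_diff borel_measurable_divide borel_measurable_times Am) auto
    show "F' j \<in> borel_measurable M" if "j \<in> I" for j
      unfolding F'_def[abs_def] using that
      by (intro borel_measurable_diff borel_measurable_divide borel_measurable_times Am Fm) auto
  qed
  then obtain x where xm: "\<forall>i\<in>I. x i \<in> borel_measurable M"
    and xs: "\<And>y. (\<forall>c. (\<exists>i\<in>I. c i \<noteq> 0) \<longrightarrow> (\<Sum>j\<in>I. c j * (\<Sum>i\<in>I. A' i j y * c i)) > 0) \<Longrightarrow>
         (\<forall>j\<in>I. (\<Sum>i\<in>I. A' i j y * x i y) = F' j y)"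
    by blast
  define x' where "x' i = (if i = k then (\<lambda>y. (F k y - (\<Sum>i\<in>I. A i k y * x i y)) / A k k y) else x i)" for i
  have xk: "x' i = x i" if "i \<in> I" for i using insert.hyps(2) that by (auto simp: x'_def)
  show ?case
  proof (intro exI[of _ x'] conjI ballI allI impI)
    show "x' i \<in> borel_measurable M" if "i \<in> insert k I" for i
    proof (cases "i = k")
      case True
      then show ?thesis
        unfolding x'_def using xm
        by (auto intro!: borel_measurable_diff borel_measurable_divide borel_measurable_times
            borel_measurable_sum Am Fm)
    next
      case False
      then show ?thesis using xm that by (auto simp: x'_def)
    qed
    fix y j
    assume pd: "\<forall>c. (\<exists>i\<in>insert k I. c i \<noteq> 0) \<longrightarrow>
        0 < (\<Sum>j\<in>insert k I. c j * (\<Sum>i\<in>insert k I. A i j y * c i))"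
      and j: "j \<in> insert k I"
    \<comment> \<open>Testing definiteness with the k-th unit vector isolates the pivot.\<close>
    have Akk: "A k k y > 0"
    proof -
      have "0 < (\<Sum>j\<in>insert k I. (if j = k then 1 else 0) * (\<Sum>i\<in>insert k I. A i j y * (if i = k then 1 else 0)))"
        using pd[rule_format, of "\<lambda>i. if i = k then 1 else 0"] by auto
      also have "\<dots> = A k k y"
      proof -
        have "(\<Sum>i\<in>I. A i k y * (if i = k then 1 else 0)) = 0"
          "(\<Sum>j\<in>I. (if j = k then 1 else 0) * r j) = (0::real)" for r
          using insert.hyps(2) by (auto intro!: sum.neutral)
        then show ?thesis
          unfolding sum_insert_split[OF insert.hyps(1,2), of "\<lambda>i. if i = k then 1 else 0" "\<lambda>i j. A i j y"]
          by simp
      qed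
      finally show ?thesis .
    qed
    have schur: "(\<Sum>i\<in>I. A i j y * c i) + A k j y * ((e - (\<Sum>i\<in>I. A i k y * c i)) / A k k y) =
        (\<Sum>i\<in>I. A' i j y * c i) + A k j y * e / A k k y" for c :: "'i \<Rightarrow> real" and e j
    proof -
      have "A' i j y * c i = A i j y * c i - A k j y / A k k y * (A i k y * c i)" for i
        by (simp add: A'_def left_diff_distrib)
      then have "(\<Sum>i\<in>I. A' i j y * c i) = (\<Sum>i\<in>I. A i j y * c i) - A k j y / A k k y * (\<Sum>i\<in>I. A i k y * c i)"
        by (simp add: sum_subtractf sum_distrib_left)
      then show ?thesis by (simp add: right_diff_distrib diff_divide_distrib)
    qed
    have sol: "\<forall>j\<in>I. (\<Sum>i\<in>I. A' i j y * x i y) = F' j y"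
    proof (rule xs, intro allI impI)
      fix c :: "'i \<Rightarrow> real" assume c: "\<exists>i\<in>I. c i \<noteq> 0"
      \<comment> \<open>The k-th coordinate is chosen so that equation k becomes homogeneous; the
        quadratic form at \<open>c'\<close> then equals that of the Schur complement at c.\<close>
      define c' where "c' i = (if i = k then (0 - (\<Sum>i\<in>I. A i k y * c i)) / A k k y else c i)" for i
      have c'I: "c' i = c i" if "i \<in> I" for i using that insert.hyps(2) by (auto simp: c'_def)
      have c'k: "c' k = (0 - (\<Sum>i\<in>I. A i k y * c i)) / A k k y" by (simp add: c'_def)
      have "\<exists>i\<in>insert k I. c' i \<noteq> 0" using c c'I by auto
      then have "0 < (\<Sum>j\<in>insert k I. c' j * (\<Sum>i\<in>insert k I. A i j y * c' i))"
        using pd by blast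
      also have "\<dots> = c' k * ((\<Sum>i\<in>I. A i k y * c' i) + A k k y * c' k) +
          (\<Sum>j\<in>I. c' j * ((\<Sum>i\<in>I. A i j y * c' i) + A k j y * c' k))"
        by (rule sum_insert_split[OF insert.hyps(1,2)])
      also have "(\<Sum>i\<in>I. A i k y * c' i) + A k k y * c' k = 0"
        using Akk by (simp add: c'k c'I cong: sum.cong)
      also have "(\<Sum>j\<in>I. c' j * ((\<Sum>i\<in>I. A i j y * c' i) + A k j y * c' k)) =
          (\<Sum>j\<in>I. c j * (\<Sum>i\<in>I. A' i j y * c i))"
        unfolding c'k using schur[where c=c and e=0] by (simp add: c'I cong: sum.cong)
      finally show "0 < (\<Sum>j\<in>I. c j * (\<Sum>i\<in>I. A' i j y * c i))" by simp
    qed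
    have x'k: "x' k y = (F k y - (\<Sum>i\<in>I. A i k y * x i y)) / A k k y" by (simp add: x'_def)
    have split: "(\<Sum>i\<in>insert k I. A i j y * x' i y) = (\<Sum>i\<in>I. A i j y * x i y) + A k j y * x' k y"
      using insert.hyps xk by (simp add: add.commute cong: sum.cong)
    show "(\<Sum>i\<in>insert k I. A i j y * x' i y) = F j y"
    proof (cases "j = k")
      case True
      then show ?thesis unfolding split x'k using Akk by simp
    next
      case False
      then have "j \<in> I" using j by simp
      then have "(\<Sum>i\<in>I. A' i j y * x i y) = F' j y" using sol by blast
      then show ?thesis unfolding split x'k schur by (simp add: F'_def)
    qed
  qed
qed

text \<open>A constant matrix is a measurable family over a one-point parameter space.\<close>

corollary positive_definite_system:
  fixes A :: "'i \<Rightarrow> 'i \<Rightarrow> real"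
  assumes "finite I" and "\<And>c. \<exists>i\<in>I. c i \<noteq> 0 \<Longrightarrow> (\<Sum>j\<in>I. c j * (\<Sum>i\<in>I. A i j * c i)) > 0"
  obtains x where "\<And>j. j \<in> I \<Longrightarrow> (\<Sum>i\<in>I. A i j * x i) = F j"
proof -
  have "\<exists>x. (\<forall>i\<in>I. x i \<in> borel_measurable (count_space (UNIV :: unit set))) \<and>
    (\<forall>y. (\<forall>c. (\<exists>i\<in>I. c i \<noteq> 0) \<longrightarrow> (\<Sum>j\<in>I. c j * (\<Sum>i\<in>I. A i j * c i)) > 0) \<longrightarrow>
         (\<forall>j\<in>I. (\<Sum>i\<in>I. A i j * x i y) = F j))"
    by (rule measurable_positive_definite_system[OF assms(1)]) simp_all
  then obtain x where x: "\<forall>y::unit. (\<forall>c. (\<exists>i\<in>I. c i \<noteq> 0) \<longrightarrow> (\<Sum>j\<in>I. c j * (\<Sum>i\<in>I. A i j * c i)) > 0) \<longrightarrow>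
         (\<forall>j\<in>I. (\<Sum>i\<in>I. A i j * x i y) = F j)"
    by (elim exE conjE) (rule that)
  have "\<forall>j\<in>I. (\<Sum>i\<in>I. A i j * x i ()) = F j"
    by (rule mp[OF spec[OF x]]) (use assms(2) in blast)
  then show thesis by (intro that[of "\<lambda>i. x i ()"]) blast
qed

text \<open>With an orthonormal basis the coordinates are the inner products x . e, continuous in x
  and hence measurable along strongly measurable functions.\<close>

lemma orthonormal_basis_of_span:
  fixes B :: "'a::real_inner set"
  assumes "finite B"
  obtains E where "finite E" "span E = span B" "pairwise orthogonal E" "\<And>e. e \<in> E \<Longrightarrow> norm e = 1"
proof -
  obtain C where C: "finite C" "span C = span B" "pairwise orthogonal C"
    using basis_orthogonal[OF assms] by blast
  define E where "E = (\<lambda>c. c /\<^sub>R norm c) ` (C - {0})"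
  show thesis
  proof (rule that)
    show "finite E" using C(1) by (simp add: E_def)
    show "norm e = 1" if "e \<in> E" for e
    proof -
      obtain c where "e = c /\<^sub>R norm c" "c \<noteq> 0" using \<open>e \<in> E\<close> by (auto simp: E_def)
      then show ?thesis by simp
    qed
    show "pairwise orthogonal E"
      using C(3) by (auto simp: E_def pairwise_def orthogonal_def)
    have "E \<subseteq> span C" unfolding E_def by (auto intro: span_scale span_base)
    moreover have "C \<subseteq> span E"
    proof
      fix c assume c: "c \<in> C"
      show "c \<in> span E"
      proof (cases "c = 0")
        case False
        then have "norm c *\<^sub>R (c /\<^sub>R norm c) \<in> span E"
          using c by (intro span_scale span_base) (auto simp: E_def)
        then show ?thesis using False by simp
      qed (simp add: span_zero)
    qed
    ultimately show "span E = span B" using C(2) span_eq by blast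
  qed
qed

section \<open>The discrete problem\<close>

lemma bochner_norm_eq_0_iff:
  assumes "p \<in> bochner_L2 M"
  shows "bochner_norm M p = 0 \<longleftrightarrow> (AE y in M. p y = 0)"
proof -
  have "integrable M (\<lambda>y. (norm (p y))\<^sup>2)" using assms by (simp add: bochner_L2_def)
  then have "(\<integral>y. (norm (p y))\<^sup>2 \<partial>M) = 0 \<longleftrightarrow> (AE y in M. (norm (p y))\<^sup>2 = 0)"
    by (intro integral_nonneg_eq_0_iff_AE) auto
  then show ?thesis by (simp add: bochner_norm_def)
qed

lemma finite_dim_function_space_sum:
  assumes W: "finite_dim_function_space M W" and "finite B" "B \<subseteq> W"
  shows "(\<lambda>x. \<Sum>b\<in>B. c b *\<^sub>R b x) \<in> W"
  using assms(2,3)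
proof (induction B rule: finite_induct)
  case empty
  then show ?case using W by (simp add: finite_dim_function_space_def)
next
  case (insert k B)
  then have "(\<lambda>x. c k *\<^sub>R k x) \<in> W" "(\<lambda>x. \<Sum>b\<in>B. c b *\<^sub>R b x) \<in> W"
    using W by (simp_all add: finite_dim_function_space_def)
  then have "(\<lambda>x. c k *\<^sub>R k x + (\<Sum>b\<in>B. c b *\<^sub>R b x)) \<in> W"
    using W by (simp add: finite_dim_function_space_def)
  then show ?case using insert.hyps by simp
qed

text \<open>A generating family of least cardinality is independent modulo null sets, since a
  nontrivial relation would allow one member to be dropped.\<close>

lemma finite_dim_function_space_basis:
  fixes W :: "('a \<Rightarrow> 'b::real_vector) set"
  assumes W: "finite_dim_function_space M W"
  obtains B where "B \<subseteq> W" "finite B" "\<And>p. p \<in> W \<Longrightarrow> \<exists>c. AE x in M. p x = (\<Sum>b\<in>B. c b *\<^sub>R b x)"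
    "\<And>c. AE x in M. (\<Sum>b\<in>B. c b *\<^sub>R b x) = 0 \<Longrightarrow> \<forall>b\<in>B. c b = 0"
proof -
  define P where "P B \<longleftrightarrow> B \<subseteq> W \<and> finite B \<and> (\<forall>p\<in>W. \<exists>c. AE x in M. p x = (\<Sum>b\<in>B. c b *\<^sub>R b x))" for B
  obtain B0 where "P B0" using W by (auto simp: finite_dim_function_space_def P_def)
  then obtain B where B: "P B" and min: "\<And>B'. P B' \<Longrightarrow> card B \<le> card B'"
    using ex_has_least_nat[of P B0 card] by blast
  have fin: "finite B" using B by (simp add: P_def)
  show thesis
  proof (rule that)
    fix c assume c: "AE x in M. (\<Sum>b\<in>B. c b *\<^sub>R b x) = 0"
    show "\<forall>b\<in>B. c b = 0"
    proof (rule ccontr)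
      assume "\<not> (\<forall>b\<in>B. c b = 0)"
      then obtain k where k: "k \<in> B" "c k \<noteq> 0" by blast
      have "P (B - {k})"
        unfolding P_def
      proof (intro conjI ballI)
        fix p assume "p \<in> W"
        then obtain d where d: "AE x in M. p x = (\<Sum>b\<in>B. d b *\<^sub>R b x)" using B by (auto simp: P_def)
        show "\<exists>c. AE x in M. p x = (\<Sum>b\<in>B - {k}. c b *\<^sub>R b x)"
        proof (intro exI)
          \<comment> \<open>Subtracting d k / c k times the relation cancels the k-th
            coefficient.\<close>
          show "AE x in M. p x = (\<Sum>b\<in>B - {k}. (d b - d k / c k * c b) *\<^sub>R b x)"
            using d c
          proof eventually_elim
            case (elim x)
            have "c k *\<^sub>R k x = - (\<Sum>b\<in>B - {k}. c b *\<^sub>R b x)"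
              using elim(2) sum.remove[OF fin k(1), of "\<lambda>b. c b *\<^sub>R b x"] by (simp add: eq_neg_iff_add_eq_0)
            then have "(d k / c k) *\<^sub>R (c k *\<^sub>R k x) = - (\<Sum>b\<in>B - {k}. (d k / c k * c b) *\<^sub>R b x)"
              by (simp only: scaleR_minus_right scaleR_sum_right scaleR_scaleR)
            then have "d k *\<^sub>R k x = - (\<Sum>b\<in>B - {k}. (d k / c k * c b) *\<^sub>R b x)" using k(2) by simp
            then show ?case
              using elim(1) sum.remove[OF fin k(1), of "\<lambda>b. d b *\<^sub>R b x"]
              by (simp add: scaleR_left_diff_distrib sum_subtractf)
          qed
        qed
      qed (use B in \<open>auto simp: P_def\<close>)
      then have "card B \<le> card (B - {k})" by (rule min)
      then show False using card_Diff1_less[OF fin k(1)] by simp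
    qed
  qed (use B in \<open>auto simp: P_def\<close>)
qed

lemma discrete_dual_norm_bounds:
  assumes K: "K \<ge> 0" and le: "\<And>\<phi>. \<phi> \<in> V \<Longrightarrow> blinfun_apply \<psi> \<phi> \<le> K * norm \<phi>"
  shows "0 \<le> discrete_dual_norm V \<psi>" "discrete_dual_norm V \<psi> \<le> K"
proof -
  let ?S = "insert 0 {blinfun_apply \<psi> \<phi> / norm \<phi> | \<phi>. \<phi> \<in> V \<and> \<phi> \<noteq> 0}"
  have ub: "s \<le> K" if "s \<in> ?S" for s
    using that K le by (auto simp: divide_le_eq)
  show "discrete_dual_norm V \<psi> \<le> K"
    unfolding discrete_dual_norm_def by (rule cSup_least) (use ub in auto)
  show "0 \<le> discrete_dual_norm V \<psi>"
    unfolding discrete_dual_norm_def by (rule cSup_upper) (use ub in \<open>auto simp: bdd_above_def\<close>)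
qed

section \<open>The load functional on representatives\<close>

context
  fixes Q :: "(real \<times> 'a::euclidean_space) set" and \<gamma>
    and g :: "(real \<times> 'a) \<times> 'a \<Rightarrow> real"
  assumes trace: "is_inflow_trace Q \<gamma>" and g: "g \<in> L2_functions (inflow_measure Q)"
begin

lemma trace_integrable:
  "p \<in> H1_FP_outflow Q \<Longrightarrow> integrable (inflow_measure Q) (\<lambda>z. g z * \<gamma> p z)"
  using trace g by (intro L2_mult_integrable) (auto simp: is_inflow_trace_def)

lemma load_add:
  assumes p: "p \<in> H1_FP_outflow Q" "q \<in> H1_FP_outflow Q" "(\<lambda>y. p y + q y) \<in> H1_FP_outflow Q"
  shows "load Q \<gamma> g (\<lambda>y. p y + q y) = load Q \<gamma> g p + load Q \<gamma> g q"
proof -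
  have "AE z in inflow_measure Q. \<gamma> (\<lambda>y. p y + q y) z = \<gamma> p z + \<gamma> q z"
    using trace p by (simp add: is_inflow_trace_def)
  then have "AE z in inflow_measure Q. g z * \<gamma> (\<lambda>y. p y + q y) z = g z * \<gamma> p z + g z * \<gamma> q z"
    by eventually_elim (simp add: distrib_left)
  then have "load Q \<gamma> g (\<lambda>y. p y + q y) = (\<integral>z. g z * \<gamma> p z + g z * \<gamma> q z \<partial>inflow_measure Q)"
    unfolding load_def using trace_integrable[OF p(1)] trace_integrable[OF p(2)] trace_integrable[OF p(3)]
    by (intro integral_cong_AE) auto
  then show ?thesis
    unfolding load_def using trace_integrable[OF p(1)] trace_integrable[OF p(2)] by simp
qed

lemma load_scaleR:
  assumes p: "p \<in> H1_FP_outflow Q" "(\<lambda>y. c *\<^sub>R p y) \<in> H1_FP_outflow Q"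
  shows "load Q \<gamma> g (\<lambda>y. c *\<^sub>R p y) = c * load Q \<gamma> g p"
proof -
  have "AE z in inflow_measure Q. \<gamma> (\<lambda>y. c *\<^sub>R p y) z = c * \<gamma> p z"
    using trace p by (simp add: is_inflow_trace_def)
  then have "AE z in inflow_measure Q. g z * \<gamma> (\<lambda>y. c *\<^sub>R p y) z = c * (g z * \<gamma> p z)"
    by eventually_elim simp
  then have "load Q \<gamma> g (\<lambda>y. c *\<^sub>R p y) = (\<integral>z. c * (g z * \<gamma> p z) \<partial>inflow_measure Q)"
    unfolding load_def using trace_integrable[OF p(1)] trace_integrable[OF p(2)]
    by (intro integral_cong_AE) auto
  then show ?thesis unfolding load_def by simp
qed

text \<open>The trace acts on functions and not on classes; it is its bound in the graph norm that
  makes the trace of a null function vanish. Together with additivity this makes the load well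
  defined modulo null sets.\<close>

lemma load_AE_zero:
  assumes Q: "open Q" and p: "p \<in> H1_FP_outflow Q" and z: "AE y in lebesgue_on Q. p y = 0"
  shows "load Q \<gamma> g p = 0"
proof -
  have pH: "p \<in> H1_FP Q" using p by (simp add: H1_FP_outflow_def)
  note D = H1_FP_D[OF Q pH]
  \<comment> \<open>The zero function written as a multiple of p, because the derivative of a
    multiple is known from scaling.\<close>
  have sp: "(\<lambda>y. 0 *\<^sub>R p y) \<in> H1_FP Q" by (rule H1_FP_scaleR[OF Q pH])
  have "AE y in lebesgue_on Q. kinetic_derivative Q p y = 0"
    using kinetic_derivative_AE_eq[OF Q pH sp] kinetic_derivative_scaleR[OF Q pH, of 0] z
    by (auto elim: eventually_elim2)
  then have "H1_FP_norm Q p = 0"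
    using z bochner_norm_eq_0_iff[OF D(1)] bochner_norm_eq_0_iff[OF D(3)] by (simp add: H1_FP_norm_def)
  moreover obtain C where "sqrt (\<integral>z. (\<gamma> p z)\<^sup>2 \<partial>inflow_measure Q) \<le> C * H1_FP_norm Q p"
    using trace p by (auto simp: is_inflow_trace_def)
  ultimately have "(\<integral>z. (\<gamma> p z)\<^sup>2 \<partial>inflow_measure Q) \<le> 0" by simp
  moreover have "0 \<le> (\<integral>z. (\<gamma> p z)\<^sup>2 \<partial>inflow_measure Q)" by simp
  ultimately have i0: "(\<integral>z. (\<gamma> p z)\<^sup>2 \<partial>inflow_measure Q) = 0" by linarith
  have "\<gamma> p \<in> L2_functions (inflow_measure Q)" using trace p by (simp add: is_inflow_trace_def)
  then have "integrable (inflow_measure Q) (\<lambda>z. (\<gamma> p z)\<^sup>2)" by (simp add: L2_functions_def)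
  then have "AE z in inflow_measure Q. (\<gamma> p z)\<^sup>2 = 0"
    using i0 by (subst (asm) integral_nonneg_eq_0_iff_AE) auto
  then have "AE z in inflow_measure Q. g z * \<gamma> p z = 0" by eventually_elim simp
  then show ?thesis unfolding load_def by (rule integral_eq_zero_AE)
qed

end

section \<open>The local problems on \<open>Vh\<close> and the form b\<close>

context
  fixes Q :: "(real \<times> 'a::euclidean_space) set"
    and a :: "real \<times> 'a \<Rightarrow> 'a H1_sphere \<Rightarrow> 'a H1_sphere \<Rightarrow> real"
    and c\<^sub>a \<alpha>\<^sub>a :: real and E Vh :: "'a H1_sphere set"
  assumes Q: "open Q"
    and a_measurable: "\<And>\<phi> \<psi>. (\<lambda>y. a y \<phi> \<psi>) \<in> borel_measurable (lebesgue_on Q)"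
    and a_bilinear: "AE y in lebesgue_on Q. bilinear (a y)"
    and a_bounded: "AE y in lebesgue_on Q. \<forall>\<phi> \<psi>. a y \<phi> \<psi> \<le> c\<^sub>a * norm \<phi> * norm \<psi>"
    and a_coercive: "AE y in lebesgue_on Q. \<forall>\<phi>. \<alpha>\<^sub>a * (norm \<phi>)\<^sup>2 \<le> a y \<phi> \<phi>"
    and \<alpha>: "\<alpha>\<^sub>a > 0"
    and E: "finite E" "pairwise orthogonal E" "\<And>e. e \<in> E \<Longrightarrow> norm e = 1"
    and Vh: "Vh = span E"
begin

abbreviation (input) "M \<equiv> lebesgue_on Q"

lemma M_complete: "complete_measure M"
  by (rule complete_Q[OF Q])

lemma Vh_expand: "x \<in> Vh \<Longrightarrow> (\<Sum>e\<in>E. (x \<bullet> e) *\<^sub>R e) = x"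
  unfolding Vh by (rule orthonormal_basis_expand[OF E(2,3) _ E(1)])

lemma Vh_subspace: "subspace Vh"
  unfolding Vh by (rule subspace_span)

lemma coefficient_measurable:
  assumes "w \<in> bochner_L2 M"
  shows "(\<lambda>y. w y \<bullet> e) \<in> borel_measurable M"
proof (rule complete_measure.strongly_measurable_imp_borel[OF M_complete])
  have "strongly_measurable M w" using assms by (simp add: bochner_L2_def)
  then show "strongly_measurable M (\<lambda>y. w y \<bullet> e)"
    by (rule strongly_measurable_compose) (intro tendsto_intros)
qed

lemma bilinear_expand:
  assumes b: "bilinear (a y)"
  shows "a y (\<Sum>i\<in>E. c i *\<^sub>R i) (\<Sum>j\<in>E. d j *\<^sub>R j) = (\<Sum>j\<in>E. d j * (\<Sum>i\<in>E. a y i j * c i))"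
proof -
  have l: "linear (\<lambda>x. a y x z)" "linear (\<lambda>z. a y x z)" for x z using b by (auto simp: bilinear_def)
  show ?thesis
    by (simp add: linear_sum[OF l(2)] linear_scale[OF l(2)] linear_sum[OF l(1)] linear_scale[OF l(1)] mult.commute)
qed

text \<open>The assumed bound is one-sided; applying it to -\<phi> bounds the absolute value. The
  maximum with 1 makes the constant nonnegative whatever the sign of
  \<open>c\<^sub>a\<close>.\<close>

lemma a_abs_bound: "AE y in M. \<forall>\<phi> \<psi>. \<bar>a y \<phi> \<psi>\<bar> \<le> max 1 c\<^sub>a * (norm \<phi> * norm \<psi>)"
  using a_bounded a_bilinear
proof eventually_elim
  case (elim y)
  have l: "linear (\<lambda>x. a y x z)" for z using elim by (auto simp: bilinear_def)
  show ?case
  proof (intro allI)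
    fix \<phi> \<psi>
    have le: "a y \<phi>' \<psi> \<le> max 1 c\<^sub>a * (norm \<phi>' * norm \<psi>)" for \<phi>'
    proof -
      have "a y \<phi>' \<psi> \<le> c\<^sub>a * (norm \<phi>' * norm \<psi>)" using elim(1) by (simp add: mult.assoc)
      also have "\<dots> \<le> max 1 c\<^sub>a * (norm \<phi>' * norm \<psi>)" by (intro mult_right_mono) auto
      finally show ?thesis .
    qed
    have "a y (- \<phi>) \<psi> = - a y \<phi> \<psi>" using linear_neg[OF l] by simp
    then show "\<bar>a y \<phi> \<psi>\<bar> \<le> max 1 c\<^sub>a * (norm \<phi> * norm \<psi>)"
      using le[of \<phi>] le[of "- \<phi>"] by simp
  qed
qed

text \<open>Measurability of a is assumed for constant arguments only. For arguments in
  \<open>Vh\<close> the expansion in the orthonormal basis turns the integrand into a finite sum of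
  measurable coefficients.\<close>

lemma a_integrable:
  assumes w: "w \<in> bochner_L2 M" "AE y in M. w y \<in> Vh" and p: "p \<in> bochner_L2 M" "AE y in M. p y \<in> Vh"
  shows "integrable M (\<lambda>y. a y (w y) (p y))"
proof (rule Bochner_Integration.integrable_bound)
  show "integrable M (\<lambda>y. max 1 c\<^sub>a * (norm (w y) * norm (p y)))"
    by (intro integrable_mult_right L2_mult_integrable bochner_L2_norm M_complete w p)
  show "AE y in M. norm (a y (w y) (p y)) \<le> norm (max 1 c\<^sub>a * (norm (w y) * norm (p y)))"
    using a_abs_bound by eventually_elim (simp add: order_trans[OF _ abs_ge_self])
  show "(\<lambda>y. a y (w y) (p y)) \<in> borel_measurable M"
  proof (rule complete_measure.borel_measurable_AE_eq[OF M_complete])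
    show "(\<lambda>y. \<Sum>j\<in>E. (p y \<bullet> j) * (\<Sum>i\<in>E. a y i j * (w y \<bullet> i))) \<in> borel_measurable M"
      by (intro borel_measurable_sum borel_measurable_times a_measurable coefficient_measurable w p)
    show "AE y in M. (\<Sum>j\<in>E. (p y \<bullet> j) * (\<Sum>i\<in>E. a y i j * (w y \<bullet> i))) = a y (w y) (p y)"
      using a_bilinear w(2) p(2)
    proof eventually_elim
      case (elim y)
      show ?case
        using bilinear_expand[OF elim(1), of "\<lambda>i. w y \<bullet> i" "\<lambda>j. p y \<bullet> j"]
        by (simp only: Vh_expand[OF elim(2)] Vh_expand[OF elim(3)])
    qed
  qed
qed

text \<open>In the basis E the local problem is a linear system with matrix a y i j, positive
  definite by coercivity for almost every y, so elimination gives measurable coordinates. Testing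
  with z itself yields \<alpha> |z| <= |r|, hence square integrability.\<close>

lemma local_solution_exists:
  assumes p: "p \<in> H1_FP Q"
  shows "\<exists>z. is_local_solution Q a Vh p z"
proof -
  define r where "r y = - kinetic_derivative Q p y" for y
  have rL: "r \<in> bochner_L2 M"
    using bochner_L2_scaleR[OF H1_FP_D(3)[OF Q p], of "-1"] by (simp add: r_def[abs_def])
  have "\<exists>x. (\<forall>i\<in>E. x i \<in> borel_measurable M) \<and>
    (\<forall>y. (\<forall>c. (\<exists>i\<in>E. c i \<noteq> 0) \<longrightarrow> (\<Sum>j\<in>E. c j * (\<Sum>i\<in>E. a y i j * c i)) > 0) \<longrightarrow>
         (\<forall>j\<in>E. (\<Sum>i\<in>E. a y i j * x i y) = blinfun_apply (r y) j))"
    by (rule measurable_positive_definite_system[OF E(1)])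
       (use a_measurable blinfun_apply_L2[OF Q rL] in \<open>auto simp: L2_functions_def\<close>)
  then obtain x where xm: "\<forall>i\<in>E. x i \<in> borel_measurable M"
    and xs: "\<forall>y. (\<forall>c. (\<exists>i\<in>E. c i \<noteq> 0) \<longrightarrow> (\<Sum>j\<in>E. c j * (\<Sum>i\<in>E. a y i j * c i)) > 0) \<longrightarrow>
         (\<forall>j\<in>E. (\<Sum>i\<in>E. a y i j * x i y) = blinfun_apply (r y) j)"
    by (elim exE conjE) (rule that)
  define z where "z y = (\<Sum>i\<in>E. x i y *\<^sub>R i)" for y
  have zV: "z y \<in> Vh" for y
    unfolding z_def Vh by (intro span_sum span_scale span_base)
  have zs: "AE y in M. \<forall>\<phi>\<in>Vh. a y (z y) \<phi> = blinfun_apply (r y) \<phi>"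
    using a_bilinear a_coercive
  proof eventually_elim
    case (elim y)
    have eqs: "\<forall>j\<in>E. (\<Sum>i\<in>E. a y i j * x i y) = blinfun_apply (r y) j"
    proof (rule mp[OF spec[OF xs]], intro allI impI)
      fix c :: "'a H1_sphere \<Rightarrow> real" assume c: "\<exists>i\<in>E. c i \<noteq> 0"
      define \<phi> where "\<phi> = (\<Sum>i\<in>E. c i *\<^sub>R i)"
      have "\<phi> \<noteq> 0"
      proof
        assume 0: "\<phi> = 0"
        obtain k where k: "k \<in> E" "c k \<noteq> 0" using c by blast
        have "0 = \<phi> \<bullet> k" using 0 by simp
        also have "\<dots> = (\<Sum>i\<in>E. c i * (i \<bullet> k))" by (simp add: \<phi>_def inner_sum_left)
        also have "\<dots> = (\<Sum>i\<in>E. if i = k then c k else 0)"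
          using E(2,3) k(1) by (intro sum.cong) (auto simp: pairwise_def orthogonal_def norm_eq_1)
        also have "\<dots> = c k" using E(1) k(1) by simp
        finally show False using k(2) by simp
      qed
      then have "0 < \<alpha>\<^sub>a * (norm \<phi>)\<^sup>2" using \<alpha> by simp
      also have "\<dots> \<le> a y \<phi> \<phi>" using elim(2) by blast
      also have "\<dots> = (\<Sum>j\<in>E. c j * (\<Sum>i\<in>E. a y i j * c i))"
        unfolding \<phi>_def by (rule bilinear_expand[OF elim(1)])
      finally show "0 < (\<Sum>j\<in>E. c j * (\<Sum>i\<in>E. a y i j * c i))" .
    qed
    show ?case
    proof
      fix \<phi> assume \<phi>: "\<phi> \<in> Vh"
      have "a y (z y) (\<Sum>j\<in>E. (\<phi> \<bullet> j) *\<^sub>R j) = (\<Sum>j\<in>E. (\<phi> \<bullet> j) * (\<Sum>i\<in>E. a y i j * x i y))"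
        unfolding z_def by (rule bilinear_expand[OF elim(1)])
      also have "\<dots> = (\<Sum>j\<in>E. (\<phi> \<bullet> j) * blinfun_apply (r y) j)"
        using eqs by (intro sum.cong) auto
      also have "\<dots> = blinfun_apply (r y) (\<Sum>j\<in>E. (\<phi> \<bullet> j) *\<^sub>R j)"
        by (simp add: blinfun.sum_right blinfun.scaleR_right)
      finally show "a y (z y) \<phi> = blinfun_apply (r y) \<phi>" by (simp only: Vh_expand[OF \<phi>])
    qed
  qed
  have "z \<in> bochner_L2 M"
  proof (rule bochner_L2I[OF M_complete])
    show "strongly_measurable M z"
      unfolding z_def[abs_def] using xm
      by (intro strongly_measurable_sum strongly_measurable_scaleR strongly_measurable_const strongly_measurable_real) auto
    show "(\<lambda>y. (1 / \<alpha>\<^sub>a) *\<^sub>R norm (r y)) \<in> L2_functions M"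
      by (intro L2_scale bochner_L2_norm M_complete rL)
    show "AE y in M. norm (z y) \<le> (1 / \<alpha>\<^sub>a) *\<^sub>R norm (r y)"
      using zs a_coercive
    proof eventually_elim
      case (elim y)
      have "\<alpha>\<^sub>a * (norm (z y))\<^sup>2 \<le> a y (z y) (z y)" using elim(2) by blast
      also have "\<dots> = blinfun_apply (r y) (z y)" using elim(1) zV by blast
      also have "\<dots> \<le> norm (r y) * norm (z y)" using norm_blinfun[of "r y" "z y"] by simp
      finally have "(\<alpha>\<^sub>a * norm (z y)) * norm (z y) \<le> norm (r y) * norm (z y)"
        by (simp add: power2_eq_square mult.assoc)
      then have "\<alpha>\<^sub>a * norm (z y) \<le> norm (r y)"
        by (cases "z y = 0") (auto dest: mult_right_le_imp_le)
      then show ?case using \<alpha> by (simp add: field_simps)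
    qed
  qed
  then have "is_local_solution Q a Vh p z"
    using zV zs by (simp add: is_local_solution_def r_def)
  then show ?thesis by blast
qed

lemma local_solution_D:
  assumes "is_local_solution Q a Vh p z"
  shows "z \<in> bochner_L2 M" "AE y in M. z y \<in> Vh"
    "AE y in M. \<forall>\<phi>\<in>Vh. a y (z y) \<phi> = blinfun_apply (- kinetic_derivative Q p y) \<phi>"
  using assms by (auto simp: is_local_solution_def)

lemma local_solution_add:
  assumes p: "p \<in> H1_FP Q" "p' \<in> H1_FP Q"
    and z: "is_local_solution Q a Vh p z" "is_local_solution Q a Vh p' z'"
  shows "is_local_solution Q a Vh (\<lambda>y. p y + p' y) (\<lambda>y. z y + z' y)"
  unfolding is_local_solution_def
proof (intro conjI)
  note D = local_solution_D[OF z(1)] and D' = local_solution_D[OF z(2)]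
  show "(\<lambda>y. z y + z' y) \<in> bochner_L2 M" by (rule bochner_L2_add[OF M_complete D(1) D'(1)])
  show "AE y in M. z y + z' y \<in> Vh"
    using D(2) D'(2) by eventually_elim (rule subspace_add[OF Vh_subspace])
  show "AE y in M. \<forall>\<phi>\<in>Vh. a y (z y + z' y) \<phi> = blinfun_apply (- kinetic_derivative Q (\<lambda>y. p y + p' y) y) \<phi>"
    using D(3) D'(3) kinetic_derivative_add[OF Q p] a_bilinear
  proof eventually_elim
    case (elim y)
    then show ?case by (simp add: bilinear_ladd blinfun.add_left blinfun.diff_left blinfun.minus_left)
  qed
qed

lemma local_solution_scaleR:
  assumes p: "p \<in> H1_FP Q" and z: "is_local_solution Q a Vh p z"
  shows "is_local_solution Q a Vh (\<lambda>y. c *\<^sub>R p y) (\<lambda>y. c *\<^sub>R z y)"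
  unfolding is_local_solution_def
proof (intro conjI)
  note D = local_solution_D[OF z]
  show "(\<lambda>y. c *\<^sub>R z y) \<in> bochner_L2 M" by (rule bochner_L2_scaleR[OF D(1)])
  show "AE y in M. c *\<^sub>R z y \<in> Vh"
    using D(2) by eventually_elim (rule subspace_scale[OF Vh_subspace])
  show "AE y in M. \<forall>\<phi>\<in>Vh. a y (c *\<^sub>R z y) \<phi> = blinfun_apply (- kinetic_derivative Q (\<lambda>y. c *\<^sub>R p y) y) \<phi>"
    using D(3) kinetic_derivative_scaleR[OF Q p, of c] a_bilinear
  proof eventually_elim
    case (elim y)
    then show ?case by (simp add: bilinear_lmul blinfun.scaleR_left blinfun.minus_left)
  qed
qed

lemma form_b_integrable:
  assumes w: "w \<in> bochner_L2 M" "AE y in M. w y \<in> Vh" and p: "p \<in> H1_FP Q" "AE y in M. p y \<in> Vh"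
  shows "integrable M (\<lambda>y. blinfun_apply (- kinetic_derivative Q p y) (w y) + a y (w y) (p y))"
proof -
  have "(\<lambda>y. - kinetic_derivative Q p y) \<in> bochner_L2 M"
    using bochner_L2_scaleR[OF H1_FP_D(3)[OF Q p(1)], of "-1"] by simp
  then show ?thesis
    by (intro Bochner_Integration.integrable_add blinfun_pairing_integrable[OF M_complete] a_integrable w p H1_FP_D(1)[OF Q p(1)])
qed

lemma form_b_add_left:
  assumes "w \<in> bochner_L2 M" "AE y in M. w y \<in> Vh" "w' \<in> bochner_L2 M" "AE y in M. w' y \<in> Vh"
    and "p \<in> H1_FP Q" "AE y in M. p y \<in> Vh"
  shows "form_b Q a (\<lambda>y. w y + w' y) p = form_b Q a w p + form_b Q a w' p"
proof -
  have s: "(\<lambda>y. w y + w' y) \<in> bochner_L2 M" "AE y in M. w y + w' y \<in> Vh"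
    using assms bochner_L2_add[OF M_complete] subspace_add[OF Vh_subspace] by (auto elim: eventually_elim2)
  note i = form_b_integrable[OF assms(1,2,5,6)] form_b_integrable[OF assms(3,4,5,6)] form_b_integrable[OF s assms(5,6)]
  have "AE y in M. blinfun_apply (- kinetic_derivative Q p y) (w y + w' y) + a y (w y + w' y) (p y) =
      (blinfun_apply (- kinetic_derivative Q p y) (w y) + a y (w y) (p y)) +
      (blinfun_apply (- kinetic_derivative Q p y) (w' y) + a y (w' y) (p y))"
    using a_bilinear by eventually_elim (simp add: bilinear_ladd blinfun.add_right)
  then have "form_b Q a (\<lambda>y. w y + w' y) p = (\<integral>y. (blinfun_apply (- kinetic_derivative Q p y) (w y) + a y (w y) (p y)) +
      (blinfun_apply (- kinetic_derivative Q p y) (w' y) + a y (w' y) (p y)) \<partial>M)"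
    unfolding form_b_def using i by (intro integral_cong_AE) auto
  then show ?thesis unfolding form_b_def using i by simp
qed

lemma form_b_scaleR_left:
  assumes "w \<in> bochner_L2 M" "AE y in M. w y \<in> Vh" "p \<in> H1_FP Q" "AE y in M. p y \<in> Vh"
  shows "form_b Q a (\<lambda>y. c *\<^sub>R w y) p = c * form_b Q a w p"
proof -
  have s: "(\<lambda>y. c *\<^sub>R w y) \<in> bochner_L2 M" "AE y in M. c *\<^sub>R w y \<in> Vh"
    using assms bochner_L2_scaleR subspace_scale[OF Vh_subspace] by (auto elim: eventually_mono)
  note i = form_b_integrable[OF assms] form_b_integrable[OF s assms(3,4)]
  have "AE y in M. blinfun_apply (- kinetic_derivative Q p y) (c *\<^sub>R w y) + a y (c *\<^sub>R w y) (p y) =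
      c * (blinfun_apply (- kinetic_derivative Q p y) (w y) + a y (w y) (p y))"
    using a_bilinear by eventually_elim (simp add: bilinear_lmul blinfun.scaleR_right distrib_left)
  then have "form_b Q a (\<lambda>y. c *\<^sub>R w y) p =
      (\<integral>y. c * (blinfun_apply (- kinetic_derivative Q p y) (w y) + a y (w y) (p y)) \<partial>M)"
    unfolding form_b_def using i by (intro integral_cong_AE) auto
  then show ?thesis unfolding form_b_def by simp
qed

lemma form_b_add_right:
  assumes "w \<in> bochner_L2 M" "AE y in M. w y \<in> Vh" "p \<in> H1_FP Q" "AE y in M. p y \<in> Vh"
    and "p' \<in> H1_FP Q" "AE y in M. p' y \<in> Vh"
  shows "form_b Q a w (\<lambda>y. p y + p' y) = form_b Q a w p + form_b Q a w p'"
proof -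
  have s: "(\<lambda>y. p y + p' y) \<in> H1_FP Q" "AE y in M. p y + p' y \<in> Vh"
    using assms H1_FP_add[OF Q] subspace_add[OF Vh_subspace] by (auto elim: eventually_elim2)
  note i = form_b_integrable[OF assms(1-4)] form_b_integrable[OF assms(1,2,5,6)] form_b_integrable[OF assms(1,2) s]
  have "AE y in M. blinfun_apply (- kinetic_derivative Q (\<lambda>y. p y + p' y) y) (w y) + a y (w y) (p y + p' y) =
      (blinfun_apply (- kinetic_derivative Q p y) (w y) + a y (w y) (p y)) +
      (blinfun_apply (- kinetic_derivative Q p' y) (w y) + a y (w y) (p' y))"
    using a_bilinear kinetic_derivative_add[OF Q assms(3,5)]
    by eventually_elim (simp add: bilinear_radd blinfun.add_left blinfun.diff_left blinfun.minus_left)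
  then have "form_b Q a w (\<lambda>y. p y + p' y) = (\<integral>y. (blinfun_apply (- kinetic_derivative Q p y) (w y) + a y (w y) (p y)) +
      (blinfun_apply (- kinetic_derivative Q p' y) (w y) + a y (w y) (p' y)) \<partial>M)"
    unfolding form_b_def using i by (intro integral_cong_AE) auto
  then show ?thesis unfolding form_b_def using i by simp
qed

lemma form_b_scaleR_right:
  assumes "w \<in> bochner_L2 M" "AE y in M. w y \<in> Vh" "p \<in> H1_FP Q" "AE y in M. p y \<in> Vh"
  shows "form_b Q a w (\<lambda>y. c *\<^sub>R p y) = c * form_b Q a w p"
proof -
  have s: "(\<lambda>y. c *\<^sub>R p y) \<in> H1_FP Q" "AE y in M. c *\<^sub>R p y \<in> Vh"
    using assms H1_FP_scaleR[OF Q] subspace_scale[OF Vh_subspace] by (auto elim: eventually_mono)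
  note i = form_b_integrable[OF assms] form_b_integrable[OF assms(1,2) s]
  have "AE y in M. blinfun_apply (- kinetic_derivative Q (\<lambda>y. c *\<^sub>R p y) y) (w y) + a y (w y) (c *\<^sub>R p y) =
      c * (blinfun_apply (- kinetic_derivative Q p y) (w y) + a y (w y) (p y))"
    using a_bilinear kinetic_derivative_scaleR[OF Q assms(3), of c]
    by eventually_elim (simp add: bilinear_rmul blinfun.scaleR_left blinfun.minus_left right_diff_distrib)
  then have "form_b Q a w (\<lambda>y. c *\<^sub>R p y) =
      (\<integral>y. c * (blinfun_apply (- kinetic_derivative Q p y) (w y) + a y (w y) (p y)) \<partial>M)"
    unfolding form_b_def using i by (intro integral_cong_AE) auto
  then show ?thesis unfolding form_b_def by simp
qed

lemma form_b_AE_eq_right: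
  assumes "w \<in> bochner_L2 M" "AE y in M. w y \<in> Vh" "p \<in> H1_FP Q" "AE y in M. p y \<in> Vh"
    and "p' \<in> H1_FP Q" "AE y in M. p y = p' y"
  shows "form_b Q a w p = form_b Q a w p'"
proof -
  have s: "AE y in M. p' y \<in> Vh" using assms(4,6) by eventually_elim simp
  have "AE y in M. blinfun_apply (- kinetic_derivative Q p y) (w y) + a y (w y) (p y) =
      blinfun_apply (- kinetic_derivative Q p' y) (w y) + a y (w y) (p' y)"
    using kinetic_derivative_AE_eq[OF Q assms(3,5,6)] assms(6) by eventually_elim simp
  then show ?thesis
    unfolding form_b_def using form_b_integrable[OF assms(1-4)] form_b_integrable[OF assms(1,2,5) s]
    by (intro integral_cong_AE) auto
qed

text \<open>
  Testing the local problem with \<open>p\<close> and with \<open>z\<close> turns the form into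
  \<open>2 \<integral> \<langle>r, p\<rangle> + \<integral> a(z, z) + a(p, p)\<close> with \<open>r = - k \<bullet> \<nabla>p\<close>, where the first integral is nonnegative.
\<close>

lemma form_b_coercive:
  assumes p: "p \<in> H1_FP Q" "AE y in M. p y \<in> Vh" and z: "is_local_solution Q a Vh p z"
    and energy: "(\<integral>y. blinfun_apply (kinetic_derivative Q p y) (p y) \<partial>M) \<le> 0"
  shows "\<alpha>\<^sub>a * ((bochner_norm M p)\<^sup>2 + (bochner_norm M z)\<^sup>2) \<le> form_b Q a (\<lambda>y. p y + z y) p"
proof -
  note D = local_solution_D[OF z] and Dp = H1_FP_D[OF Q p(1)]
  have s: "(\<lambda>y. p y + z y) \<in> bochner_L2 M" "AE y in M. p y + z y \<in> Vh"
    using bochner_L2_add[OF M_complete Dp(1) D(1)] p(2) D(2) subspace_add[OF Vh_subspace]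
    by (auto elim: eventually_elim2)
  have i: "integrable M (\<lambda>y. blinfun_apply (kinetic_derivative Q p y) (p y))"
    "integrable M (\<lambda>y. (norm (p y))\<^sup>2)" "integrable M (\<lambda>y. (norm (z y))\<^sup>2)"
    using blinfun_pairing_integrable[OF M_complete Dp(3,1)] Dp(1) D(1) by (auto simp: bochner_L2_def)
  have "\<alpha>\<^sub>a * ((bochner_norm M p)\<^sup>2 + (bochner_norm M z)\<^sup>2) \<le>
      - 2 * (\<integral>y. blinfun_apply (kinetic_derivative Q p y) (p y) \<partial>M) +
      \<alpha>\<^sub>a * ((\<integral>y. (norm (p y))\<^sup>2 \<partial>M) + (\<integral>y. (norm (z y))\<^sup>2 \<partial>M))"
    using energy by (simp add: bochner_norm_power2)
  also have "\<dots> = (\<integral>y. - 2 * blinfun_apply (kinetic_derivative Q p y) (p y) +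
      \<alpha>\<^sub>a * ((norm (p y))\<^sup>2 + (norm (z y))\<^sup>2) \<partial>M)"
    using i by simp
  also have "\<dots> \<le> form_b Q a (\<lambda>y. p y + z y) p"
    unfolding form_b_def
  proof (rule integral_mono_AE)
    show "integrable M (\<lambda>y. - 2 * blinfun_apply (kinetic_derivative Q p y) (p y) +
        \<alpha>\<^sub>a * ((norm (p y))\<^sup>2 + (norm (z y))\<^sup>2))" using i by simp
    show "AE y in M. - 2 * blinfun_apply (kinetic_derivative Q p y) (p y) + \<alpha>\<^sub>a * ((norm (p y))\<^sup>2 + (norm (z y))\<^sup>2)
        \<le> blinfun_apply (- kinetic_derivative Q p y) (p y + z y) + a y (p y + z y) (p y)"
      using D(2,3) p(2) a_bilinear a_coercive
    proof eventually_elim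
      case (elim y)
      have "a y (z y) (p y) = - blinfun_apply (kinetic_derivative Q p y) (p y)"
        "a y (z y) (z y) = - blinfun_apply (kinetic_derivative Q p y) (z y)"
        using elim(1-3) by (simp_all add: blinfun.minus_left)
      moreover have "\<alpha>\<^sub>a * (norm (p y))\<^sup>2 \<le> a y (p y) (p y)" "\<alpha>\<^sub>a * (norm (z y))\<^sup>2 \<le> a y (z y) (z y)"
        using elim(5) by blast+
      ultimately show ?case
        using elim(4) by (simp add: bilinear_ladd blinfun.add_right blinfun.minus_left distrib_left)
    qed
  qed (rule form_b_integrable[OF s p])
  finally show ?thesis .
qed

section \<open>The Galerkin system and the inf-sup estimate\<close>

context
  fixes Yd :: "(real \<times> 'a \<Rightarrow> 'a H1_sphere) set"
  assumes Yd: "Yd \<subseteq> H1_FP_outflow Q" "finite_dim_function_space (lebesgue_on Q) Yd"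
    and Yd_Vh: "\<And>p. p \<in> Yd \<Longrightarrow> AE y in lebesgue_on Q. p y \<in> Vh"
    and energy: "\<And>p. p \<in> Yd \<Longrightarrow> (\<integral>y. blinfun_apply (kinetic_derivative Q p y) (p y) \<partial>lebesgue_on Q) \<le> 0"
begin

lemma Yd_H1: "p \<in> Yd \<Longrightarrow> p \<in> H1_FP Q" "p \<in> Yd \<Longrightarrow> p \<in> bochner_L2 M"
  using Yd(1) H1_FP_D(1)[OF Q] by (auto simp: H1_FP_outflow_def)

lemma Yd_closed: "(\<lambda>y. 0) \<in> Yd" "p \<in> Yd \<Longrightarrow> q \<in> Yd \<Longrightarrow> (\<lambda>y. p y + q y) \<in> Yd"
    "p \<in> Yd \<Longrightarrow> (\<lambda>y. c *\<^sub>R p y) \<in> Yd"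
  using Yd(2) by (auto simp: finite_dim_function_space_def)

lemma Yd_diff: "p \<in> Yd \<Longrightarrow> q \<in> Yd \<Longrightarrow> (\<lambda>y. p y - q y) \<in> Yd"
  using Yd_closed(2)[OF _ Yd_closed(3)[of q "-1"], of p] by simp

lemma trial_spaceI:
  "p \<in> Yd \<Longrightarrow> is_local_solution Q a Vh p z \<Longrightarrow> (\<lambda>y. p y + z y) \<in> trial_space Q a Vh Yd"
  unfolding trial_space_def by blast

lemma trial_L2:
  assumes "p \<in> Yd" "is_local_solution Q a Vh p z"
  shows "(\<lambda>y. p y + z y) \<in> bochner_L2 M" "AE y in M. p y + z y \<in> Vh"
  using bochner_L2_add[OF M_complete Yd_H1(2)[OF assms(1)] local_solution_D(1)[OF assms(2)]]
    Yd_Vh[OF assms(1)] local_solution_D(2)[OF assms(2)] subspace_add[OF Vh_subspace]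
  by (auto elim: eventually_elim2)

lemma form_b_trial_coercive:
  assumes "p \<in> Yd" "is_local_solution Q a Vh p z"
  shows "\<alpha>\<^sub>a * ((bochner_norm M p)\<^sup>2 + (bochner_norm M z)\<^sup>2) \<le> form_b Q a (\<lambda>y. p y + z y) p"
  by (rule form_b_coercive[OF Yd_H1(1)[OF assms(1)] Yd_Vh[OF assms(1)] assms(2) energy[OF assms(1)]])

lemma local_solution_sum:
  assumes "finite B" "B \<subseteq> Yd" and z: "\<And>b. b \<in> B \<Longrightarrow> is_local_solution Q a Vh b (z b)"
  shows "is_local_solution Q a Vh (\<lambda>y. \<Sum>b\<in>B. c b *\<^sub>R b y) (\<lambda>y. \<Sum>b\<in>B. c b *\<^sub>R z b y)"
  using assms
proof (induction B rule: finite_induct)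
  case empty
  \<comment> \<open>An empty sum needs the zero function to be a local solution for 0; it is
    obtained by scaling an arbitrary one by 0.\<close>
  have 0: "(\<lambda>y. 0) \<in> H1_FP Q" using Yd_H1(1) Yd_closed(1) by blast
  obtain z0 where "is_local_solution Q a Vh (\<lambda>y. 0) z0" using local_solution_exists[OF 0] by blast
  from local_solution_scaleR[OF 0 this, of 0] show ?case by simp
next
  case (insert k B)
  have k: "k \<in> Yd" "B \<subseteq> Yd" using insert.prems(1) by auto
  have "is_local_solution Q a Vh (\<lambda>y. c k *\<^sub>R k y) (\<lambda>y. c k *\<^sub>R z k y)"
    using k insert.prems(2) by (intro local_solution_scaleR Yd_H1) auto
  moreover have "is_local_solution Q a Vh (\<lambda>y. \<Sum>b\<in>B. c b *\<^sub>R b y) (\<lambda>y. \<Sum>b\<in>B. c b *\<^sub>R z b y)"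
    using k insert.prems(2) by (intro insert.IH) auto
  ultimately have "is_local_solution Q a Vh (\<lambda>y. c k *\<^sub>R k y + (\<Sum>b\<in>B. c b *\<^sub>R b y))
      (\<lambda>y. c k *\<^sub>R z k y + (\<Sum>b\<in>B. c b *\<^sub>R z b y))"
    using k insert.hyps(1)
    by (intro local_solution_add Yd_H1(1) Yd_closed(3) finite_dim_function_space_sum[OF Yd(2)]) auto
  then show ?case using insert.hyps by simp
qed

text \<open>The three claims are proved together because additivity of the form in the induction
  step presupposes that the partial sums are square integrable and \<open>Vh\<close>-valued.\<close>

lemma form_b_sum_left:
  assumes "finite B" and w: "\<And>b. b \<in> B \<Longrightarrow> w b \<in> bochner_L2 M" "\<And>b. b \<in> B \<Longrightarrow> AE y in M. w b y \<in> Vh"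
    and p: "p \<in> Yd"
  shows "(\<lambda>y. \<Sum>b\<in>B. c b *\<^sub>R w b y) \<in> bochner_L2 M \<and> (AE y in M. (\<Sum>b\<in>B. c b *\<^sub>R w b y) \<in> Vh) \<and>
    form_b Q a (\<lambda>y. \<Sum>b\<in>B. c b *\<^sub>R w b y) p = (\<Sum>b\<in>B. c b * form_b Q a (w b) p)"
  using assms(1) w
proof (induction B rule: finite_induct)
  case empty
  have p0: "(\<lambda>y. 0 *\<^sub>R p y) \<in> bochner_L2 M" by (rule bochner_L2_scaleR[OF Yd_H1(2)[OF p]])
  have "form_b Q a (\<lambda>y. 0 *\<^sub>R p y) p = 0 * form_b Q a p p"
    by (rule form_b_scaleR_left) (use p Yd_H1 Yd_Vh in auto)
  then show ?case using p0 subspace_0[OF Vh_subspace] by simp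
next
  case (insert k B)
  have IH: "(\<lambda>y. \<Sum>b\<in>B. c b *\<^sub>R w b y) \<in> bochner_L2 M" "AE y in M. (\<Sum>b\<in>B. c b *\<^sub>R w b y) \<in> Vh"
    "form_b Q a (\<lambda>y. \<Sum>b\<in>B. c b *\<^sub>R w b y) p = (\<Sum>b\<in>B. c b * form_b Q a (w b) p)"
    using insert.IH insert.prems by auto
  have k: "w k \<in> bochner_L2 M" "AE y in M. w k y \<in> Vh" using insert.prems by auto
  have ck: "(\<lambda>y. c k *\<^sub>R w k y) \<in> bochner_L2 M" "AE y in M. c k *\<^sub>R w k y \<in> Vh"
    using bochner_L2_scaleR[OF k(1)] k(2) subspace_scale[OF Vh_subspace] by (auto elim: eventually_mono)
  have eq: "(\<Sum>b\<in>insert k B. c b *\<^sub>R w b y) = c k *\<^sub>R w k y + (\<Sum>b\<in>B. c b *\<^sub>R w b y)" for y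
    using insert.hyps by simp
  show ?case
    unfolding eq
  proof (intro conjI)
    show "(\<lambda>y. c k *\<^sub>R w k y + (\<Sum>b\<in>B. c b *\<^sub>R w b y)) \<in> bochner_L2 M"
      by (rule bochner_L2_add[OF M_complete ck(1) IH(1)])
    show "AE y in M. c k *\<^sub>R w k y + (\<Sum>b\<in>B. c b *\<^sub>R w b y) \<in> Vh"
      using ck(2) IH(2) by eventually_elim (rule subspace_add[OF Vh_subspace])
    show "form_b Q a (\<lambda>y. c k *\<^sub>R w k y + (\<Sum>b\<in>B. c b *\<^sub>R w b y)) p =
        (\<Sum>b\<in>insert k B. c b * form_b Q a (w b) p)"
      using form_b_add_left[OF ck IH(1,2) Yd_H1(1)[OF p] Yd_Vh[OF p]]
        form_b_scaleR_left[OF k Yd_H1(1)[OF p] Yd_Vh[OF p], of "c k"] IH(3) insert.hyps by simp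
  qed
qed

lemma form_b_sum_right:
  assumes "finite B" "B \<subseteq> Yd" and w: "w \<in> bochner_L2 M" "AE y in M. w y \<in> Vh"
  shows "form_b Q a w (\<lambda>y. \<Sum>b\<in>B. c b *\<^sub>R b y) = (\<Sum>b\<in>B. c b * form_b Q a w b)"
  using assms(1,2)
proof (induction B rule: finite_induct)
  case empty
  have "form_b Q a w (\<lambda>y. 0 *\<^sub>R (0 :: 'a H1_sphere)) = 0 * form_b Q a w (\<lambda>y. 0)"
    by (rule form_b_scaleR_right[OF w]) (use Yd_closed(1) Yd_H1 Yd_Vh in auto)
  then show ?case by simp
next
  case (insert k B)
  have k: "k \<in> Yd" "B \<subseteq> Yd" using insert.prems by auto
  have ck: "(\<lambda>y. c k *\<^sub>R k y) \<in> Yd" by (rule Yd_closed(3)[OF k(1)])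
  have s: "(\<lambda>y. \<Sum>b\<in>B. c b *\<^sub>R b y) \<in> Yd"
    by (rule finite_dim_function_space_sum[OF Yd(2) insert.hyps(1) k(2)])
  have "form_b Q a w (\<lambda>y. c k *\<^sub>R k y + (\<Sum>b\<in>B. c b *\<^sub>R b y)) =
      c k * form_b Q a w k + (\<Sum>b\<in>B. c b * form_b Q a w b)"
    using form_b_add_right[OF w Yd_H1(1)[OF ck] Yd_Vh[OF ck] Yd_H1(1)[OF s] Yd_Vh[OF s]]
      form_b_scaleR_right[OF w Yd_H1(1)[OF k(1)] Yd_Vh[OF k(1)], of "c k"] insert.IH[OF k(2)] by simp
  then show ?case using insert.hyps by simp
qed

text \<open>The difference of two trial functions is d + e with d in the test space and e a local
  solution for d; testing the difference of the equations with d itself makes d and e vanish by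
  coercivity.\<close>

lemma discrete_solution_unique:
  assumes u: "u \<in> trial_space Q a Vh Yd" "u' \<in> trial_space Q a Vh Yd"
    and eq: "\<And>v. v \<in> Yd \<Longrightarrow> form_b Q a u v = form_b Q a u' v"
  shows "AE y in M. u' y = u y"
proof -
  obtain p z where p: "u = (\<lambda>y. p y + z y)" "p \<in> Yd" "is_local_solution Q a Vh p z"
    using u(1) by (auto simp: trial_space_def)
  obtain p' z' where p': "u' = (\<lambda>y. p' y + z' y)" "p' \<in> Yd" "is_local_solution Q a Vh p' z'"
    using u(2) by (auto simp: trial_space_def)
  define d e where "d = (\<lambda>y. p y - p' y)" and "e = (\<lambda>y. z y - z' y)"
  have d: "d \<in> Yd" unfolding d_def by (rule Yd_diff[OF p(2) p'(2)])
  have e: "is_local_solution Q a Vh d e"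
    using local_solution_add[OF Yd_H1(1)[OF p(2)] H1_FP_scaleR[OF Q Yd_H1(1)[OF p'(2)]] p(3)
        local_solution_scaleR[OF Yd_H1(1)[OF p'(2)] p'(3)], of "-1"]
    by (simp add: d_def e_def)
  note t = trial_L2[OF p(2,3)] and t' = trial_L2[OF p'(2,3)] and s = trial_L2[OF d e]
  have "form_b Q a (\<lambda>y. (d y + e y) + (p' y + z' y)) d = form_b Q a (\<lambda>y. d y + e y) d + form_b Q a (\<lambda>y. p' y + z' y) d"
    by (rule form_b_add_left[OF s t' Yd_H1(1)[OF d] Yd_Vh[OF d]])
  moreover have "(\<lambda>y. (d y + e y) + (p' y + z' y)) = (\<lambda>y. p y + z y)" by (simp add: d_def e_def)
  ultimately have "form_b Q a (\<lambda>y. d y + e y) d = 0"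
    using eq[OF d] p(1) p'(1) by simp
  then have "\<alpha>\<^sub>a * ((bochner_norm M d)\<^sup>2 + (bochner_norm M e)\<^sup>2) \<le> 0"
    using form_b_trial_coercive[OF d e] by simp
  then have "(bochner_norm M d)\<^sup>2 + (bochner_norm M e)\<^sup>2 \<le> 0" using \<alpha> by (simp add: mult_le_0_iff)
  then have "bochner_norm M d = 0" "bochner_norm M e = 0" by (simp_all add: sum_power2_le_zero_iff)
  then have "AE y in M. d y = 0" "AE y in M. e y = 0"
    using bochner_norm_eq_0_iff[OF Yd_H1(2)[OF d]] bochner_norm_eq_0_iff[OF local_solution_D(1)[OF e]] by auto
  then show ?thesis unfolding p(1) p'(1) by eventually_elim (simp add: d_def e_def)
qed

text \<open>Unknowns are the coefficients of the trial functions w_b = b + z_b, equations are the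
  tests with the same basis. The functional L lives on functions, so independence of representatives
  enters as an assumption.\<close>

lemma discrete_solution_exists:
  assumes L_add: "\<And>p q. p \<in> Yd \<Longrightarrow> q \<in> Yd \<Longrightarrow> L (\<lambda>y. p y + q y) = L p + L q"
    and L_scaleR: "\<And>p c. p \<in> Yd \<Longrightarrow> L (\<lambda>y. c *\<^sub>R p y) = c * L p"
    and L_zero: "\<And>p. p \<in> Yd \<Longrightarrow> AE y in M. p y = 0 \<Longrightarrow> L p = (0::real)"
  shows "\<exists>u\<in>trial_space Q a Vh Yd. \<forall>v\<in>Yd. form_b Q a u v = L v"
proof -
  obtain B where B: "B \<subseteq> Yd" "finite B"
    and span: "\<And>p. p \<in> Yd \<Longrightarrow> \<exists>c. AE y in M. p y = (\<Sum>b\<in>B. c b *\<^sub>R b y)"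
    and indep: "\<And>c. AE y in M. (\<Sum>b\<in>B. c b *\<^sub>R b y) = 0 \<Longrightarrow> \<forall>b\<in>B. c b = 0"
    by (rule finite_dim_function_space_basis[OF Yd(2)]) (rule that)
  have "\<forall>b\<in>B. \<exists>z. is_local_solution Q a Vh b z"
    using B(1) local_solution_exists Yd_H1(1) by blast
  then obtain z where z: "\<And>b. b \<in> B \<Longrightarrow> is_local_solution Q a Vh b (z b)" by metis
  define w where "w b y = b y + z b y" for b y
  have w: "w b \<in> bochner_L2 M" "AE y in M. w b y \<in> Vh" if "b \<in> B" for b
    using trial_L2[of b "z b"] z[OF that] B(1) that by (auto simp: w_def[abs_def])
  have BY: "b \<in> Yd" if "b \<in> B" for b using B(1) that by blast
  have sums: "(\<lambda>y. \<Sum>b\<in>B. c b *\<^sub>R w b y) \<in> bochner_L2 M" "AE y in M. (\<Sum>b\<in>B. c b *\<^sub>R w b y) \<in> Vh"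
    "(\<lambda>y. \<Sum>b\<in>B. c b *\<^sub>R b y) \<in> Yd"
    "is_local_solution Q a Vh (\<lambda>y. \<Sum>b\<in>B. c b *\<^sub>R b y) (\<lambda>y. \<Sum>b\<in>B. c b *\<^sub>R z b y)"
    "(\<lambda>y. \<Sum>b\<in>B. c b *\<^sub>R w b y) = (\<lambda>y. (\<Sum>b\<in>B. c b *\<^sub>R b y) + (\<Sum>b\<in>B. c b *\<^sub>R z b y))" for c
    using form_b_sum_left[OF B(2) w Yd_closed(1), where c=c] local_solution_sum[OF B(2,1) z]
      finite_dim_function_space_sum[OF Yd(2) B(2,1)]
    by (auto simp: w_def scaleR_right_distrib sum.distrib)
  \<comment> \<open>The quadratic form of this matrix at c is b(p + z, p) for p with coefficients c;
    p is not a null function by independence of the basis, so coercivity makes the value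
    positive.\<close>
  obtain x where x: "\<And>b'. b' \<in> B \<Longrightarrow> (\<Sum>b\<in>B. form_b Q a (w b) b' * x b) = L b'"
  proof (rule positive_definite_system[OF B(2), of "\<lambda>b b'. form_b Q a (w b) b'" L])
    fix c :: "(real \<times> 'a \<Rightarrow> 'a H1_sphere) \<Rightarrow> real" assume c: "\<exists>b\<in>B. c b \<noteq> 0"
    let ?p = "\<lambda>y. \<Sum>b\<in>B. c b *\<^sub>R b y" and ?z = "\<lambda>y. \<Sum>b\<in>B. c b *\<^sub>R z b y"
    have "\<not> (AE y in M. ?p y = 0)" using c indep[of c] by blast
    then have "bochner_norm M ?p \<noteq> 0" using bochner_norm_eq_0_iff[OF Yd_H1(2)[OF sums(3)]] by blast
    then have "0 < (bochner_norm M ?p)\<^sup>2 + (bochner_norm M ?z)\<^sup>2" by (simp add: add_pos_nonneg)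
    then have "0 < \<alpha>\<^sub>a * ((bochner_norm M ?p)\<^sup>2 + (bochner_norm M ?z)\<^sup>2)" using \<alpha> by simp
    also have "\<dots> \<le> form_b Q a (\<lambda>y. \<Sum>b\<in>B. c b *\<^sub>R w b y) ?p"
      unfolding sums(5) by (rule form_b_trial_coercive[OF sums(3,4)])
    also have "\<dots> = (\<Sum>b'\<in>B. c b' * form_b Q a (\<lambda>y. \<Sum>b\<in>B. c b *\<^sub>R w b y) b')"
      by (rule form_b_sum_right[OF B(2,1) sums(1,2)])
    also have "\<dots> = (\<Sum>b'\<in>B. c b' * (\<Sum>b\<in>B. form_b Q a (w b) b' * c b))"
      using form_b_sum_left[OF B(2) w BY, where c=c]
      by (intro sum.cong refl) (simp add: mult.commute)
    finally show "0 < (\<Sum>b'\<in>B. c b' * (\<Sum>b\<in>B. form_b Q a (w b) b' * c b))" .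
  qed (rule that)
  define u where "u = (\<lambda>y. \<Sum>b\<in>B. x b *\<^sub>R w b y)"
  have uB: "form_b Q a u b' = L b'" if "b' \<in> B" for b'
    using form_b_sum_left[OF B(2) w BY[OF that], where c=x] x[OF that] by (simp add: u_def mult.commute)
  have L_sum: "L (\<lambda>y. \<Sum>b\<in>B'. c b *\<^sub>R b y) = (\<Sum>b\<in>B'. c b * L b)" if "finite B'" "B' \<subseteq> Yd" for B' c
    using that
  proof (induction B' rule: finite_induct)
    case empty
    then show ?case using L_zero[OF Yd_closed(1)] by simp
  next
    case (insert k B')
    then have "L (\<lambda>y. c k *\<^sub>R k y + (\<Sum>b\<in>B'. c b *\<^sub>R b y)) = c k * L k + (\<Sum>b\<in>B'. c b * L b)"
      using L_add[OF Yd_closed(3)[of k "c k"] finite_dim_function_space_sum[OF Yd(2), of B' c]] L_scaleR[of k "c k"]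
      by simp
    then show ?case using insert.hyps by simp
  qed
  have "u \<in> trial_space Q a Vh Yd"
    unfolding u_def sums(5) by (rule trial_spaceI[OF sums(3,4)])
  moreover have "form_b Q a u v = L v" if v: "v \<in> Yd" for v
  proof -
    obtain c where c: "AE y in M. v y = (\<Sum>b\<in>B. c b *\<^sub>R b y)" using span[OF v] by blast
    let ?p = "\<lambda>y. \<Sum>b\<in>B. c b *\<^sub>R b y"
    have uL: "u \<in> bochner_L2 M" "AE y in M. u y \<in> Vh" unfolding u_def by (rule sums)+
    have "form_b Q a u v = form_b Q a u ?p"
      by (rule form_b_AE_eq_right[OF uL Yd_H1(1)[OF v] Yd_Vh[OF v] Yd_H1(1)[OF sums(3)] c])
    also have "\<dots> = (\<Sum>b\<in>B. c b * form_b Q a u b)" by (rule form_b_sum_right[OF B(2,1) uL])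
    also have "\<dots> = (\<Sum>b\<in>B. c b * L b)" using uB by simp
    also have "\<dots> = L ?p" using L_sum[OF B(2,1)] by simp
    \<comment> \<open>v agrees with its expansion only almost everywhere; the difference is a null
      function in the test space, on which L vanishes.\<close>
    also have "\<dots> = L v"
    proof -
      have d: "(\<lambda>y. v y - ?p y) \<in> Yd" by (rule Yd_diff[OF v sums(3)])
      have "AE y in M. v y - ?p y = 0" using c by eventually_elim simp
      then have "L (\<lambda>y. v y - ?p y) = 0" by (rule L_zero[OF d])
      then show ?thesis using L_add[OF sums(3)[of c] d] by simp
    qed
    finally show ?thesis .
  qed
  ultimately show ?thesis by blast
qed

lemma discrete_inf_sup:
  assumes p: "p \<in> Yd" "\<not> (AE y in M. p y = 0)"
  shows "\<exists>w\<in>trial_space Q a Vh Yd. \<not> (AE y in M. w y = 0) \<and>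
    \<alpha>\<^sub>a / (sqrt 2 * max 1 c\<^sub>a) \<le> form_b Q a w p / (bochner_norm M w * discrete_Y_norm Q Vh p)"
proof -
  obtain z where z: "is_local_solution Q a Vh p z"
    using local_solution_exists[OF Yd_H1(1)[OF p(1)]] by blast
  note D = local_solution_D[OF z] and pL = Yd_H1(2)[OF p(1)]
  define w where "w = (\<lambda>y. p y + z y)"
  define S C where "S = (bochner_norm M p)\<^sup>2 + (bochner_norm M z)\<^sup>2" and "C = max 1 c\<^sub>a"
  have C: "C \<ge> 1" by (simp add: C_def)
  have wL: "w \<in> bochner_L2 M" unfolding w_def by (rule trial_L2(1)[OF p(1) z])
  have pn: "bochner_norm M p > 0"
    using bochner_norm_eq_0_iff[OF pL] p(2) bochner_norm_nonneg[of M p] by (simp add: order_less_le)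
  then have S: "S > 0" by (simp add: S_def add_pos_nonneg)
  have form: "\<alpha>\<^sub>a * S \<le> form_b Q a w p"
    unfolding S_def w_def by (rule form_b_trial_coercive[OF p(1) z])
  \<comment> \<open>A vanishing w would give b(w, p) = 0, against the lower bound \<alpha> S > 0; so
    w is admissible in the supremum and its norm may be divided by.\<close>
  have w0: "\<not> (AE y in M. w y = 0)"
  proof
    assume w: "AE y in M. w y = 0"
    have "form_b Q a w p = 0"
      unfolding form_b_def
    proof (rule integral_eq_zero_AE)
      show "AE y in M. blinfun_apply (- kinetic_derivative Q p y) (w y) + a y (w y) (p y) = 0"
        using w a_bilinear by eventually_elim (simp add: bilinear_lzero blinfun.zero_right)
    qed
    then show False using form S \<alpha> by (simp add: mult_le_0_iff)
  qed
  then have wn: "bochner_norm M w > 0"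
    using bochner_norm_eq_0_iff[OF wL] bochner_norm_nonneg[of M w] by (simp add: order_less_le)
  have i: "integrable M (\<lambda>y. (norm (p y))\<^sup>2)" "integrable M (\<lambda>y. (norm (z y))\<^sup>2)" "integrable M (\<lambda>y. (norm (w y))\<^sup>2)"
    using pL D(1) wL by (auto simp: bochner_L2_def)
  have "(bochner_norm M w)\<^sup>2 \<le> (\<integral>y. 2 * (norm (p y))\<^sup>2 + 2 * (norm (z y))\<^sup>2 \<partial>M)"
    unfolding bochner_norm_power2
  proof (rule integral_mono)
    fix y
    have "(norm (w y))\<^sup>2 \<le> (norm (p y) + norm (z y))\<^sup>2"
      by (simp add: w_def norm_triangle_ineq power_mono)
    also have "\<dots> \<le> 2 * (norm (p y))\<^sup>2 + 2 * (norm (z y))\<^sup>2"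
      using sum_squares_bound[of "norm (p y)" "norm (z y)"] by (simp add: power2_sum)
    finally show "(norm (w y))\<^sup>2 \<le> 2 * (norm (p y))\<^sup>2 + 2 * (norm (z y))\<^sup>2" .
  qed (use i in auto)
  also have "\<dots> = 2 * S" using i by (simp add: S_def bochner_norm_power2)
  finally have wle: "bochner_norm M w \<le> sqrt (2 * S)" by (rule real_le_rsqrt)
  \<comment> \<open>On \<open>Vh\<close> the derivative is represented by -a(z, .), so its discrete
    dual norm is controlled by z. Outside \<open>Vh\<close> the local problem gives no information,
    whence the discrete norm in the estimate.\<close>
  have dual: "AE y in M. 0 \<le> discrete_dual_norm Vh (kinetic_derivative Q p y) \<and>
      discrete_dual_norm Vh (kinetic_derivative Q p y) \<le> C * norm (z y)"
    using D(3) D(2) a_abs_bound a_bilinear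
  proof eventually_elim
    case (elim y)
    have "blinfun_apply (kinetic_derivative Q p y) \<phi> \<le> (C * norm (z y)) * norm \<phi>" if \<phi>: "\<phi> \<in> Vh" for \<phi>
    proof -
      have "blinfun_apply (kinetic_derivative Q p y) \<phi> = - a y (z y) \<phi>"
        using elim(1) \<phi> by (simp add: blinfun.minus_left)
      also have "\<dots> \<le> \<bar>a y (z y) \<phi>\<bar>" by simp
      also have "\<dots> \<le> C * (norm (z y) * norm \<phi>)" using elim(3) unfolding C_def by blast
      finally show ?thesis by (simp add: mult.assoc)
    qed
    then show ?case using discrete_dual_norm_bounds[of "C * norm (z y)" Vh "kinetic_derivative Q p y"] C by simp
  qed
  have "(\<integral>y. (discrete_dual_norm Vh (kinetic_derivative Q p y))\<^sup>2 \<partial>M) \<le> (\<integral>y. C\<^sup>2 * (norm (z y))\<^sup>2 \<partial>M)"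
  \<comment> \<open>A function that is not integrable has integral 0 by convention, so the bound
    holds in that case as well.\<close>
  proof (cases "integrable M (\<lambda>y. (discrete_dual_norm Vh (kinetic_derivative Q p y))\<^sup>2)")
    case True
    show ?thesis
    proof (rule integral_mono_AE[OF True])
      show "AE y in M. (discrete_dual_norm Vh (kinetic_derivative Q p y))\<^sup>2 \<le> C\<^sup>2 * (norm (z y))\<^sup>2"
        using dual by eventually_elim (simp add: power_mono flip: power_mult_distrib)
    qed (use i in simp)
  next
    case False
    then show ?thesis by (simp add: not_integrable_integral_eq)
  qed
  also have "\<dots> = C\<^sup>2 * (bochner_norm M z)\<^sup>2" by (simp add: bochner_norm_power2)
  \<comment> \<open>As C >= 1, the term of p may be weighted with C^2 too, so that S factors
    out.\<close>
  finally have "(bochner_norm M p)\<^sup>2 + (\<integral>y. (discrete_dual_norm Vh (kinetic_derivative Q p y))\<^sup>2 \<partial>M)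
      \<le> C\<^sup>2 * (bochner_norm M p)\<^sup>2 + C\<^sup>2 * (bochner_norm M z)\<^sup>2"
    using C mult_right_mono[of 1 "C\<^sup>2" "(bochner_norm M p)\<^sup>2"] by (simp add: one_le_power)
  also have "\<dots> = C\<^sup>2 * S" by (simp add: S_def distrib_left)
  finally have Yle: "discrete_Y_norm Q Vh p \<le> C * sqrt S"
    unfolding discrete_Y_norm_def using C real_sqrt_le_mono[of _ "C\<^sup>2 * S"] by (simp add: real_sqrt_mult)
  have "bochner_norm M p = sqrt ((bochner_norm M p)\<^sup>2)" by (simp add: bochner_norm_nonneg)
  also have "\<dots> \<le> discrete_Y_norm Q Vh p"
    unfolding discrete_Y_norm_def by (intro real_sqrt_le_mono) simp
  finally have Yn: "discrete_Y_norm Q Vh p > 0" using pn by simp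
  have "bochner_norm M w * discrete_Y_norm Q Vh p \<le> sqrt (2 * S) * (C * sqrt S)"
    by (rule mult_mono[OF wle Yle]) (use S Yn in auto)
  also have "\<dots> = sqrt 2 * C * S" using S by (simp add: real_sqrt_mult)
  finally have prod: "bochner_norm M w * discrete_Y_norm Q Vh p \<le> sqrt 2 * C * S" .
  have "\<alpha>\<^sub>a / (sqrt 2 * C) * (bochner_norm M w * discrete_Y_norm Q Vh p) \<le> \<alpha>\<^sub>a / (sqrt 2 * C) * (sqrt 2 * C * S)"
    by (rule mult_left_mono[OF prod]) (use \<alpha> C in auto)
  also have "\<dots> = \<alpha>\<^sub>a * S" using C by simp
  also have "\<dots> \<le> form_b Q a w p" by (rule form)
  finally have "\<alpha>\<^sub>a / (sqrt 2 * C) \<le> form_b Q a w p / (bochner_norm M w * discrete_Y_norm Q Vh p)"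
    using wn Yn by (simp add: pos_le_divide_eq)
  moreover have "w \<in> trial_space Q a Vh Yd" unfolding w_def by (rule trial_spaceI[OF p(1) z])
  ultimately show ?thesis using w0 by (auto simp: C_def)
qed

end

end

theorem proposition5p1:
  fixes \<Omega>x :: "(real ^ 'd) set"
    and Q :: "(real \<times> (real ^ 'd)) set"
    and T c\<^sub>a lam\<^sub>a \<alpha>\<^sub>a :: real
    and a :: "real \<times> (real ^ 'd) \<Rightarrow> (real ^ 'd) H1_sphere \<Rightarrow> (real ^ 'd) H1_sphere \<Rightarrow> real"
    and \<gamma> :: "(real \<times> (real ^ 'd) \<Rightarrow> (real ^ 'd) H1_sphere) \<Rightarrow> (real \<times> (real ^ 'd)) \<times> (real ^ 'd) \<Rightarrow> real"
    and g :: "(real \<times> (real ^ 'd)) \<times> (real ^ 'd) \<Rightarrow> real"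
    and Vh :: "(real ^ 'd) H1_sphere set"
    and Yd :: "(real \<times> (real ^ 'd) \<Rightarrow> (real ^ 'd) H1_sphere) set"
  assumes dim: "CARD('d) = 2 \<or> CARD('d) = 3"
    and domain: "open \<Omega>x" "connected \<Omega>x" "\<Omega>x \<noteq> {}"
    and boundary: "piecewise_C1_boundary \<Omega>x" "lipschitz_boundary \<Omega>x"
    and T: "T > 0"
    and Q: "Q = {0<..<T} \<times> \<Omega>x"
    and a_measurable: "\<And>\<phi> \<psi>. (\<lambda>y. a y \<phi> \<psi>) \<in> borel_measurable (lebesgue_on Q)"
    and a_bilinear: "AE y in lebesgue_on Q. bilinear (a y)"
    and a_bounded: "AE y in lebesgue_on Q. \<forall>\<phi> \<psi>. a y \<phi> \<psi> \<le> c\<^sub>a * norm \<phi> * norm \<psi>"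
    and a_coercive: "AE y in lebesgue_on Q. \<forall>\<phi>.
                       a y \<phi> \<phi> + lam\<^sub>a * (L2_norm_sphere \<phi>)\<^sup>2 \<ge> \<alpha>\<^sub>a * (norm \<phi>)\<^sup>2"
    and constants: "\<alpha>\<^sub>a > 0" "lam\<^sub>a \<le> 0"
    and trace: "is_inflow_trace Q \<gamma>"
    and g: "g \<in> L2_functions (inflow_measure Q)"
    and Vh: "\<exists>B. finite B \<and> Vh = span B"
    and Yd: "Yd \<subseteq> H1_FP_outflow Q" "finite_dim_function_space (lebesgue_on Q) Yd"
    and Yd_Vh: "\<And>p. p \<in> Yd \<Longrightarrow> AE y in lebesgue_on Q. p y \<in> Vh"
  shows "(\<exists>u \<in> trial_space Q a Vh Yd.
            (\<forall>v\<in>Yd. form_b Q a u v = load Q \<gamma> g v) \<and>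
            (\<forall>u' \<in> trial_space Q a Vh Yd.
               (\<forall>v\<in>Yd. form_b Q a u' v = load Q \<gamma> g v) \<longrightarrow>
               (AE y in lebesgue_on Q. u' y = u y))) \<and>
         (\<exists>\<beta>\<^sub>\<delta>::real.
            (INF p\<in>{p \<in> Yd. \<not> (AE y in lebesgue_on Q. p y = 0)}.
               SUP w\<in>{w \<in> trial_space Q a Vh Yd. \<not> (AE y in lebesgue_on Q. w y = 0)}.
                 ereal (form_b Q a w p /
                        (bochner_norm (lebesgue_on Q) w * discrete_Y_norm Q Vh p))) \<ge> ereal \<beta>\<^sub>\<delta> \<and>
            \<beta>\<^sub>\<delta> \<ge> \<alpha>\<^sub>a / (sqrt 2 * max 1 c\<^sub>a))"
proof -
  have dim': "DIM(real ^ 'd) = 2 \<or> DIM(real ^ 'd) = 3" using dim by simp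
  have oQ: "open Q" unfolding Q using domain(1) by (simp add: open_Times)
  obtain B where B: "finite B" "Vh = span B" using Vh by blast
  obtain E where E: "finite E" "span E = span B" "pairwise orthogonal E" "\<And>e. e \<in> E \<Longrightarrow> norm e = 1"
    by (rule orthonormal_basis_of_span[OF B(1)]) (rule that)
  have VE: "Vh = span E" using B(2) E(2) by simp
  have coer: "AE y in lebesgue_on Q. \<forall>\<phi>. \<alpha>\<^sub>a * (norm \<phi>)\<^sup>2 \<le> a y \<phi> \<phi>"
    using a_coercive
  proof eventually_elim
    case (elim y)
    show ?case
    proof
      fix \<phi> :: "(real ^ 'd) H1_sphere"
      have "lam\<^sub>a * (L2_norm_sphere \<phi>)\<^sup>2 \<le> 0" using constants(2) by (simp add: mult_nonpos_nonneg)
      then show "\<alpha>\<^sub>a * (norm \<phi>)\<^sup>2 \<le> a y \<phi> \<phi>" using elim[rule_format, of \<phi>] by linarith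
    qed
  qed
  have energy: "(\<integral>y. blinfun_apply (kinetic_derivative Q p y) (p y) \<partial>lebesgue_on Q) \<le> 0" if "p \<in> Yd" for p
    using that Yd(1) by (intro kinetic_energy_nonpos[OF dim' domain(1) boundary(1) T Q]) auto
  note hyps = oQ a_measurable a_bilinear a_bounded coer constants(1) E(1,3,4) VE Yd Yd_Vh energy
  have Yd_closed: "p \<in> H1_FP_outflow Q" "q \<in> Yd \<Longrightarrow> (\<lambda>y. p y + q y) \<in> H1_FP_outflow Q"
      "(\<lambda>y. c *\<^sub>R p y) \<in> H1_FP_outflow Q" if "p \<in> Yd" for p q c
    using Yd that by (auto simp: finite_dim_function_space_def)
  have "\<exists>u\<in>trial_space Q a Vh Yd. \<forall>v\<in>Yd. form_b Q a u v = load Q \<gamma> g v"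
  proof (rule discrete_solution_exists[OF hyps])
    show "load Q \<gamma> g (\<lambda>y. p y + q y) = load Q \<gamma> g p + load Q \<gamma> g q" if "p \<in> Yd" "q \<in> Yd" for p q
      using that Yd_closed by (intro load_add[OF trace g]) auto
    show "load Q \<gamma> g (\<lambda>y. c *\<^sub>R p y) = c * load Q \<gamma> g p" if "p \<in> Yd" for p c
      using that Yd_closed by (intro load_scaleR[OF trace g]) auto
    show "load Q \<gamma> g p = 0" if "p \<in> Yd" "AE y in lebesgue_on Q. p y = 0" for p
      using that Yd_closed by (intro load_AE_zero[OF trace g oQ]) auto
  qed
  then obtain u where u: "u \<in> trial_space Q a Vh Yd" "\<forall>v\<in>Yd. form_b Q a u v = load Q \<gamma> g v" by blast
  have unique: "AE y in lebesgue_on Q. u' y = u y"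
    if u': "u' \<in> trial_space Q a Vh Yd" "\<forall>v\<in>Yd. form_b Q a u' v = load Q \<gamma> g v" for u'
  proof (rule discrete_solution_unique[OF hyps u(1) u'(1)])
    fix v assume "v \<in> Yd"
    then show "form_b Q a u v = form_b Q a u' v" using u(2) u'(2) by metis
  qed
  \<comment> \<open>The explicit constant itself serves as \<open>\<beta>\<^sub>\<delta>\<close>. In
    \<open>ereal\<close> an infimum over the empty set is infinite, so a test space of null
    functions requires no separate case.\<close>
  have "ereal (\<alpha>\<^sub>a / (sqrt 2 * max 1 c\<^sub>a)) \<le>
      (INF p\<in>{p \<in> Yd. \<not> (AE y in lebesgue_on Q. p y = 0)}.
               SUP w\<in>{w \<in> trial_space Q a Vh Yd. \<not> (AE y in lebesgue_on Q. w y = 0)}.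
                 ereal (form_b Q a w p / (bochner_norm (lebesgue_on Q) w * discrete_Y_norm Q Vh p)))"
  proof (rule INF_greatest)
    fix p assume "p \<in> {p \<in> Yd. \<not> (AE y in lebesgue_on Q. p y = 0)}"
    then have "p \<in> Yd" "\<not> (AE y in lebesgue_on Q. p y = 0)" by auto
    from discrete_inf_sup[OF hyps this] obtain w where
      w: "w \<in> trial_space Q a Vh Yd" "\<not> (AE y in lebesgue_on Q. w y = 0)"
        "\<alpha>\<^sub>a / (sqrt 2 * max 1 c\<^sub>a) \<le> form_b Q a w p / (bochner_norm (lebesgue_on Q) w * discrete_Y_norm Q Vh p)"
      by blast
    show "ereal (\<alpha>\<^sub>a / (sqrt 2 * max 1 c\<^sub>a)) \<le>
        (SUP w\<in>{w \<in> trial_space Q a Vh Yd. \<not> (AE y in lebesgue_on Q. w y = 0)}.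
                 ereal (form_b Q a w p / (bochner_norm (lebesgue_on Q) w * discrete_Y_norm Q Vh p)))"
      by (rule SUP_upper2[of w]) (use w in auto)
  qed
  then show ?thesis using u unique by blast
qed

end
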